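(* Let $(M,\omega)$ be a four-dimensional symplectic manifold, let $\rho_1,\rho_2\colon M\to M$ be two distinct commuting antisymplectic involutions, and let $H\colon M\to\mathbb{R}$ be a smooth function with $H\circ\rho_1=H$ and $H\circ\rho_2=H$. Let $v$ be a doubly symmetric periodic orbit of $X_H$ (with respect to $\rho_1,\rho_2$). Then every $k$-fold cover of $v$, $k\ge1$, is a good periodic orbit.
   Context: Conventions. A diffeomorphism $\rho$ of $M$ is an antisymplectic involution if $\rho^2=\mathrm{id}$ and $\rho^*\omega=-\omega$. The Hamiltonian vector field $X_H$ is defined by $dH=\omega(\cdot,X_H)$, and $\phi^t_H$ denotes its flow. Put $S^1=\mathbb{R}/\mathbb{Z}$. A simple periodic orbit is an injective map $v\colon S^1\to M$ for which there is $\tau>0$ (its period) with $\partial_t v(t)=\tau X_H(v(t))$ for all $t\in S^1$. The $k$-fold cover of a periodic orbit $v$ of period $\tau$ is $t\mapsto v(kt)$, regarded as a periodic orbit of period $k\tau$. Doubly symmetric orbits. A simple periodic orbit $v$ is symmetric with respect to $\rho_1$ if $\rho_1(v(-t))=v(t)$ for all $t\in S^1$. It is doubly symmetric (with respect to $\rho_1,\rho_2$) if it is symmetric with respect to $\rho_1$ and in addition $\rho_2(v(0))=v(\tfrac12)$. Reduced monodromy. For a nonconstant periodic orbit $v$ with period $\tau$ let $\Sigma=H^{-1}(H(v(0)))$, which is a hypersurface near $v$. The linear map $d\phi^\tau_H(v(0))$ preserves $T_{v(0)}\Sigma$ and fixes $X_H(v(0))$. The induced map $M_v$ on the two-dimensional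 symplectic vector space $T_{v(0)}\Sigma/\langle X_H(v(0))\rangle$ is the reduced monodromy; $\det M_v=1$. The orbit $v$ is positive hyperbolic if $\mathrm{tr}(M_v)>2$, negative hyperbolic if $\mathrm{tr}(M_v)<-2$, and elliptic if $-2\le\mathrm{tr}(M_v)\le 2$. A periodic orbit is bad if it is an even cover of a negative hyperbolic orbit; otherwise it is good. *)

theory Defs
  imports "HOL-Analysis.Analysis"
begin

section \<open>Smooth manifolds\<close>

primrec Ck_on :: "nat \<Rightarrow> 'a::real_normed_vector set \<Rightarrow> ('a \<Rightarrow> 'b::real_normed_vector) \<Rightarrow> bool" where
  "Ck_on 0 S = (\<lambda>f. continuous_on S f)"
| "Ck_on (Suc k) S = (\<lambda>f. (\<forall>x\<in>S. f differentiable (at x)) \<and>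
     (\<forall>u. Ck_on k S (\<lambda>x. frechet_derivative f (at x) u)))"

text \<open>Meaningful for open \<open>S\<close> only.\<close>
definition smooth_on :: "'a::real_normed_vector set \<Rightarrow> ('a \<Rightarrow> 'b::real_normed_vector) \<Rightarrow> bool" where
  "smooth_on S f \<longleftrightarrow> (\<forall>k. Ck_on k S f)"

text \<open>The manifold is the whole type \<open>'m\<close>; a chart is a domain together with a coordinate
  map, whose values outside the domain are irrelevant.  Atlases need not be maximal.\<close>
type_synonym ('m, 'e) chart = "'m set \<times> ('m \<Rightarrow> 'e)"

definition chart_inv :: "('m, 'e) chart \<Rightarrow> 'e \<Rightarrow> 'm" where
  "chart_inv c = inv_into (fst c) (snd c)"

definition smooth_atlas ::
  "('m::{t2_space, second_countable_topology}, 'e::euclidean_space) chart set \<Rightarrow> bool" where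
  "smooth_atlas A \<longleftrightarrow>
     (\<forall>c\<in>A. open (fst c) \<and> open (snd c ` fst c) \<and>
        homeomorphism (fst c) (snd c ` fst c) (snd c) (chart_inv c)) \<and>
     (\<Union>c\<in>A. fst c) = UNIV \<and>
     (\<forall>c\<in>A. \<forall>c'\<in>A. smooth_on (snd c ` (fst c \<inter> fst c')) (snd c' \<circ> chart_inv c))"

definition smooth_fun ::
  "('m::topological_space, 'e::euclidean_space) chart set \<Rightarrow> ('m \<Rightarrow> real) \<Rightarrow> bool" where
  "smooth_fun A h \<longleftrightarrow> (\<forall>c\<in>A. smooth_on (snd c ` fst c) (h \<circ> chart_inv c))"

definition smooth_map ::
  "('m::topological_space, 'e::euclidean_space) chart set \<Rightarrow> ('m \<Rightarrow> 'm) \<Rightarrow> bool" where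
  "smooth_map A f \<longleftrightarrow> continuous_on UNIV f \<and>
     (\<forall>c\<in>A. \<forall>c'\<in>A. smooth_on (snd c ` (fst c \<inter> f -` fst c')) (snd c' \<circ> f \<circ> chart_inv c))"

definition diffeomorphism ::
  "('m::topological_space, 'e::euclidean_space) chart set \<Rightarrow> ('m \<Rightarrow> 'm) \<Rightarrow> bool" where
  "diffeomorphism A f \<longleftrightarrow> bij f \<and> smooth_map A f \<and> smooth_map A (inv f)"


section \<open>Tangent spaces\<close>

text \<open>A tangent vector at \<open>p\<close> is the family of its coordinate representations in the charts
  around \<open>p\<close>, which transform into each other by the differentials of the coordinate changes.
  It is set to \<open>0\<close> at all other arguments, so that equality of families is equality of
  tangent vectors.  The vector space operations are pointwise.\<close>
type_synonym ('m, 'e) tvec = "('m, 'e) chart \<Rightarrow> 'e"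

definition tangent_space ::
  "('m, 'e::euclidean_space) chart set \<Rightarrow> 'm \<Rightarrow> ('m, 'e) tvec set" where
  "tangent_space A p = {X.
     (\<forall>c. \<not> (c \<in> A \<and> p \<in> fst c) \<longrightarrow> X c = 0) \<and>
     (\<forall>c\<in>A. \<forall>c'\<in>A. p \<in> fst c \<and> p \<in> fst c' \<longrightarrow>
        X c' = frechet_derivative (snd c' \<circ> chart_inv c) (at (snd c p)) (X c))}"

definition tlin :: "real \<Rightarrow> ('m, 'e::euclidean_space) tvec \<Rightarrow> real \<Rightarrow> ('m, 'e) tvec \<Rightarrow> ('m, 'e) tvec" where
  "tlin a X b Y = (\<lambda>c. a *\<^sub>R X c + b *\<^sub>R Y c)"

text \<open>The tangent vector at \<open>p\<close> whose representation in the chart \<open>c\<close> is \<open>u\<close>.\<close>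
definition coord_tvec ::
  "('m, 'e::euclidean_space) chart set \<Rightarrow> ('m, 'e) chart \<Rightarrow> 'm \<Rightarrow> 'e \<Rightarrow> ('m, 'e) tvec" where
  "coord_tvec A c p u = (\<lambda>c'. if c' \<in> A \<and> p \<in> fst c'
     then frechet_derivative (snd c' \<circ> chart_inv c) (at (snd c p)) u else 0)"

definition chart_at :: "('m, 'e) chart set \<Rightarrow> 'm \<Rightarrow> ('m, 'e) chart" where
  "chart_at A p = (SOME c. c \<in> A \<and> p \<in> fst c)"

text \<open>Differentials of a real function and of a self-map of the manifold at \<open>p\<close>; by the chain
  rule they do not depend on the chart at \<open>p\<close>.\<close>
definition dfun ::
  "('m, 'e::euclidean_space) chart set \<Rightarrow> ('m \<Rightarrow> real) \<Rightarrow> 'm \<Rightarrow> ('m, 'e) tvec \<Rightarrow> real" where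
  "dfun A h p X = (let c = chart_at A p in
     frechet_derivative (h \<circ> chart_inv c) (at (snd c p)) (X c))"

definition dmap ::
  "('m, 'e::euclidean_space) chart set \<Rightarrow> ('m \<Rightarrow> 'm) \<Rightarrow> 'm \<Rightarrow> ('m, 'e) tvec \<Rightarrow> ('m, 'e) tvec" where
  "dmap A f p X = (let c = chart_at A p in
     (\<lambda>c'. if c' \<in> A \<and> f p \<in> fst c'
       then frechet_derivative (snd c' \<circ> f \<circ> chart_inv c) (at (snd c p)) (X c) else 0))"

definition has_velocity ::
  "('m::topological_space, 'e::euclidean_space) chart set \<Rightarrow> (real \<Rightarrow> 'm) \<Rightarrow> real \<Rightarrow> ('m, 'e) tvec \<Rightarrow> bool" where
  "has_velocity A \<gamma> t X \<longleftrightarrow> isCont \<gamma> t \<and> X \<in> tangent_space A (\<gamma> t) \<and>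
     (\<forall>c\<in>A. \<gamma> t \<in> fst c \<longrightarrow> ((snd c \<circ> \<gamma>) has_vector_derivative X c) (at t))"

text \<open>Velocities at \<open>p\<close> of curves in \<open>S\<close> through \<open>p\<close>: the tangent space of \<open>S\<close> at \<open>p\<close>
  if \<open>S\<close> is a submanifold near \<open>p\<close>.\<close>
definition tangent_to ::
  "('m::topological_space, 'e::euclidean_space) chart set \<Rightarrow> 'm set \<Rightarrow> 'm \<Rightarrow> ('m, 'e) tvec set" where
  "tangent_to A S p = {X. \<exists>\<gamma>. range \<gamma> \<subseteq> S \<and> \<gamma> 0 = p \<and> has_velocity A \<gamma> 0 X}"


section \<open>Symplectic forms and Hamiltonian flows\<close>

type_synonym ('m, 'e) form2 = "'m \<Rightarrow> ('m, 'e) tvec \<Rightarrow> ('m, 'e) tvec \<Rightarrow> real"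

definition form_in_chart ::
  "('m, 'e::euclidean_space) chart set \<Rightarrow> ('m, 'e) form2 \<Rightarrow> ('m, 'e) chart \<Rightarrow> 'e \<Rightarrow> 'e \<Rightarrow> 'e \<Rightarrow> real" where
  "form_in_chart A \<omega> c u w = (\<lambda>x. let p = chart_inv c x in
     \<omega> p (coord_tvec A c p u) (coord_tvec A c p w))"

definition differential_2form ::
  "('m, 'e::euclidean_space) chart set \<Rightarrow> ('m, 'e) form2 \<Rightarrow> bool" where
  "differential_2form A \<omega> \<longleftrightarrow>
     (\<forall>p. \<forall>X\<in>tangent_space A p. \<forall>Y\<in>tangent_space A p. \<omega> p X Y = - \<omega> p Y X) \<and>
     (\<forall>p. \<forall>X\<in>tangent_space A p. \<forall>Y\<in>tangent_space A p. \<forall>Z\<in>tangent_space A p. \<forall>a b.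
        \<omega> p (tlin a X b Y) Z = a * \<omega> p X Z + b * \<omega> p Y Z) \<and>
     (\<forall>c\<in>A. \<forall>u w. smooth_on (snd c ` fst c) (form_in_chart A \<omega> c u w))"

text \<open>The exterior derivative of a 2-form in a chart, evaluated on the constant vector
  fields \<open>u\<close>, \<open>w\<close>, \<open>z\<close> (whose Lie brackets vanish), is the cyclic sum below.\<close>
definition closed_2form ::
  "('m, 'e::euclidean_space) chart set \<Rightarrow> ('m, 'e) form2 \<Rightarrow> bool" where
  "closed_2form A \<omega> \<longleftrightarrow> (\<forall>c\<in>A. \<forall>x\<in>snd c ` fst c. \<forall>u w z.
     frechet_derivative (form_in_chart A \<omega> c w z) (at x) u
     + frechet_derivative (form_in_chart A \<omega> c z u) (at x) w
     + frechet_derivative (form_in_chart A \<omega> c u w) (at x) z = 0)"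

definition symplectic_manifold ::
  "('m::{t2_space, second_countable_topology}, 'e::euclidean_space) chart set \<Rightarrow> ('m, 'e) form2 \<Rightarrow> bool" where
  "symplectic_manifold A \<omega> \<longleftrightarrow> smooth_atlas A \<and> differential_2form A \<omega> \<and> closed_2form A \<omega> \<and>
     (\<forall>p. \<forall>X\<in>tangent_space A p. (\<forall>Y\<in>tangent_space A p. \<omega> p X Y = 0) \<longrightarrow> X = (\<lambda>_. 0))"

definition antisymplectic_involution ::
  "('m::topological_space, 'e::euclidean_space) chart set \<Rightarrow> ('m, 'e) form2 \<Rightarrow> ('m \<Rightarrow> 'm) \<Rightarrow> bool" where
  "antisymplectic_involution A \<omega> \<rho> \<longleftrightarrow> diffeomorphism A \<rho> \<and> \<rho> \<circ> \<rho> = id \<and>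
     (\<forall>p. \<forall>X\<in>tangent_space A p. \<forall>Y\<in>tangent_space A p.
        \<omega> (\<rho> p) (dmap A \<rho> p X) (dmap A \<rho> p Y) = - \<omega> p X Y)"

definition ham_vf ::
  "('m, 'e::euclidean_space) chart set \<Rightarrow> ('m, 'e) form2 \<Rightarrow> ('m \<Rightarrow> real) \<Rightarrow> 'm \<Rightarrow> ('m, 'e) tvec" where
  "ham_vf A \<omega> H p = (THE X. X \<in> tangent_space A p \<and>
     (\<forall>Y\<in>tangent_space A p. dfun A H p Y = \<omega> p Y X))"

text \<open>The flow is local: its value is meaningful only if the integral curve starting at \<open>p\<close>
  exists up to time \<open>t\<close>.\<close>
definition ham_flow ::
  "('m::topological_space, 'e::euclidean_space) chart set \<Rightarrow> ('m, 'e) form2 \<Rightarrow> ('m \<Rightarrow> real) \<Rightarrow>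
   real \<Rightarrow> 'm \<Rightarrow> 'm" where
  "ham_flow A \<omega> H t p = (THE q. \<exists>\<gamma> I. open I \<and> is_interval I \<and> 0 \<in> I \<and> t \<in> I \<and>
     (\<forall>s\<in>I. has_velocity A \<gamma> s (ham_vf A \<omega> H (\<gamma> s))) \<and> \<gamma> 0 = p \<and> \<gamma> t = q)"


section \<open>Periodic orbits\<close>

text \<open>Maps on the circle \<open>\<real>/\<int>\<close> are represented by functions on the reals of period \<open>1\<close>.\<close>
definition periodic_orbit ::
  "('m::topological_space, 'e::euclidean_space) chart set \<Rightarrow> ('m, 'e) form2 \<Rightarrow> ('m \<Rightarrow> real) \<Rightarrow>
   (real \<Rightarrow> 'm) \<Rightarrow> real \<Rightarrow> bool" where
  "periodic_orbit A \<omega> H v \<tau> \<longleftrightarrow> \<tau> > 0 \<and> (\<forall>t. v (t + 1) = v t) \<and>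
     (\<forall>t. has_velocity A v t (\<lambda>c. \<tau> *\<^sub>R ham_vf A \<omega> H (v t) c))"

definition simple_periodic_orbit ::
  "('m::topological_space, 'e::euclidean_space) chart set \<Rightarrow> ('m, 'e) form2 \<Rightarrow> ('m \<Rightarrow> real) \<Rightarrow>
   (real \<Rightarrow> 'm) \<Rightarrow> real \<Rightarrow> bool" where
  "simple_periodic_orbit A \<omega> H v \<tau> \<longleftrightarrow> periodic_orbit A \<omega> H v \<tau> \<and>
     (\<forall>s t. v s = v t \<longrightarrow> s - t \<in> \<int>)"

definition orbit_cover :: "nat \<Rightarrow> (real \<Rightarrow> 'm) \<Rightarrow> real \<Rightarrow> 'm" where
  "orbit_cover k v = (\<lambda>t. v (real k * t))"

definition symmetric_orbit ::
  "('m::topological_space, 'e::euclidean_space) chart set \<Rightarrow> ('m, 'e) form2 \<Rightarrow> ('m \<Rightarrow> real) \<Rightarrow>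
   ('m \<Rightarrow> 'm) \<Rightarrow> (real \<Rightarrow> 'm) \<Rightarrow> real \<Rightarrow> bool" where
  "symmetric_orbit A \<omega> H \<rho> v \<tau> \<longleftrightarrow> simple_periodic_orbit A \<omega> H v \<tau> \<and> (\<forall>t. \<rho> (v (- t)) = v t)"

definition doubly_symmetric_orbit ::
  "('m::topological_space, 'e::euclidean_space) chart set \<Rightarrow> ('m, 'e) form2 \<Rightarrow> ('m \<Rightarrow> real) \<Rightarrow>
   ('m \<Rightarrow> 'm) \<Rightarrow> ('m \<Rightarrow> 'm) \<Rightarrow> (real \<Rightarrow> 'm) \<Rightarrow> real \<Rightarrow> bool" where
  "doubly_symmetric_orbit A \<omega> H \<rho>\<^sub>1 \<rho>\<^sub>2 v \<tau> \<longleftrightarrow>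
     symmetric_orbit A \<omega> H \<rho>\<^sub>1 v \<tau> \<and> \<rho>\<^sub>2 (v 0) = v (1 / 2)"


section \<open>Reduced monodromy\<close>

text \<open>The class of \<open>Y\<close> modulo the line spanned by \<open>X\<close>.\<close>
definition line_coset :: "('m, 'e::euclidean_space) tvec \<Rightarrow> ('m, 'e) tvec \<Rightarrow> ('m, 'e) tvec set" where
  "line_coset X Y = {tlin 1 Y s X | s. True}"

definition quotient_basis ::
  "('m, 'e::euclidean_space) tvec set \<Rightarrow> ('m, 'e) tvec \<Rightarrow> ('m, 'e) tvec \<Rightarrow> ('m, 'e) tvec \<Rightarrow> bool" where
  "quotient_basis V X e f \<longleftrightarrow> e \<in> V \<and> f \<in> V \<and>
     (\<forall>Q \<in> line_coset X ` V. \<exists>!ab. Q = line_coset X (tlin (fst ab) e (snd ab) f))"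

text \<open>The trace of an endomorphism \<open>T\<close> of a two-dimensional quotient of \<open>V\<close> by the line
  spanned by \<open>X\<close>, computed from its matrix in any basis of the quotient.\<close>
definition quotient_trace ::
  "('m, 'e::euclidean_space) tvec set \<Rightarrow> ('m, 'e) tvec \<Rightarrow>
   (('m, 'e) tvec set \<Rightarrow> ('m, 'e) tvec set) \<Rightarrow> real" where
  "quotient_trace V X T = (THE r. \<exists>e f a b c d. quotient_basis V X e f \<and>
     T (line_coset X e) = line_coset X (tlin a e b f) \<and>
     T (line_coset X f) = line_coset X (tlin c e d f) \<and> r = a + d)"

text \<open>The map induced on cosets by a linear map preserving the line is the direct image.\<close>
definition reduced_monodromy ::
  "('m::topological_space, 'e::euclidean_space) chart set \<Rightarrow> ('m, 'e) form2 \<Rightarrow> ('m \<Rightarrow> real) \<Rightarrow>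
   (real \<Rightarrow> 'm) \<Rightarrow> real \<Rightarrow> ('m, 'e) tvec set \<Rightarrow> ('m, 'e) tvec set" where
  "reduced_monodromy A \<omega> H v \<tau> Q = dmap A (ham_flow A \<omega> H \<tau>) (v 0) ` Q"

definition monodromy_trace ::
  "('m::topological_space, 'e::euclidean_space) chart set \<Rightarrow> ('m, 'e) form2 \<Rightarrow> ('m \<Rightarrow> real) \<Rightarrow>
   (real \<Rightarrow> 'm) \<Rightarrow> real \<Rightarrow> real" where
  "monodromy_trace A \<omega> H v \<tau> =
     quotient_trace (tangent_to A {p. H p = H (v 0)} (v 0)) (ham_vf A \<omega> H (v 0))
       (reduced_monodromy A \<omega> H v \<tau>)"

definition negative_hyperbolic ::
  "('m::topological_space, 'e::euclidean_space) chart set \<Rightarrow> ('m, 'e) form2 \<Rightarrow> ('m \<Rightarrow> real) \<Rightarrow>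
   (real \<Rightarrow> 'm) \<Rightarrow> real \<Rightarrow> bool" where
  "negative_hyperbolic A \<omega> H v \<tau> \<longleftrightarrow> periodic_orbit A \<omega> H v \<tau> \<and> (\<exists>t. v t \<noteq> v 0) \<and>
     monodromy_trace A \<omega> H v \<tau> < -2"

definition bad_orbit ::
  "('m::topological_space, 'e::euclidean_space) chart set \<Rightarrow> ('m, 'e) form2 \<Rightarrow> ('m \<Rightarrow> real) \<Rightarrow>
   (real \<Rightarrow> 'm) \<Rightarrow> real \<Rightarrow> bool" where
  "bad_orbit A \<omega> H v \<tau> \<longleftrightarrow> (\<exists>w \<kappa> m. negative_hyperbolic A \<omega> H w \<kappa> \<and> m > 0 \<and> even m \<and>
     v = orbit_cover m w \<and> \<tau> = real m * \<kappa>)"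

definition good_orbit ::
  "('m::topological_space, 'e::euclidean_space) chart set \<Rightarrow> ('m, 'e) form2 \<Rightarrow> ('m \<Rightarrow> real) \<Rightarrow>
   (real \<Rightarrow> 'm) \<Rightarrow> real \<Rightarrow> bool" where
  "good_orbit A \<omega> H v \<tau> \<longleftrightarrow> periodic_orbit A \<omega> H v \<tau> \<and> \<not> bad_orbit A \<omega> H v \<tau>"

end

theory Submission
  imports Defs
begin

text \<open>
  The idea is that the monodromy of every cover of a doubly symmetric orbit is a square.  Write
  \<open>\<phi>\<close> for the Hamiltonian flow.  The symplectic involution \<open>\<sigma> = \<rho>\<^sub>1 \<circ> \<rho>\<^sub>2\<close> commutes with \<open>\<phi>\<close>, and
  \<open>\<sigma> (v t) = v (t + 1/2)\<close> because this holds at \<open>t = 0\<close>.  For the \<open>j\<close>-fold cover, of period \<open>j * \<tau>\<close>,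
  let \<open>S\<close> be \<open>\<sigma>\<close> or the identity, as \<open>j\<close> is odd or even.  Then \<open>S\<close> acts on the orbit as the shift
  by \<open>j/2\<close>, so that \<open>\<Psi> = S \<circ> \<phi>\<^bsup>j\<tau>/2\<^esup>\<close> fixes every point of the orbit and \<open>\<Psi> \<circ> \<Psi> = \<phi>\<^bsup>j\<tau>\<^esup>\<close> near \<open>v 0\<close>.
  Hence the reduced monodromy of the cover is \<open>N\<^sup>2\<close>, where \<open>N\<close> is the map induced by the
  differential of \<open>\<Psi>\<close> on the two-dimensional quotient, and
  \<open>tr (N\<^sup>2) = (tr N)\<^sup>2 - 2 det N \<ge> -2\<close> as soon as \<open>det N \<le> 1\<close>.

  That \<open>det N\<close> is \<open>1\<close> or \<open>-1\<close> follows from reversibility alone: \<open>\<rho>\<^sub>1\<close> fixes \<open>v 0\<close> and conjugates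
  \<open>\<Psi>\<close> to its inverse, so the map \<open>R\<close> induced by \<open>\<rho>\<^sub>1\<close> satisfies \<open>R\<^sup>2 = 1\<close> and \<open>(N R)\<^sup>2 = 1\<close>; the
  invariance of \<open>\<omega>\<close> under the flow is not needed.  So no cover of \<open>v\<close> is negative hyperbolic
  (\<open>monodromy_trace_cover_ge\<close>, by way of the algebraic \<open>quotient_trace_square_ge\<close>).  If some cover
  of \<open>v\<close> were bad, it would be a cover of a negative hyperbolic orbit \<open>w\<close>; since \<open>v\<close> is injective
  on the circle, \<open>w\<close> is itself a cover of \<open>v\<close>, a contradiction (\<open>cover_good\<close>).

  The analytic work lies in giving the objects their meaning.  The Hamiltonian vector field
  exists and is continuously differentiable in charts by Cramer's rule (\<open>ham_coord_C1\<close>); its flow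
  is single-valued (\<open>integral_curve_unique\<close>) and differentiable at the points of a periodic orbit
  for all times (\<open>flow_differentiable_along_orbit\<close>), by a local existence theorem in Euclidean
  space (\<open>local_flow\<close>) and compactness of the orbit; and the velocities of curves in the energy
  level form the kernel of \<open>dH\<close> (\<open>level_set_tangent\<close>), so that the quotient is a plane.
\<close>

section \<open>Continuously differentiable maps\<close>

text \<open>The function \<open>f\<close> has on \<open>U\<close> the derivative \<open>f'\<close>, and \<open>f'\<close> is continuous in the operator
  norm.  Derivatives are taken with respect to the whole space, so \<open>U\<close> is meant to be open.\<close>
definition C1_on :: "'a::real_normed_vector set \<Rightarrow> ('a \<Rightarrow> 'b::real_normed_vector) \<Rightarrow> ('a \<Rightarrow> 'a \<Rightarrow>\<^sub>L 'b) \<Rightarrow> bool" where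
  "C1_on U f f' \<longleftrightarrow> (\<forall>x\<in>U. (f has_derivative blinfun_apply (f' x)) (at x)) \<and> continuous_on U f'"

lemma C1_onD:
  assumes "C1_on U f f'" shows "x \<in> U \<Longrightarrow> (f has_derivative blinfun_apply (f' x)) (at x)" "continuous_on U f'"
  "x \<in> U \<Longrightarrow> (f has_derivative blinfun_apply (f' x)) (at x within S)"
  using assms unfolding C1_on_def by (auto intro: has_derivative_at_withinI)

text \<open>Existence of such a continuous derivative.\<close>
definition C1 :: "'a::real_normed_vector set \<Rightarrow> ('a \<Rightarrow> 'b::real_normed_vector) \<Rightarrow> bool" where
  "C1 U f \<longleftrightarrow> (\<exists>f'. C1_on U f f')"

lemma C1I:
  assumes "\<And>x. x \<in> U \<Longrightarrow> (f has_derivative blinfun_apply (f' x)) (at x)" "continuous_on U f'"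
  shows "C1 U f"
  using assms unfolding C1_def C1_on_def by blast

lemma C1E:
  assumes "C1 U f"
  obtains f' where "\<And>x. x \<in> U \<Longrightarrow> (f has_derivative blinfun_apply (f' x)) (at x)" "continuous_on U f'"
  using assms unfolding C1_def C1_on_def by blast

lemma C1_continuous_on: "C1 U f \<Longrightarrow> continuous_on U f"
  by (meson C1E continuous_at_imp_continuous_on has_derivative_continuous)

lemma C1_const: "C1 U (\<lambda>x. k)"
  by (rule C1I[where f'="\<lambda>x. 0"]) (auto intro!: derivative_eq_intros)

lemma C1_cong:
  assumes "open U" "\<And>x. x \<in> U \<Longrightarrow> f x = g x" "C1 U f"
  shows "C1 U g"
proof -
  obtain f' where f: "\<And>x. x \<in> U \<Longrightarrow> (f has_derivative blinfun_apply (f' x)) (at x)" "continuous_on U f'"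
    using C1E[OF assms(3)] by metis
  show ?thesis
    by (rule C1I[OF _ f(2)]) (use has_derivative_transform_within_open[OF f(1) assms(1)] assms(2) in blast)
qed

lemma C1_add:
  assumes "C1 U f" "C1 U g" shows "C1 U (\<lambda>x. f x + g x)"
proof -
  obtain f' g' where f: "\<And>x. x \<in> U \<Longrightarrow> (f has_derivative blinfun_apply (f' x)) (at x)" "continuous_on U f'"
    and g: "\<And>x. x \<in> U \<Longrightarrow> (g has_derivative blinfun_apply (g' x)) (at x)" "continuous_on U g'"
    using C1E[OF assms(1)] C1E[OF assms(2)] by metis
  show ?thesis
    by (rule C1I[where f'="\<lambda>x. f' x + g' x"])
      (auto intro!: continuous_intros f g derivative_eq_intros simp: blinfun.add_left)
qed

lemma C1_mult:
  fixes f g :: "'a::real_normed_vector \<Rightarrow> real"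
  assumes "C1 U f" "C1 U g" shows "C1 U (\<lambda>x. f x * g x)"
proof -
  obtain f' g' where f: "\<And>x. x \<in> U \<Longrightarrow> (f has_derivative blinfun_apply (f' x)) (at x)" "continuous_on U f'"
    and g: "\<And>x. x \<in> U \<Longrightarrow> (g has_derivative blinfun_apply (g' x)) (at x)" "continuous_on U g'"
    using C1E[OF assms(1)] C1E[OF assms(2)] by metis
  show ?thesis
    by (rule C1I[where f'="\<lambda>x. g x *\<^sub>R f' x + f x *\<^sub>R g' x"])
      (auto intro!: continuous_intros f g C1_continuous_on[OF assms(1)] C1_continuous_on[OF assms(2)] has_derivative_eq_rhs[OF has_derivative_mult[OF f(1) g(1)]]
       simp: blinfun.add_left blinfun.scaleR_left fun_eq_iff)
qed

lemma C1_inverse: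
  fixes f :: "'a::real_normed_vector \<Rightarrow> real"
  assumes "C1 U f" "\<And>x. x \<in> U \<Longrightarrow> f x \<noteq> 0" shows "C1 U (\<lambda>x. inverse (f x))"
proof -
  obtain f' where f: "\<And>x. x \<in> U \<Longrightarrow> (f has_derivative blinfun_apply (f' x)) (at x)" "continuous_on U f'"
    using C1E[OF assms(1)] by metis
  show ?thesis
    by (rule C1I[where f'="\<lambda>x. (- (inverse (f x) * inverse (f x))) *\<^sub>R f' x"])
      (auto intro!: continuous_intros f C1_continuous_on[OF assms(1)] assms(2) has_derivative_eq_rhs[OF Deriv.has_derivative_inverse[OF _ f(1)]]
       simp: blinfun.scaleR_left blinfun.minus_left fun_eq_iff mult_ac)
qed

lemma C1_scaleR_const:
  fixes f :: "'a::real_normed_vector \<Rightarrow> real"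
  assumes "C1 U f" shows "C1 U (\<lambda>x. f x *\<^sub>R v)"
proof -
  obtain f' where f: "\<And>x. x \<in> U \<Longrightarrow> (f has_derivative blinfun_apply (f' x)) (at x)" "continuous_on U f'"
    using C1E[OF assms(1)] by metis
  show ?thesis
  proof (rule C1I[where f'="\<lambda>x. blinfun_scaleR_left v o\<^sub>L f' x"])
    show "((\<lambda>x. f x *\<^sub>R v) has_derivative blinfun_apply (blinfun_scaleR_left v o\<^sub>L f' x)) (at x)" if "x \<in> U" for x
      by (rule has_derivative_eq_rhs[OF has_derivative_scaleR_left[OF f(1)[OF that]]]) (simp add: fun_eq_iff)
    show "continuous_on U (\<lambda>x. blinfun_scaleR_left v o\<^sub>L f' x)"
      by (intro bounded_bilinear.continuous_on[OF bounded_bilinear_blinfun_compose] f continuous_on_const)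
  qed
qed

lemma C1_sum: "(\<And>i. i \<in> I \<Longrightarrow> C1 U (f i)) \<Longrightarrow> C1 U (\<lambda>x. \<Sum>i\<in>I. f i x)"
  by (induction I rule: infinite_finite_induct) (auto intro: C1_add C1_const)

lemma C1_prod:
  fixes f :: "'i \<Rightarrow> 'a::real_normed_vector \<Rightarrow> real"
  shows "(\<And>i. i \<in> I \<Longrightarrow> C1 U (f i)) \<Longrightarrow> C1 U (\<lambda>x. \<Prod>i\<in>I. f i x)"
  by (induction I rule: infinite_finite_induct) (auto intro: C1_mult C1_const)

lemma C1_det:
  fixes M :: "'a::real_normed_vector \<Rightarrow> real^'n^'n"
  assumes "\<And>i j. C1 U (\<lambda>x. M x $ i $ j)"
  shows "C1 U (\<lambda>x. det (M x))"
  unfolding det_def by (intro C1_sum C1_mult C1_const C1_prod assms)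

lemma C1_vec:
  fixes f :: "'a::real_normed_vector \<Rightarrow> real^'n"
  assumes "\<And>k. C1 U (\<lambda>x. f x $ k)"
  shows "C1 U f"
proof -
  have "C1 U (\<lambda>x. \<Sum>k\<in>UNIV. (f x $ k) *\<^sub>R (axis k 1 :: real^'n))"
    by (intro C1_sum C1_scaleR_const assms)
  moreover have "(\<lambda>x. \<Sum>k\<in>UNIV. (f x $ k) *\<^sub>R (axis k 1 :: real^'n)) = f"
  proof
    fix x show "(\<Sum>k\<in>UNIV. (f x $ k) *\<^sub>R (axis k 1 :: real^'n)) = f x"
      using basis_expansion[of "f x"] by (simp add: scalar_mult_eq_scaleR)
  qed
  ultimately show ?thesis by simp
qed

text \<open>In finite dimension continuity of all directional derivatives is continuity in the
  operator norm.\<close>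
lemma Ck_on_1_C1:
  fixes f :: "'a::euclidean_space \<Rightarrow> 'b::real_normed_vector"
  assumes "Ck_on (Suc 0) S f"
  shows "C1 S f"
proof (rule C1I[where f'="\<lambda>x. Blinfun (frechet_derivative f (at x))"])
  have b: "blinfun_apply (Blinfun (frechet_derivative f (at x))) = frechet_derivative f (at x)"
    and d: "(f has_derivative frechet_derivative f (at x)) (at x)" if "x \<in> S" for x
  proof -
    show *: "(f has_derivative frechet_derivative f (at x)) (at x)"
      using assms that frechet_derivative_works by auto
    show "blinfun_apply (Blinfun (frechet_derivative f (at x))) = frechet_derivative f (at x)"
      using has_derivative_bounded_linear[OF *] by (rule bounded_linear_Blinfun_apply)
  qed
  show "(f has_derivative blinfun_apply (Blinfun (frechet_derivative f (at x)))) (at x)" if "x \<in> S" for x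
    using b[OF that] d[OF that] by simp
  show "continuous_on S (\<lambda>x. Blinfun (frechet_derivative f (at x)))"
  proof (rule continuous_on_blinfun_componentwise)
    fix i :: 'a
    have "continuous_on S (\<lambda>x. frechet_derivative f (at x) i)" using assms by simp
    then show "continuous_on S (\<lambda>x. blinfun_apply (Blinfun (frechet_derivative f (at x))) i)"
      using continuous_on_cong[of S S "\<lambda>x. frechet_derivative f (at x) i"] b by fastforce
  qed
qed

lemma smooth_on_C1:
  fixes f :: "'a::euclidean_space \<Rightarrow> 'b::real_normed_vector"
  assumes "smooth_on S f"
  shows "C1 S f" "C1 S (\<lambda>x. frechet_derivative f (at x) u)"
proof -
  have "Ck_on (Suc 0) S f" "Ck_on (Suc (Suc 0)) S f" using assms unfolding smooth_on_def by blast+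
  then show "C1 S f" "C1 S (\<lambda>x. frechet_derivative f (at x) u)"
    using Ck_on_1_C1 Ck_on.simps(2)[of "Suc 0" S] by metis+
qed

lemma linear_axis_expansion:
  fixes f :: "real^'n \<Rightarrow> 'b::real_vector"
  assumes "linear f"
  shows "f w = (\<Sum>j\<in>UNIV. (w $ j) *\<^sub>R f (axis j 1))"
proof -
  have "f w = f (\<Sum>j\<in>UNIV. (w $ j) *\<^sub>R axis j 1)"
    using basis_expansion[of w] by (simp add: scalar_mult_eq_scaleR)
  then show ?thesis by (simp add: linear_sum[OF assms] linear_cmul[OF assms])
qed

section \<open>Ordinary differential equations over short times\<close>

lemma vector_mean_value:
  fixes u :: "real \<Rightarrow> 'a::real_normed_vector"
  assumes "convex S" "\<And>t. t \<in> S \<Longrightarrow> (u has_vector_derivative u' t) (at t within S)"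
    and "\<And>t. t \<in> S \<Longrightarrow> norm (u' t) \<le> B" "s \<in> S" "t \<in> S"
  shows "norm (u s - u t) \<le> B * \<bar>s - t\<bar>"
proof -
  have "onorm (\<lambda>h. h *\<^sub>R u' x) \<le> B" if "x \<in> S" for x
    using assms(3)[OF that] by (intro onorm_le) (auto simp: mult.commute[of B] intro!: mult_left_mono)
  then show ?thesis
    using differentiable_bound[OF assms(1), of u "\<lambda>x h. h *\<^sub>R u' x" B s t] assms
    unfolding has_vector_derivative_def by auto
qed

text \<open>A substitute for Gronwall's inequality on an interval so short that \<open>L * \<epsilon> \<le> 1/2\<close>: at a point
  where \<open>norm (u t)\<close> is maximal, the mean value inequality bounds the maximum by half of itself
  plus \<open>norm (u 0) + \<epsilon> * b\<close>.\<close>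
lemma short_time_gronwall:
  fixes u :: "real \<Rightarrow> 'a::real_normed_vector"
  assumes \<epsilon>: "\<epsilon> > 0" and L: "L \<ge> 0" "L * \<epsilon> \<le> 1/2" and b: "b \<ge> 0"
    and der: "\<And>t. t \<in> {-\<epsilon>..\<epsilon>} \<Longrightarrow> (u has_vector_derivative u' t) (at t within {-\<epsilon>..\<epsilon>})"
    and bnd: "\<And>t. t \<in> {-\<epsilon>..\<epsilon>} \<Longrightarrow> norm (u' t) \<le> L * norm (u t) + b"
    and t: "t \<in> {-\<epsilon>..\<epsilon>}"
  shows "norm (u t) \<le> 2 * (norm (u 0) + \<epsilon> * b)"
proof -
  have "continuous_on {-\<epsilon>..\<epsilon>} u"
    using der has_vector_derivative_continuous continuous_on_eq_continuous_within by blast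
  then have "continuous_on {-\<epsilon>..\<epsilon>} (\<lambda>t. norm (u t))" by (intro continuous_intros)
  then obtain s where s: "s \<in> {-\<epsilon>..\<epsilon>}" "\<And>t. t \<in> {-\<epsilon>..\<epsilon>} \<Longrightarrow> norm (u t) \<le> norm (u s)"
    using continuous_attains_sup[of "{-\<epsilon>..\<epsilon>}" "\<lambda>t. norm (u t)"] \<epsilon> by auto
  have "norm (u s - u 0) \<le> (L * norm (u s) + b) * \<bar>s - 0\<bar>"
  proof (rule vector_mean_value[where S="{-\<epsilon>..\<epsilon>}" and u'=u'])
    show "norm (u' t) \<le> L * norm (u s) + b" if "t \<in> {-\<epsilon>..\<epsilon>}" for t
      using bnd[OF that] s(2)[OF that] L by (smt (verit) mult_left_mono)
  qed (use der s \<epsilon> in auto)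
  also have "\<dots> \<le> (L * norm (u s) + b) * \<epsilon>"
    using s(1) L b by (intro mult_left_mono) auto
  also have "\<dots> = (L * \<epsilon>) * norm (u s) + \<epsilon> * b" by (simp add: algebra_simps)
  also have "\<dots> \<le> 1/2 * norm (u s) + \<epsilon> * b"
    using L(2) by (intro add_right_mono mult_right_mono) auto
  finally have "norm (u s) \<le> 2 * (norm (u 0) + \<epsilon> * b)"
    using norm_triangle_sub[of "u s" "u 0"] by simp
  then show ?thesis using s(2)[OF t] by simp
qed

text \<open>The Picard iteration is a contraction by the factor \<open>1/2\<close>.  To work in the complete space of
  bounded continuous functions on the whole line, functions on \<open>{-\<epsilon>..\<epsilon>}\<close> are extended by
  constants.\<close>
lemma picard_lindeloef:
  fixes F :: "real \<Rightarrow> 'a::banach \<Rightarrow> 'a"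
  assumes \<epsilon>: "\<epsilon> > 0" and L: "L \<ge> 0" "L * \<epsilon> \<le> 1/2"
    and cont: "\<And>y. continuous_on {-\<epsilon>..\<epsilon>} y \<Longrightarrow> continuous_on {-\<epsilon>..\<epsilon>} (\<lambda>t. F t (y t))"
    and lip: "\<And>t x y. t \<in> {-\<epsilon>..\<epsilon>} \<Longrightarrow> norm (F t x - F t y) \<le> L * norm (x - y)"
  shows "\<exists>y. y 0 = x0 \<and>
    (\<forall>t\<in>{-\<epsilon>..\<epsilon>}. (y has_vector_derivative F t (y t)) (at t within {-\<epsilon>..\<epsilon>}))"
proof -
  let ?I = "{-\<epsilon>..\<epsilon>}"
  let ?c = "\<lambda>t::real. max (-\<epsilon>) (min \<epsilon> t)"
  have "\<exists>g. g 0 = x0 \<and> (\<forall>t\<in>?I. (g has_vector_derivative F t (apply_bcontfun y t)) (at t within ?I))" for y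
  proof -
    obtain g where g: "\<And>t. t \<in> ?I \<Longrightarrow> (g has_vector_derivative F t (apply_bcontfun y t)) (at t within ?I)"
      using antiderivative_continuous[OF cont[of "apply_bcontfun y"]] by auto
    have "((\<lambda>t. g t + (x0 - g 0)) has_vector_derivative F t (apply_bcontfun y t)) (at t within ?I)" if "t \<in> ?I" for t
      using g[OF that] by (auto intro!: derivative_eq_intros)
    then show ?thesis by (intro exI[of _ "\<lambda>t. g t + (x0 - g 0)"]) auto
  qed
  then obtain G where G0: "\<And>y. G y 0 = x0"
    and G: "\<And>y t. t \<in> ?I \<Longrightarrow> (G y has_vector_derivative F t (apply_bcontfun y t)) (at t within ?I)"
    by metis
  have Gc: "continuous_on ?I (G y)" for y
    using G has_vector_derivative_continuous continuous_on_eq_continuous_within by blast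
  have bc: "(\<lambda>t. G y (?c t)) \<in> bcontfun" for y
  proof -
    have "continuous_on UNIV (\<lambda>t. G y (?c t))"
      using \<epsilon> by (intro continuous_on_compose2[OF Gc] continuous_intros) auto
    moreover have "bounded (range (\<lambda>t. G y (?c t)))"
      using compact_imp_bounded[OF compact_continuous_image[OF Gc compact_Icc]]
      by (rule bounded_subset) (use \<epsilon> in auto)
    ultimately show ?thesis by (simp add: bcontfun_def)
  qed
  define T where "T y = Bcontfun (\<lambda>t. G y (?c t))" for y
  have T: "apply_bcontfun (T y) t = G y (?c t)" for y t
    unfolding T_def using Bcontfun_inverse[OF bc[of y]] by simp
  have contr: "dist (T y) (T z) \<le> 1/2 * dist y z" for y z
  proof (rule dist_bound)
    fix t
    have "norm ((G y (?c t) - G z (?c t)) - (G y 0 - G z 0)) \<le> (L * dist y z) * \<bar>?c t - 0\<bar>"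
    proof (rule vector_mean_value[where S="?I" and u="\<lambda>t. G y t - G z t"])
      fix s assume s: "s \<in> ?I"
      show "((\<lambda>t. G y t - G z t) has_vector_derivative (F s (apply_bcontfun y s) - F s (apply_bcontfun z s))) (at s within ?I)"
        using G[OF s] by (intro has_vector_derivative_diff) auto
      have "norm (apply_bcontfun y s - apply_bcontfun z s) \<le> dist y z"
        using dist_bounded[of y s z] by (simp add: dist_norm)
      then show "norm (F s (apply_bcontfun y s) - F s (apply_bcontfun z s)) \<le> L * dist y z"
        using lip[OF s, of "apply_bcontfun y s" "apply_bcontfun z s"] L by (smt (verit) mult_left_mono)
    qed (use \<epsilon> in auto)
    also have "\<dots> \<le> (L * dist y z) * \<epsilon>"
      using \<epsilon> L by (intro mult_left_mono) auto
    also have "\<dots> = (L * \<epsilon>) * dist y z" by (simp add: algebra_simps)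
    also have "\<dots> \<le> 1/2 * dist y z" using L by (intro mult_right_mono) auto
    finally show "dist (apply_bcontfun (T y) t) (apply_bcontfun (T z) t) \<le> 1/2 * dist y z"
      by (simp add: T G0 dist_norm)
  qed
  then obtain y where y: "T y = y"
    using banach_fix_type[of "1/2" T] by auto
  have yG: "apply_bcontfun y t = G y t" if "t \<in> ?I" for t
    using T[of y t] y that by (simp add: max_def min_def split: if_splits)
  have "((\<lambda>t. G y t) has_vector_derivative F t (G y t)) (at t within ?I)" if "t \<in> ?I" for t
    using G[OF that, of y] yG[OF that] by simp
  then show ?thesis using G0 by blast
qed

lemma C1_on_lipschitz_cball:
  fixes f :: "'a::euclidean_space \<Rightarrow> 'a"
  assumes "C1_on U f f'" "cball x0 r \<subseteq> U"
  obtains L where "L > 0" "\<And>z. z \<in> cball x0 r \<Longrightarrow> norm (f' z) \<le> L"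
     "\<And>x y. x \<in> cball x0 r \<Longrightarrow> y \<in> cball x0 r \<Longrightarrow> norm (f x - f y) \<le> L * norm (x - y)"
proof -
  note C = C1_onD[OF assms(1)]
  have "bounded (f' ` cball x0 r)"
    by (intro compact_imp_bounded compact_continuous_image continuous_on_subset[OF C(2)]) (use assms in auto)
  then obtain L where L: "L > 0" "\<And>z. z \<in> cball x0 r \<Longrightarrow> norm (f' z) \<le> L"
    unfolding bounded_pos by auto
  have "norm (f x - f y) \<le> L * norm (x - y)" if "x \<in> cball x0 r" "y \<in> cball x0 r" for x y
  proof (rule differentiable_bound[of "cball x0 r" f "\<lambda>z. blinfun_apply (f' z)"])
    show "onorm (blinfun_apply (f' z)) \<le> L" if "z \<in> cball x0 r" for z
      using L(2)[OF that] by (simp add: norm_blinfun.rep_eq)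
  qed (use that assms C(3) in auto)
  with L that show ?thesis by blast
qed

text \<open>The local flow of a continuously differentiable vector field.  Composing \<open>f\<close> with the
  projection to a ball makes it globally Lipschitz, so that all solutions exist on a common
  interval.  The derivative of the flow in the initial point is the solution \<open>Y\<close> of the linear
  equation of variations \<open>Y' = f' (\<Phi> x t) \<circ> Y\<close>.\<close>
lemma local_flow:
  fixes f :: "'a::euclidean_space \<Rightarrow> 'a"
  assumes "open U" "C1_on U f f'" "x0 \<in> U"
  obtains r \<epsilon> \<Phi> where "r > 0" "\<epsilon> > 0" "ball x0 r \<subseteq> U" "\<And>x. x \<in> ball x0 r \<Longrightarrow> \<Phi> x 0 = x"
    "\<And>x t. x \<in> ball x0 r \<Longrightarrow> t \<in> {-\<epsilon><..<\<epsilon>} \<Longrightarrow> \<Phi> x t \<in> U"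
    "\<And>x t. x \<in> ball x0 r \<Longrightarrow> t \<in> {-\<epsilon><..<\<epsilon>} \<Longrightarrow> (\<Phi> x has_vector_derivative f (\<Phi> x t)) (at t)"
    "\<And>x t. x \<in> ball x0 r \<Longrightarrow> t \<in> {-\<epsilon><..<\<epsilon>} \<Longrightarrow> (\<lambda>x. \<Phi> x t) differentiable (at x)"
proof -
  note C = C1_onD[OF assms(2)]
  obtain r where r: "r > 0" and rU: "cball x0 r \<subseteq> U"
    using assms open_contains_cball by blast
  obtain L where L0: "L > 0" and L: "\<And>z. z \<in> cball x0 r \<Longrightarrow> norm (f' z) \<le> L"
    and lip: "\<And>x y. x \<in> cball x0 r \<Longrightarrow> y \<in> cball x0 r \<Longrightarrow> norm (f x - f y) \<le> L * norm (x - y)"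
    using C1_on_lipschitz_cball[OF assms(2) rU] by blast
  have cf: "continuous_on U f"
    using C(1) by (meson continuous_at_imp_continuous_on has_derivative_continuous)
  have "bounded (f ` cball x0 r)"
    by (intro compact_imp_bounded compact_continuous_image continuous_on_subset[OF cf]) (use rU in auto)
  then obtain B where B0: "B > 0" and B: "\<And>z. z \<in> cball x0 r \<Longrightarrow> norm (f z) \<le> B"
    unfolding bounded_pos by auto
  define \<epsilon> where "\<epsilon> = min (1 / (2 * L)) (r / (4 * B))"
  have \<epsilon>: "\<epsilon> > 0" using L0 B0 r by (simp add: \<epsilon>_def)
  have "\<epsilon> \<le> 1 / (2 * L)" "\<epsilon> \<le> r / (4 * B)" by (auto simp: \<epsilon>_def)
  then have "L * \<epsilon> \<le> L * (1 / (2 * L))" "B * \<epsilon> \<le> B * (r / (4 * B))"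
    using L0 B0 by (auto simp del: times_divide_eq_right intro!: mult_left_mono)
  then have L\<epsilon>: "L * \<epsilon> \<le> 1/2" and B\<epsilon>: "B * \<epsilon> \<le> r/4" using L0 B0 by auto
  let ?I = "{-\<epsilon>..\<epsilon>}"
  \<comment> \<open>solutions starting in the half ball stay in the ball up to time \<open>\<epsilon>\<close>, where the projection is the identity\<close>
  define \<pi> where "\<pi> = closest_point (cball x0 r)"
  have \<pi>in: "\<pi> z \<in> cball x0 r" for z
    unfolding \<pi>_def using r by (intro closest_point_in_set) auto
  have \<pi>id: "z \<in> cball x0 r \<Longrightarrow> \<pi> z = z" for z unfolding \<pi>_def by (rule closest_point_self)
  have \<pi>lip: "dist (\<pi> x) (\<pi> y) \<le> dist x y" for x y
    unfolding \<pi>_def by (rule closest_point_lipschitz) (use r in auto)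
  have \<pi>c: "continuous_on S \<pi>" for S
    unfolding \<pi>_def by (rule continuous_on_closest_point) (use r in auto)
  have glip: "norm (f (\<pi> x) - f (\<pi> y)) \<le> L * norm (x - y)" for x y
    using lip[OF \<pi>in \<pi>in, of x y] \<pi>lip[of x y] L0 by (smt (verit) dist_norm mult_left_mono)
  have "\<exists>y. y 0 = x \<and> (\<forall>t\<in>?I. (y has_vector_derivative f (\<pi> (y t))) (at t within ?I))" for x
  proof (rule picard_lindeloef[where F="\<lambda>t y. f (\<pi> y)"])
    fix y :: "real \<Rightarrow> 'a" assume "continuous_on ?I y"
    then show "continuous_on ?I (\<lambda>t. f (\<pi> (y t)))"
      using \<pi>in rU by (intro continuous_on_compose2[OF cf] continuous_on_compose2[OF \<pi>c[of UNIV]]) auto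
  qed (use \<epsilon> L0 L\<epsilon> glip in auto)
  then obtain \<Phi> where \<Phi>0: "\<And>x. \<Phi> x 0 = x"
    and \<Phi>: "\<And>x t. t \<in> ?I \<Longrightarrow> (\<Phi> x has_vector_derivative f (\<pi> (\<Phi> x t))) (at t within ?I)"
    by metis
  have in_ball: "\<Phi> x t \<in> ball x0 r" if "x \<in> ball x0 (r/2)" "t \<in> ?I" for x t
  proof -
    have "norm (\<Phi> x t - \<Phi> x 0) \<le> B * \<bar>t - 0\<bar>"
      by (rule vector_mean_value[where S="?I"]) (use \<Phi> B \<pi>in that \<epsilon> in auto)
    also have "\<dots> \<le> B * \<epsilon>" using that B0 by (intro mult_left_mono) auto
    finally have "dist (\<Phi> x t) x \<le> r / 4" using B\<epsilon> \<Phi>0 by (simp add: dist_norm)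
    then have "dist x0 (\<Phi> x t) < r/2 + r/4"
      using that(1) dist_triangle[of x0 "\<Phi> x t" x] by (simp add: dist_commute)
    then show ?thesis using r by simp
  qed
  have \<Phi>': "(\<Phi> x has_vector_derivative f (\<Phi> x t)) (at t within ?I)" if "x \<in> ball x0 (r/2)" "t \<in> ?I" for x t
    using \<Phi>[OF that(2), of x] \<pi>id[of "\<Phi> x t"] in_ball[OF that] by (simp add: less_imp_le)
  have Lip: "norm (\<Phi> x t - \<Phi> y t) \<le> 2 * norm (x - y)" if "t \<in> ?I" for x y t
  proof -
    have "norm (\<Phi> x t - \<Phi> y t) \<le> 2 * (norm (\<Phi> x 0 - \<Phi> y 0) + \<epsilon> * 0)"
      by (rule short_time_gronwall[where L=L and u="\<lambda>t. \<Phi> x t - \<Phi> y t" and u'="\<lambda>t. f (\<pi> (\<Phi> x t)) - f (\<pi> (\<Phi> y t))"])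
        (use \<epsilon> L0 L\<epsilon> glip that \<Phi> in \<open>auto intro: has_vector_derivative_diff\<close>)
    then show ?thesis by (simp add: \<Phi>0)
  qed
  have diff: "(\<lambda>x. \<Phi> x t) differentiable (at x)" if x: "x \<in> ball x0 (r/2)" and t: "t \<in> ?I" for x t
  proof -
    have \<Phi>c: "continuous_on ?I (\<Phi> x)"
      using \<Phi> has_vector_derivative_continuous continuous_on_eq_continuous_within by blast
    have cA: "continuous_on ?I (\<lambda>t. f' (\<Phi> x t))"
      using in_ball[OF x] rU by (intro continuous_on_compose2[OF C(2) \<Phi>c]) fastforce
    have "\<exists>Y. Y 0 = id_blinfun \<and> (\<forall>t\<in>?I. (Y has_vector_derivative (f' (\<Phi> x t) o\<^sub>L Y t)) (at t within ?I))"
    proof (rule picard_lindeloef[where F="\<lambda>t Y. f' (\<Phi> x t) o\<^sub>L Y"])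
      fix Y assume "continuous_on ?I (Y :: real \<Rightarrow> 'a \<Rightarrow>\<^sub>L 'a)"
      then show "continuous_on ?I (\<lambda>t. f' (\<Phi> x t) o\<^sub>L Y t)"
        by (rule bounded_bilinear.continuous_on[OF bounded_bilinear_blinfun_compose cA])
    next
      fix s X Y assume s: "s \<in> ?I"
      have "norm ((f' (\<Phi> x s) o\<^sub>L X) - (f' (\<Phi> x s) o\<^sub>L Y)) = norm (f' (\<Phi> x s) o\<^sub>L (X - Y))"
        by (simp add: bounded_bilinear.diff_right[OF bounded_bilinear_blinfun_compose])
      also have "\<dots> \<le> norm (f' (\<Phi> x s)) * norm (X - Y)" by (rule norm_blinfun_compose)
      also have "\<dots> \<le> L * norm (X - Y)"
        using L[of "\<Phi> x s"] in_ball[OF x s] by (intro mult_right_mono) auto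
      finally show "norm ((f' (\<Phi> x s) o\<^sub>L X) - (f' (\<Phi> x s) o\<^sub>L Y)) \<le> L * norm (X - Y)" .
    qed (use \<epsilon> L0 L\<epsilon> in auto)
    then obtain Y where Y0: "Y 0 = id_blinfun"
      and Y: "\<And>t. t \<in> ?I \<Longrightarrow> (Y has_vector_derivative (f' (\<Phi> x t) o\<^sub>L Y t)) (at t within ?I)" by blast
    have "((\<lambda>x. \<Phi> x t) has_derivative blinfun_apply (Y t)) (at x)"
      unfolding has_derivative_at_alt
    proof (intro conjI allI impI blinfun.bounded_linear_right)
      fix e :: real assume e: "e > 0"
      \<comment> \<open>\<open>\<Phi>\<close> is Lipschitz with constant \<open>2\<close>, so the error \<open>?u\<close> below solves the linear equation up to \<open>\<eta> * 2 * norm (y - x)\<close>, which contributes \<open>4 * \<epsilon> * \<eta> * norm (y - x)\<close> to it\<close>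
      define \<eta> where "\<eta> = e / (4 * \<epsilon>)"
      have \<eta>: "\<eta> > 0" using e \<epsilon> by (simp add: \<eta>_def)
      have "uniformly_continuous_on (cball x0 r) f'"
        using compact_uniformly_continuous continuous_on_subset[OF C(2) rU] compact_cball by blast
      then obtain d where d: "d > 0" "\<And>z a. z \<in> cball x0 r \<Longrightarrow> a \<in> cball x0 r \<Longrightarrow> dist z a < d \<Longrightarrow> dist (f' z) (f' a) < \<eta>"
        unfolding uniformly_continuous_on_def using \<eta> by metis
      have lin: "norm (f b - f a - f' a (b - a)) \<le> norm (b - a) * \<eta>"
        if ab: "a \<in> cball x0 r" "b \<in> cball x0 r" "norm (b - a) < d" for a b
      proof (rule differentiable_bound_linearization[where S="cball x0 r \<inter> ball a d" and f'="\<lambda>z. blinfun_apply (f' z)"])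
        fix s :: real assume "s \<in> {0..1}"
        then have "a + s *\<^sub>R (b - a) \<in> closed_segment a b" unfolding closed_segment_def by (intro CollectI exI[of _ s]) (auto simp: algebra_simps)
        moreover have "closed_segment a b \<subseteq> cball x0 r \<inter> ball a d"
          using ab d(1) by (intro closed_segment_subset convex_Int) (auto simp: dist_norm norm_minus_commute)
        ultimately show "a + s *\<^sub>R (b - a) \<in> cball x0 r \<inter> ball a d" by blast
      next
        fix z assume z: "z \<in> cball x0 r \<inter> ball a d"
        have "onorm (blinfun_apply (f' z) - blinfun_apply (f' a)) = norm (f' z - f' a)"
          by (simp add: norm_blinfun.rep_eq minus_blinfun.rep_eq fun_diff_def)
        then show "onorm (blinfun_apply (f' z) - blinfun_apply (f' a)) \<le> \<eta>"
          using d(2)[of z a] z ab by (simp add: dist_norm norm_minus_commute)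
      qed (use ab d(1) C(3) rU in auto)
      define d' where "d' = min (d/2) (r/2 - dist x0 x)"
      have d': "d' > 0" using d x by (simp add: d'_def)
      have "norm (\<Phi> y t - \<Phi> x t - Y t (y - x)) \<le> e * norm (y - x)" if y: "norm (y - x) < d'" for y
      proof -
        have yb: "y \<in> ball x0 (r/2)"
          using y dist_triangle[of x0 y x] by (simp add: d'_def dist_norm norm_minus_commute)
        let ?u = "\<lambda>t. \<Phi> y t - \<Phi> x t - Y t (y - x)"
        have "norm (?u t) \<le> 2 * (norm (?u 0) + \<epsilon> * (\<eta> * (2 * norm (y - x))))"
        proof (rule short_time_gronwall[where L=L and u'="\<lambda>t. f (\<Phi> y t) - f (\<Phi> x t) - f' (\<Phi> x t) (Y t (y - x))"])
          fix s assume s: "s \<in> ?I"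
          have "((\<lambda>t. Y t (y - x)) has_vector_derivative (f' (\<Phi> x s) o\<^sub>L Y s) (y - x)) (at s within ?I)"
            using bounded_linear.has_vector_derivative[OF bounded_linear_blinfun_apply[OF bounded_linear_ident] Y[OF s]]
              blinfun.bounded_linear_left[of "y - x"] bounded_linear.has_vector_derivative[OF _ Y[OF s]] by blast
          then show "(?u has_vector_derivative f (\<Phi> y s) - f (\<Phi> x s) - f' (\<Phi> x s) (Y s (y - x))) (at s within ?I)"
            using \<Phi>'[OF x s] \<Phi>'[OF yb s] by (intro has_vector_derivative_diff) auto
          have in': "\<Phi> x s \<in> cball x0 r" "\<Phi> y s \<in> cball x0 r" using in_ball[OF x s] in_ball[OF yb s] by auto
          have li: "norm (\<Phi> y s - \<Phi> x s) \<le> 2 * norm (y - x)" by (rule Lip[OF s])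
          then have "norm (\<Phi> y s - \<Phi> x s) < d" using y by (simp add: d'_def)
          from lin[OF in' this] li \<eta>
          have 1: "norm (f (\<Phi> y s) - f (\<Phi> x s) - f' (\<Phi> x s) (\<Phi> y s - \<Phi> x s)) \<le> \<eta> * (2 * norm (y - x))"
            by (smt (verit) mult.commute mult_left_mono)
          have 2: "norm (f' (\<Phi> x s) (?u s)) \<le> L * norm (?u s)"
            using norm_blinfun[of "f' (\<Phi> x s)" "?u s"] L[OF in'(1)] by (smt (verit) mult_right_mono norm_ge_zero)
          have "f (\<Phi> y s) - f (\<Phi> x s) - f' (\<Phi> x s) (Y s (y - x)) =
            (f (\<Phi> y s) - f (\<Phi> x s) - f' (\<Phi> x s) (\<Phi> y s - \<Phi> x s)) + f' (\<Phi> x s) (?u s)"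
            by (simp add: blinfun.diff_right)
          then show "norm (f (\<Phi> y s) - f (\<Phi> x s) - f' (\<Phi> x s) (Y s (y - x))) \<le> L * norm (?u s) + \<eta> * (2 * norm (y - x))"
            using norm_triangle_ineq 1 2 by (smt (verit))
        qed (use \<epsilon> L0 L\<epsilon> \<eta> t in auto)
        also have "\<dots> = e * norm (y - x)" using \<epsilon> by (simp add: \<Phi>0 Y0 \<eta>_def)
        finally show ?thesis .
      qed
      then show "\<exists>d>0. \<forall>y. norm (y - x) < d \<longrightarrow> norm (\<Phi> y t - \<Phi> x t - Y t (y - x)) \<le> e * norm (y - x)"
        using d' by blast
    qed
    then show ?thesis using differentiable_def by blast
  qed
  show ?thesis
  proof (rule that[of "r/2" \<epsilon> \<Phi>])
    show "(\<Phi> x has_vector_derivative f (\<Phi> x t)) (at t)" if "x \<in> ball x0 (r/2)" "t \<in> {-\<epsilon><..<\<epsilon>}" for x t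
    proof -
      have "at t within ?I = at t" using that(2) by (intro at_within_interior) auto
      then show ?thesis using \<Phi>'[OF that(1), of t] that(2) by auto
    qed
    show "\<Phi> x t \<in> U" if "x \<in> ball x0 (r/2)" "t \<in> {-\<epsilon><..<\<epsilon>}" for x t
    proof -
      have "t \<in> ?I" using that by auto
      from in_ball[OF that(1) this] rU show ?thesis by auto
    qed
    show "ball x0 (r/2) \<subseteq> U" using rU r by auto
    show "(\<lambda>x. \<Phi> x t) differentiable (at x)" if "x \<in> ball x0 (r/2)" "t \<in> {-\<epsilon><..<\<epsilon>}" for x t
      using diff[OF that(1)] that(2) by auto
  qed (use r \<epsilon> \<Phi>0 in auto)
qed

lemma local_ode_uniqueness:
  fixes f :: "'a::euclidean_space \<Rightarrow> 'a"
  assumes "open U" "C1_on U f f'" "x s = y s" "x s \<in> U"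
    and x: "\<forall>\<^sub>F t in nhds s. (x has_vector_derivative f (x t)) (at t)"
    and y: "\<forall>\<^sub>F t in nhds s. (y has_vector_derivative f (y t)) (at t)"
  shows "\<forall>\<^sub>F t in nhds s. x t = y t"
proof -
  obtain r where r: "r > 0" and rU: "cball (x s) r \<subseteq> U"
    using assms open_contains_cball by blast
  obtain L where L0: "L > 0" and "\<And>z. z \<in> cball (x s) r \<Longrightarrow> norm (f' z) \<le> L"
    and lip: "\<And>a b. a \<in> cball (x s) r \<Longrightarrow> b \<in> cball (x s) r \<Longrightarrow> norm (f a - f b) \<le> L * norm (a - b)"
    using C1_on_lipschitz_cball[OF assms(2) rU] by blast
  have cx: "isCont x s" "isCont y s"
    using eventually_nhds_x_imp_x[OF x] eventually_nhds_x_imp_x[OF y] has_vector_derivative_continuous by auto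
  have "\<forall>\<^sub>F t in nhds s. x t \<in> ball (x s) r" "\<forall>\<^sub>F t in nhds s. y t \<in> ball (x s) r"
    using tendstoD[of x "x s" "nhds s" r] tendstoD[of y "x s" "nhds s" r] cx r assms(3)
    unfolding isCont_def tendsto_at_iff_tendsto_nhds by (auto simp: dist_commute)
  with x y have "\<forall>\<^sub>F t in nhds s. (x has_vector_derivative f (x t)) (at t) \<and> (y has_vector_derivative f (y t)) (at t)
     \<and> x t \<in> cball (x s) r \<and> y t \<in> cball (x s) r"
    by eventually_elim auto
  then obtain d where d: "d > 0" and D: "\<And>t. dist t s < d \<Longrightarrow> (x has_vector_derivative f (x t)) (at t) \<and> (y has_vector_derivative f (y t)) (at t)
     \<and> x t \<in> cball (x s) r \<and> y t \<in> cball (x s) r"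
    unfolding eventually_nhds_metric by blast
  define \<epsilon> where "\<epsilon> = min (d/2) (1/(2*L))"
  have \<epsilon>: "\<epsilon> > 0" "\<epsilon> < d" using d L0 by (auto simp: \<epsilon>_def)
  have "L * \<epsilon> \<le> L * (1 / (2 * L))" using L0 by (intro mult_left_mono) (simp_all add: \<epsilon>_def del: times_divide_eq_right)
  then have L\<epsilon>: "L * \<epsilon> \<le> 1/2" using L0 by simp
  have "x t = y t" if "dist t s < \<epsilon>" for t
  proof -
    have "norm (x (s + (t - s)) - y (s + (t - s))) \<le> 2 * (norm (x (s + 0) - y (s + 0)) + \<epsilon> * 0)"
    proof (rule short_time_gronwall[where L=L and u="\<lambda>t. x (s + t) - y (s + t)" and u'="\<lambda>t. f (x (s + t)) - f (y (s + t))"])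
      fix t assume t: "t \<in> {-\<epsilon>..\<epsilon>}"
      then have D': "(x has_vector_derivative f (x (s+t))) (at (s+t))" "(y has_vector_derivative f (y (s+t))) (at (s+t))"
         "x (s+t) \<in> cball (x s) r" "y (s+t) \<in> cball (x s) r"
        using D[of "s + t"] \<epsilon> by (auto simp: dist_real_def)
      have sh: "((\<lambda>t. s + t) has_real_derivative 1) (at t)" by (auto intro!: derivative_eq_intros)
      have "((\<lambda>t. x (s + t)) has_vector_derivative f (x (s+t))) (at t)"
         "((\<lambda>t. y (s + t)) has_vector_derivative f (y (s+t))) (at t)"
        using vector_diff_chain_at[of "\<lambda>t. s + t" 1 t x "f (x (s+t))"] vector_diff_chain_at[of "\<lambda>t. s + t" 1 t y "f (y (s+t))"] sh D'
        by (auto simp: o_def has_real_derivative_iff_has_vector_derivative)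
      then show "((\<lambda>t. x (s + t) - y (s + t)) has_vector_derivative f (x (s + t)) - f (y (s + t))) (at t within {-\<epsilon>..\<epsilon>})"
        by (intro has_vector_derivative_diff) (auto intro: has_vector_derivative_at_within)
      show "norm (f (x (s + t)) - f (y (s + t))) \<le> L * norm (x (s + t) - y (s + t)) + 0"
        using lip D' by auto
    qed (use \<epsilon> L0 L\<epsilon> that in \<open>auto simp: dist_real_def\<close>)
    then show ?thesis using assms(3) by simp
  qed
  then show ?thesis unfolding eventually_nhds_metric using \<epsilon> by blast
qed

section \<open>Differential calculus in charts\<close>

lemma smooth_on_differentiable: "smooth_on S f \<Longrightarrow> x \<in> S \<Longrightarrow> f differentiable (at x)"
  unfolding smooth_on_def using Ck_on.simps(2)[of 0] by metis

lemma frechet_derivative_eventually_cong: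
  assumes "\<forall>\<^sub>F y in nhds x. f y = g y"
  shows "(f has_derivative D) (at x) \<longleftrightarrow> (g has_derivative D) (at x)"
    and "frechet_derivative f (at x) = frechet_derivative g (at x)"
    and "f differentiable (at x) \<longleftrightarrow> g differentiable (at x)"
proof -
  have ev: "\<forall>\<^sub>F y in at x. f y = g y" "f x = g x"
    using assms eventually_nhds_x_imp_x by (auto simp: eventually_at_filter elim: eventually_mono)
  then have ev': "\<forall>\<^sub>F y in at x. g y = f y" by (simp add: eq_commute)
  show *: "(f has_derivative D) (at x) \<longleftrightarrow> (g has_derivative D) (at x)" for D
    using has_derivative_transform_eventually[of f D x UNIV g] has_derivative_transform_eventually[of g D x UNIV f] ev ev'
    by auto
  show "frechet_derivative f (at x) = frechet_derivative g (at x)"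
    unfolding frechet_derivative_def * ..
  show "f differentiable (at x) \<longleftrightarrow> g differentiable (at x)"
    unfolding differentiable_def * ..
qed

text \<open>A smooth manifold with its atlas.\<close>
locale smooth_mfd =
  fixes A :: "('m::{t2_space, second_countable_topology}, 'e::euclidean_space) chart set"
  assumes atlas: "smooth_atlas A"
begin

lemma
  assumes "c \<in> A"
  shows open_domain: "open (fst c)"
    and open_range: "open (snd c ` fst c)"
    and chart_homeo: "homeomorphism (fst c) (snd c ` fst c) (snd c) (chart_inv c)"
  using atlas assms unfolding smooth_atlas_def by auto

lemma chart_inv_chart: "c \<in> A \<Longrightarrow> p \<in> fst c \<Longrightarrow> chart_inv c (snd c p) = p"
  using chart_homeo homeomorphism_apply1 by fastforce

lemma
  assumes "c \<in> A" "x \<in> snd c ` fst c"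
  shows chart_chart_inv: "snd c (chart_inv c x) = x" and chart_inv_in: "chart_inv c x \<in> fst c"
  using assms chart_inv_chart[OF assms(1)] by auto

lemma ex_chart: "\<exists>c\<in>A. p \<in> fst c"
  using atlas unfolding smooth_atlas_def by auto

lemma chart_at: "chart_at A p \<in> A" "p \<in> fst (chart_at A p)"
  using someI_ex[of "\<lambda>c. c \<in> A \<and> p \<in> fst c"] ex_chart[of p] unfolding chart_at_def by blast+

lemma isCont_chart: "c \<in> A \<Longrightarrow> p \<in> fst c \<Longrightarrow> isCont (snd c) p"
  using chart_homeo[of c] open_domain[of c] continuous_on_eq_continuous_at homeomorphism_cont1 by blast

lemma isCont_chart_inv: "c \<in> A \<Longrightarrow> p \<in> fst c \<Longrightarrow> isCont (chart_inv c) (snd c p)"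
  using chart_homeo[of c] open_range[of c] continuous_on_eq_continuous_at homeomorphism_cont2 by blast

lemma eventually_in_domain: "c \<in> A \<Longrightarrow> p \<in> fst c \<Longrightarrow> \<forall>\<^sub>F q in nhds p. q \<in> fst c"
  using open_domain eventually_nhds_in_open by blast

lemma eventually_in_range: "c \<in> A \<Longrightarrow> p \<in> fst c \<Longrightarrow> \<forall>\<^sub>F x in nhds (snd c p). x \<in> snd c ` fst c"
  using open_range eventually_nhds_in_open by blast

lemma eventually_pullback:
  assumes "isCont \<gamma> z" "\<forall>\<^sub>F p in nhds (\<gamma> z). P p"
  shows "\<forall>\<^sub>F x in nhds z. P (\<gamma> x)"
  using assms filterlim_iff[of \<gamma> "nhds (\<gamma> z)" "nhds z"] unfolding isCont_def tendsto_at_iff_tendsto_nhds by blast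

lemma eventually_chart_inv:
  assumes "c \<in> A" "p \<in> fst c" "\<forall>\<^sub>F q in nhds p. P q"
  shows "\<forall>\<^sub>F x in nhds (snd c p). P (chart_inv c x)"
  using eventually_pullback[OF isCont_chart_inv[OF assms(1,2)]] assms chart_inv_chart by metis

lemma isCont_rep: "c \<in> A \<Longrightarrow> p \<in> fst c \<Longrightarrow> isCont f p \<Longrightarrow> isCont (f \<circ> chart_inv c) (snd c p)"
  using isCont_chart_inv chart_inv_chart by (metis continuous_at_compose)

lemma transition_differentiable:
  assumes "c \<in> A" "c' \<in> A" "p \<in> fst c" "p \<in> fst c'"
  shows "(snd c' \<circ> chart_inv c) differentiable (at (snd c p))"
  using assms atlas unfolding smooth_atlas_def by (intro smooth_on_differentiable) auto

lemma transition_has_derivative: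
  assumes "c \<in> A" "c' \<in> A" "p \<in> fst c" "p \<in> fst c'"
  shows "((snd c' \<circ> chart_inv c) has_derivative frechet_derivative (snd c' \<circ> chart_inv c) (at (snd c p))) (at (snd c p))"
  using transition_differentiable[OF assms] frechet_derivative_works by blast

text \<open>The chain rule through a chart.  The source of \<open>\<gamma>\<close> and the target of \<open>h\<close> are arbitrary normed
  spaces, so that one statement serves curves, local representations of maps and real functions.\<close>
lemma derivative_through_chart:
  fixes \<gamma> :: "'z::real_normed_vector \<Rightarrow> 'm" and h :: "'m \<Rightarrow> 'b::real_normed_vector"
  assumes "c \<in> A" "isCont \<gamma> z" "\<gamma> z \<in> fst c"
    and 1: "((snd c \<circ> \<gamma>) has_derivative D) (at z)"
    and 2: "((h \<circ> chart_inv c) has_derivative E) (at (snd c (\<gamma> z)))"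
  shows "((h \<circ> \<gamma>) has_derivative (E \<circ> D)) (at z)"
proof -
  have "(((h \<circ> chart_inv c) \<circ> (snd c \<circ> \<gamma>)) has_derivative (E \<circ> D)) (at z)"
    using diff_chain_at[OF 1] 2 by (simp add: o_assoc)
  moreover have "\<forall>\<^sub>F y in nhds z. ((h \<circ> chart_inv c) \<circ> (snd c \<circ> \<gamma>)) y = (h \<circ> \<gamma>) y"
    using eventually_pullback[OF assms(2) eventually_in_domain[OF assms(1,3)]]
    by eventually_elim (simp add: chart_inv_chart assms(1))
  ultimately show ?thesis using frechet_derivative_eventually_cong(1) by blast
qed

lemma tangent_space_transform:
  "X \<in> tangent_space A p \<Longrightarrow> c \<in> A \<Longrightarrow> c' \<in> A \<Longrightarrow> p \<in> fst c \<Longrightarrow> p \<in> fst c' \<Longrightarrow>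
    X c' = frechet_derivative (snd c' \<circ> chart_inv c) (at (snd c p)) (X c)"
  unfolding tangent_space_def by blast

lemma tangent_space_outside: "X \<in> tangent_space A p \<Longrightarrow> \<not> (c \<in> A \<and> p \<in> fst c) \<Longrightarrow> X c = 0"
  unfolding tangent_space_def by blast

lemma tangent_space_eqI:
  assumes "X \<in> tangent_space A p" "Y \<in> tangent_space A p" "c \<in> A" "p \<in> fst c" "X c = Y c"
  shows "X = Y"
proof
  fix c'
  show "X c' = Y c'"
    using tangent_space_transform[OF assms(1) assms(3), of c'] tangent_space_transform[OF assms(2) assms(3), of c']
      tangent_space_outside[OF assms(1), of c'] tangent_space_outside[OF assms(2), of c'] assms(4,5) by metis
qed

lemma tlin_in_tangent_space:
  assumes "X \<in> tangent_space A p" "Y \<in> tangent_space A p"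
  shows "tlin a X b Y \<in> tangent_space A p"
proof -
  have "tlin a X b Y c' = frechet_derivative (snd c' \<circ> chart_inv c) (at (snd c p)) (tlin a X b Y c)"
    if "c \<in> A" "c' \<in> A" "p \<in> fst c" "p \<in> fst c'" for c c'
  proof -
    interpret bounded_linear "frechet_derivative (snd c' \<circ> chart_inv c) (at (snd c p))"
      using transition_has_derivative[OF that] has_derivative_bounded_linear by blast
    show ?thesis
      using tangent_space_transform[OF assms(1) that] tangent_space_transform[OF assms(2) that]
      by (simp add: tlin_def add scaleR)
  qed
  moreover have "tlin a X b Y c = 0" if "\<not> (c \<in> A \<and> p \<in> fst c)" for c
    using tangent_space_outside[OF assms(1) that] tangent_space_outside[OF assms(2) that] by (simp add: tlin_def)
  ultimately show ?thesis unfolding tangent_space_def by blast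
qed

text \<open>The differential of \<open>h\<close> applied to a tangent vector does not depend on the chart used to
  express both.\<close>
lemma chart_independence:
  fixes h :: "'m \<Rightarrow> 'b::real_normed_vector"
  assumes "c \<in> A" "c' \<in> A" "p \<in> fst c" "p \<in> fst c'"
    and "(h \<circ> chart_inv c) differentiable (at (snd c p))"
  shows "(h \<circ> chart_inv c') differentiable (at (snd c' p))"
    and "X \<in> tangent_space A p \<Longrightarrow> frechet_derivative (h \<circ> chart_inv c') (at (snd c' p)) (X c')
      = frechet_derivative (h \<circ> chart_inv c) (at (snd c p)) (X c)"
proof -
  have *: "((h \<circ> chart_inv c') has_derivative (frechet_derivative (h \<circ> chart_inv c) (at (snd c p)) \<circ>
      frechet_derivative (snd c \<circ> chart_inv c') (at (snd c' p)))) (at (snd c' p))"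
    using assms frechet_derivative_works[of "h \<circ> chart_inv c"] transition_has_derivative[of c' c p]
    by (intro derivative_through_chart[where c=c]) (auto simp: chart_inv_chart isCont_chart_inv)
  then show "(h \<circ> chart_inv c') differentiable (at (snd c' p))" unfolding differentiable_def by blast
  assume X: "X \<in> tangent_space A p"
  show "frechet_derivative (h \<circ> chart_inv c') (at (snd c' p)) (X c')
      = frechet_derivative (h \<circ> chart_inv c) (at (snd c p)) (X c)"
    using frechet_derivative_at[OF *] tangent_space_transform[OF X, of c' c] assms by (metis comp_apply)
qed

lemma coord_tvec:
  assumes "c \<in> A" "p \<in> fst c"
  shows "coord_tvec A c p u \<in> tangent_space A p" "coord_tvec A c p u c = u"
    "X \<in> tangent_space A p \<Longrightarrow> coord_tvec A c p (X c) = X"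
proof -
  have self: "frechet_derivative (snd c \<circ> chart_inv c) (at (snd c p)) = (\<lambda>x. x)"
  proof -
    have "\<forall>\<^sub>F x in nhds (snd c p). (snd c \<circ> chart_inv c) x = x"
      using eventually_in_range[OF assms] by eventually_elim (simp add: chart_chart_inv assms)
    then show ?thesis using frechet_derivative_eventually_cong(2) frechet_derivative_ident by metis
  qed
  show c: "coord_tvec A c p u c = u" for u unfolding coord_tvec_def using assms self by simp
  have tr: "frechet_derivative (snd c'' \<circ> chart_inv c) (at (snd c p)) u
      = frechet_derivative (snd c'' \<circ> chart_inv c') (at (snd c' p)) (frechet_derivative (snd c' \<circ> chart_inv c) (at (snd c p)) u)"
    if "c' \<in> A" "c'' \<in> A" "p \<in> fst c'" "p \<in> fst c''" for c' c'' u
  proof -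
    have "((snd c'' \<circ> chart_inv c) has_derivative
      (frechet_derivative (snd c'' \<circ> chart_inv c') (at (snd c' p)) \<circ> frechet_derivative (snd c' \<circ> chart_inv c) (at (snd c p)))) (at (snd c p))"
      using assms that transition_has_derivative
      by (intro derivative_through_chart[where c=c']) (auto simp: chart_inv_chart isCont_chart_inv)
    then show ?thesis using frechet_derivative_at by (metis comp_apply)
  qed
  show ts: "coord_tvec A c p u \<in> tangent_space A p" for u
    unfolding tangent_space_def
  proof (intro CollectI conjI allI ballI impI)
    fix c' c'' assume "c' \<in> A" "c'' \<in> A" "p \<in> fst c' \<and> p \<in> fst c''"
    then show "coord_tvec A c p u c'' = frechet_derivative (snd c'' \<circ> chart_inv c') (at (snd c' p)) (coord_tvec A c p u c')"
      using tr[of c' c'' u] by (simp add: coord_tvec_def)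
  qed (auto simp: coord_tvec_def)
  show "X \<in> tangent_space A p \<Longrightarrow> coord_tvec A c p (X c) = X"
    using tangent_space_eqI[OF ts _ assms] c by blast
qed

text \<open>Differentiability of a self-map at a point, tested in all pairs of charts; one pair suffices
  by \<open>mdiffI\<close>.\<close>
definition mdiff :: "('m \<Rightarrow> 'm) \<Rightarrow> 'm \<Rightarrow> bool" where
  "mdiff f p \<longleftrightarrow> isCont f p \<and> (\<forall>c\<in>A. \<forall>c'\<in>A. p \<in> fst c \<and> f p \<in> fst c' \<longrightarrow>
     (snd c' \<circ> f \<circ> chart_inv c) differentiable (at (snd c p)))"

lemma mdiffD:
  assumes "mdiff f p" "c \<in> A" "c' \<in> A" "p \<in> fst c" "f p \<in> fst c'"
  shows "((snd c' \<circ> f \<circ> chart_inv c) has_derivative frechet_derivative (snd c' \<circ> f \<circ> chart_inv c) (at (snd c p))) (at (snd c p))"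
  using assms unfolding mdiff_def by (intro frechet_derivative_works[THEN iffD1]) auto

lemma mdiffI:
  assumes "isCont f p" "c \<in> A" "c' \<in> A" "p \<in> fst c" "f p \<in> fst c'"
    and "(snd c' \<circ> f \<circ> chart_inv c) differentiable (at (snd c p))"
  shows "mdiff f p"
  unfolding mdiff_def
proof (intro conjI ballI impI assms(1))
  fix d d' assume d: "d \<in> A" "d' \<in> A" "p \<in> fst d \<and> f p \<in> fst d'"
  have fp: "f (chart_inv c (snd c p)) = f p" using assms by (simp add: chart_inv_chart)
  have 1: "((snd c' \<circ> (f \<circ> chart_inv c)) has_derivative frechet_derivative (snd c' \<circ> f \<circ> chart_inv c) (at (snd c p))) (at (snd c p))"
    using assms(6) frechet_derivative_works by (auto simp: o_assoc)
  have "((snd d' \<circ> (f \<circ> chart_inv c)) has_derivative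
     (frechet_derivative (snd d' \<circ> chart_inv c') (at (snd c' (f p))) \<circ> frechet_derivative (snd c' \<circ> f \<circ> chart_inv c) (at (snd c p)))) (at (snd c p))"
    using assms d 1 transition_has_derivative[of c' d' "f p"] isCont_rep[of c p f] fp
    by (intro derivative_through_chart[where c=c']) auto
  then have "((snd d' \<circ> f) \<circ> chart_inv c) differentiable (at (snd c p))"
    unfolding differentiable_def by (auto simp: o_assoc)
  from chart_independence(1)[OF assms(2) d(1) assms(4) _ this]
  show "(snd d' \<circ> f \<circ> chart_inv d) differentiable (at (snd d p))" using d by simp
qed

lemma dmap_in_chart:
  assumes "mdiff f p" "X \<in> tangent_space A p" "c \<in> A" "c' \<in> A" "p \<in> fst c" "f p \<in> fst c'"
  shows "dmap A f p X c' = frechet_derivative (snd c' \<circ> f \<circ> chart_inv c) (at (snd c p)) (X c)"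
proof -
  have "(snd c' \<circ> f \<circ> chart_inv c) differentiable (at (snd c p))"
    using assms unfolding mdiff_def by simp
  from chart_independence(2)[OF assms(3) chart_at(1) assms(5) chart_at(2) this assms(2)]
  show ?thesis unfolding dmap_def using assms(4,6) by (simp add: Let_def)
qed

lemma dmap_in_tangent_space:
  assumes "mdiff f p" "X \<in> tangent_space A p"
  shows "dmap A f p X \<in> tangent_space A (f p)"
  unfolding tangent_space_def
proof (intro CollectI conjI allI impI ballI)
  fix c' assume "\<not> (c' \<in> A \<and> f p \<in> fst c')"
  then show "dmap A f p X c' = 0" unfolding dmap_def by (auto simp: Let_def)
next
  fix d d' assume d: "d \<in> A" "d' \<in> A" "f p \<in> fst d \<and> f p \<in> fst d'"
  let ?c = "chart_at A p"
  have fp: "f (chart_inv ?c (snd ?c p)) = f p" using chart_at by (simp add: chart_inv_chart)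
  have "((snd d' \<circ> (f \<circ> chart_inv ?c)) has_derivative
     (frechet_derivative (snd d' \<circ> chart_inv d) (at (snd d (f p))) \<circ> frechet_derivative (snd d \<circ> f \<circ> chart_inv ?c) (at (snd ?c p)))) (at (snd ?c p))"
    using d mdiffD[OF assms(1), of ?c d] transition_has_derivative[of d d' "f p"] isCont_rep[of ?c p f] fp chart_at assms(1)
    by (intro derivative_through_chart[where c=d]) (auto simp: o_assoc mdiff_def)
  from fun_cong[OF frechet_derivative_at[OF this], of "X ?c"]
  show "dmap A f p X d' = frechet_derivative (snd d' \<circ> chart_inv d) (at (snd d (f p))) (dmap A f p X d)"
    using dmap_in_chart[OF assms, of ?c d] dmap_in_chart[OF assms, of ?c d'] d chart_at
    by (simp add: o_assoc)
qed

lemma dmap_tlin: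
  assumes "mdiff f p" "X \<in> tangent_space A p" "Y \<in> tangent_space A p"
  shows "dmap A f p (tlin a X b Y) = tlin a (dmap A f p X) b (dmap A f p Y)"
proof (rule ext)
  fix c' let ?c = "chart_at A p"
  show "dmap A f p (tlin a X b Y) c' = tlin a (dmap A f p X) b (dmap A f p Y) c'"
  proof (cases "c' \<in> A \<and> f p \<in> fst c'")
    case True
    interpret bounded_linear "frechet_derivative (snd c' \<circ> f \<circ> chart_inv ?c) (at (snd ?c p))"
      using True by (intro has_derivative_bounded_linear[OF mdiffD[OF assms(1)]] chart_at) auto
    show ?thesis unfolding dmap_def tlin_def using True by (simp add: Let_def add scaleR)
  qed (auto simp: dmap_def tlin_def Let_def)
qed

lemma mdiff_comp:
  assumes "mdiff f p" "mdiff g (f p)"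
  shows "mdiff (g \<circ> f) p" "X \<in> tangent_space A p \<Longrightarrow> dmap A (g \<circ> f) p X = dmap A g (f p) (dmap A f p X)"
proof -
  let ?c = "chart_at A p" let ?d = "chart_at A (f p)"
  have fp: "f (chart_inv ?c (snd ?c p)) = f p" using chart_at by (simp add: chart_inv_chart)
  have *: "((snd e \<circ> (g \<circ> f) \<circ> chart_inv ?c) has_derivative
     (frechet_derivative (snd e \<circ> g \<circ> chart_inv ?d) (at (snd ?d (f p))) \<circ> frechet_derivative (snd ?d \<circ> f \<circ> chart_inv ?c) (at (snd ?c p)))) (at (snd ?c p))"
    if "e \<in> A" "g (f p) \<in> fst e" for e
  proof -
    have "(((snd e \<circ> g) \<circ> (f \<circ> chart_inv ?c)) has_derivative
     (frechet_derivative (snd e \<circ> g \<circ> chart_inv ?d) (at (snd ?d (f p))) \<circ> frechet_derivative (snd ?d \<circ> f \<circ> chart_inv ?c) (at (snd ?c p)))) (at (snd ?c p))"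
      using mdiffD[OF assms(1), of ?c ?d] mdiffD[OF assms(2), of ?d e] isCont_rep[of ?c p f] fp chart_at assms(1) that
      by (intro derivative_through_chart[where c="?d"]) (auto simp: o_assoc mdiff_def)
    then show ?thesis by (simp add: o_assoc)
  qed
  have cont: "isCont (g \<circ> f) p" using assms continuous_at_compose unfolding mdiff_def by blast
  let ?e = "chart_at A (g (f p))"
  show comp: "mdiff (g \<circ> f) p"
    using *[of ?e] chart_at by (intro mdiffI[OF cont, of ?c ?e]) (auto simp: differentiable_def)
  assume X: "X \<in> tangent_space A p"
  show "dmap A (g \<circ> f) p X = dmap A g (f p) (dmap A f p X)"
  proof (rule tangent_space_eqI)
    show "dmap A (g \<circ> f) p X ?e = dmap A g (f p) (dmap A f p X) ?e"
      using dmap_in_chart[OF comp X, of ?c ?e] dmap_in_chart[OF assms(1) X, of ?c ?d]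
        dmap_in_chart[OF assms(2) dmap_in_tangent_space[OF assms(1) X], of ?d ?e] frechet_derivative_at[OF *[of ?e]] chart_at
      by (metis comp_apply)
    show "dmap A (g \<circ> f) p X \<in> tangent_space A (g (f p))"
      using dmap_in_tangent_space[OF comp X] by simp
    show "dmap A g (f p) (dmap A f p X) \<in> tangent_space A (g (f p))"
      by (intro dmap_in_tangent_space assms X)
  qed (use chart_at in auto)
qed

lemma mdiff_id: "mdiff id p" "X \<in> tangent_space A p \<Longrightarrow> dmap A id p X = X"
proof -
  show *: "mdiff id p"
    using transition_differentiable[OF chart_at(1) chart_at(1) chart_at(2) chart_at(2), of p]
    by (intro mdiffI[where c="chart_at A p" and c'="chart_at A p"]) (auto simp: chart_at)
  assume X: "X \<in> tangent_space A p"
  show "dmap A id p X = X"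
  proof
    fix c' show "dmap A id p X c' = X c'"
      using tangent_space_outside[OF X, of c'] tangent_space_transform[OF X chart_at(1)[of p], of c'] chart_at(2)[of p]
      unfolding dmap_def Let_def id_apply comp_id by (metis (full_types))
  qed
qed

lemma mdiff_cong:
  assumes ev: "\<forall>\<^sub>F q in nhds p. f q = g q"
  shows "mdiff f p \<longleftrightarrow> mdiff g p" "dmap A f p = dmap A g p"
proof -
  have p: "f p = g p" using ev eventually_nhds_x_imp_x by blast
  have cont: "isCont f p \<longleftrightarrow> isCont g p" using isCont_cong[OF ev] .
  have ev': "\<forall>\<^sub>F x in nhds (snd c p). (snd c' \<circ> f \<circ> chart_inv c) x = (snd c' \<circ> g \<circ> chart_inv c) x"
    if "c \<in> A" "p \<in> fst c" for c c'
    using eventually_chart_inv[OF that ev] by eventually_elim simp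
  note cong = frechet_derivative_eventually_cong[OF ev']
  show "mdiff f p \<longleftrightarrow> mdiff g p" unfolding mdiff_def p cont using cong(3) by blast
  show "dmap A f p = dmap A g p"
    unfolding dmap_def Let_def p cong(2)[OF chart_at] ..
qed

lemma smooth_map_mdiff:
  assumes "smooth_map A f" shows "mdiff f p"
proof (rule mdiffI[where c="chart_at A p" and c'="chart_at A (f p)"])
  show "isCont f p" using assms unfolding smooth_map_def by (simp add: continuous_on_eq_continuous_at)
  show "(snd (chart_at A (f p)) \<circ> f \<circ> chart_inv (chart_at A p)) differentiable at (snd (chart_at A p) p)"
    using assms chart_at unfolding smooth_map_def by (intro smooth_on_differentiable) auto
qed (auto simp: chart_at)

text \<open>It suffices to check a velocity in one chart.\<close>
lemma velocityI:
  assumes "isCont \<gamma> t" "X \<in> tangent_space A (\<gamma> t)" "c \<in> A" "\<gamma> t \<in> fst c"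
    and "((snd c \<circ> \<gamma>) has_vector_derivative X c) (at t)"
  shows "has_velocity A \<gamma> t X"
  unfolding has_velocity_def
proof (intro conjI ballI impI assms(1,2))
  fix c' assume c': "c' \<in> A" "\<gamma> t \<in> fst c'"
  let ?D = "frechet_derivative (snd c' \<circ> chart_inv c) (at (snd c (\<gamma> t)))"
  have tr: "((snd c' \<circ> chart_inv c) has_derivative ?D) (at (snd c (\<gamma> t)))"
    using transition_has_derivative assms c' by blast
  have "((snd c' \<circ> \<gamma>) has_derivative (?D \<circ> (\<lambda>h. h *\<^sub>R X c))) (at t)"
    using assms c' tr by (intro derivative_through_chart[where c=c]) (auto simp: has_vector_derivative_def)
  moreover have "?D \<circ> (\<lambda>h. h *\<^sub>R X c) = (\<lambda>h. h *\<^sub>R X c')"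
    using tangent_space_transform[OF assms(2,3) c'(1) assms(4) c'(2)]
      bounded_linear.linear[OF has_derivative_bounded_linear[OF tr]] by (auto simp: fun_eq_iff linear_cmul)
  ultimately show "((snd c' \<circ> \<gamma>) has_vector_derivative X c') (at t)" by (simp add: has_vector_derivative_def)
qed

lemma velocity_unique:
  assumes "has_velocity A \<gamma> t X" "has_velocity A \<gamma> t Y" shows "X = Y"
proof -
  let ?c = "chart_at A (\<gamma> t)"
  have "X ?c = Y ?c" using assms chart_at unfolding has_velocity_def by (meson vector_derivative_unique_at)
  then show ?thesis using assms tangent_space_eqI chart_at unfolding has_velocity_def by blast
qed

lemma velocity_map:
  assumes "has_velocity A \<gamma> t X" "mdiff f (\<gamma> t)"
  shows "has_velocity A (f \<circ> \<gamma>) t (dmap A f (\<gamma> t) X)"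
proof -
  let ?c = "chart_at A (\<gamma> t)" let ?d = "chart_at A (f (\<gamma> t))"
  let ?D = "frechet_derivative (snd ?d \<circ> f \<circ> chart_inv ?c) (at (snd ?c (\<gamma> t)))"
  have X: "X \<in> tangent_space A (\<gamma> t)" "isCont \<gamma> t" using assms unfolding has_velocity_def by auto
  have D: "((snd ?d \<circ> f \<circ> chart_inv ?c) has_derivative ?D) (at (snd ?c (\<gamma> t)))"
    using mdiffD[OF assms(2)] chart_at by blast
  have "(((snd ?d \<circ> f) \<circ> \<gamma>) has_derivative (?D \<circ> (\<lambda>h. h *\<^sub>R X ?c))) (at t)"
    using D chart_at assms unfolding has_velocity_def has_vector_derivative_def
    by (intro derivative_through_chart[where c="?c"]) auto
  moreover have "?D \<circ> (\<lambda>h. h *\<^sub>R X ?c) = (\<lambda>h. h *\<^sub>R dmap A f (\<gamma> t) X ?d)"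
    using dmap_in_chart[OF assms(2) X(1) chart_at(1) chart_at(1) chart_at(2) chart_at(2)]
      bounded_linear.linear[OF has_derivative_bounded_linear[OF D]] by (auto simp: fun_eq_iff linear_cmul)
  ultimately have "((snd ?d \<circ> (f \<circ> \<gamma>)) has_vector_derivative dmap A f (\<gamma> t) X ?d) (at t)"
    by (simp add: has_vector_derivative_def o_assoc)
  moreover have "isCont (f \<circ> \<gamma>) t" using X(2) assms(2) continuous_at_compose unfolding mdiff_def by blast
  ultimately show ?thesis
    using dmap_in_tangent_space[OF assms(2) X(1)] chart_at by (intro velocityI) auto
qed

lemma velocity_cong:
  assumes "\<forall>\<^sub>F s in nhds t. \<gamma> s = \<delta> s"
  shows "has_velocity A \<gamma> t X \<longleftrightarrow> has_velocity A \<delta> t X"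
proof -
  have p: "\<gamma> t = \<delta> t" using eventually_nhds_x_imp_x[OF assms] .
  have "\<forall>\<^sub>F s in nhds t. (snd c \<circ> \<gamma>) s = (snd c \<circ> \<delta>) s" for c :: "('m,'e) chart"
    by (rule eventually_mono[OF assms]) (simp only: comp_apply)
  from frechet_derivative_eventually_cong(1)[OF this]
  show ?thesis unfolding has_velocity_def p has_vector_derivative_def isCont_cong[OF assms] by (simp only:)
qed

lemma velocity_affine:
  assumes "has_velocity A \<gamma> (a * t + b) X"
  shows "has_velocity A (\<lambda>s. \<gamma> (a * s + b)) t (\<lambda>c. a *\<^sub>R X c)"
proof -
  have aff: "((\<lambda>s. a * s + b) has_vector_derivative a) (at t)" by (auto intro!: derivative_eq_intros)
  have X: "X \<in> tangent_space A (\<gamma> (a * t + b))" using assms unfolding has_velocity_def by auto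
  have "tlin a X 0 X \<in> tangent_space A (\<gamma> (a * t + b))" by (rule tlin_in_tangent_space[OF X X])
  moreover have "isCont (\<gamma> \<circ> (\<lambda>s. a * s + b)) t"
    by (rule continuous_at_compose) (use assms in \<open>auto simp: has_velocity_def intro!: continuous_intros\<close>)
  moreover have "((snd c \<circ> \<gamma> \<circ> (\<lambda>s. a * s + b)) has_vector_derivative a *\<^sub>R X c) (at t)"
    if "c \<in> A" "\<gamma> (a * t + b) \<in> fst c" for c
    using vector_diff_chain_at[OF aff] assms that unfolding has_velocity_def by blast
  ultimately show ?thesis unfolding has_velocity_def by (auto simp: tlin_def o_def)
qed

lemma dfun_in_chart:
  assumes "smooth_fun A H" "X \<in> tangent_space A p" "c \<in> A" "p \<in> fst c"
  shows "dfun A H p X = frechet_derivative (H \<circ> chart_inv c) (at (snd c p)) (X c)"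
    "((H \<circ> chart_inv c) has_derivative frechet_derivative (H \<circ> chart_inv c) (at (snd c p))) (at (snd c p))"
proof -
  have d: "(H \<circ> chart_inv c) differentiable (at (snd c p))"
    using assms unfolding smooth_fun_def by (intro smooth_on_differentiable) auto
  then show "((H \<circ> chart_inv c) has_derivative frechet_derivative (H \<circ> chart_inv c) (at (snd c p))) (at (snd c p))"
    using frechet_derivative_works by blast
  show "dfun A H p X = frechet_derivative (H \<circ> chart_inv c) (at (snd c p)) (X c)"
    unfolding dfun_def Let_def using chart_independence(2)[OF assms(3) chart_at(1) assms(4) chart_at(2) d assms(2)] .
qed

lemma dfun_tlin:
  assumes "smooth_fun A H" "X \<in> tangent_space A p" "Y \<in> tangent_space A p"
  shows "dfun A H p (tlin a X b Y) = a * dfun A H p X + b * dfun A H p Y"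
proof -
  let ?c = "chart_at A p"
  interpret bounded_linear "frechet_derivative (H \<circ> chart_inv ?c) (at (snd ?c p))"
    by (rule has_derivative_bounded_linear[OF dfun_in_chart(2)[OF assms(1,2) chart_at]])
  show ?thesis unfolding dfun_def Let_def tlin_def by (simp add: add scaleR)
qed

lemma dfun_velocity:
  assumes "smooth_fun A H" "has_velocity A \<gamma> t X"
  shows "((H \<circ> \<gamma>) has_vector_derivative dfun A H (\<gamma> t) X) (at t)"
proof -
  let ?c = "chart_at A (\<gamma> t)"
  let ?D = "frechet_derivative (H \<circ> chart_inv ?c) (at (snd ?c (\<gamma> t)))"
  have X: "X \<in> tangent_space A (\<gamma> t)" using assms unfolding has_velocity_def by auto
  note D = dfun_in_chart[OF assms(1) X chart_at]
  have "((H \<circ> \<gamma>) has_derivative (?D \<circ> (\<lambda>h. h *\<^sub>R X ?c))) (at t)"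
    using D(2) chart_at assms unfolding has_velocity_def has_vector_derivative_def
    by (intro derivative_through_chart[where c="?c"]) auto
  moreover have "?D \<circ> (\<lambda>h. h *\<^sub>R X ?c) = (\<lambda>h. h *\<^sub>R dfun A H (\<gamma> t) X)"
    using D(1) bounded_linear.linear[OF has_derivative_bounded_linear[OF D(2)]] by (auto simp: fun_eq_iff linear_cmul)
  ultimately show ?thesis by (simp add: has_vector_derivative_def)
qed

lemma dfun_dmap:
  assumes "smooth_fun A H" "mdiff f p" "\<forall>\<^sub>F q in nhds p. H (f q) = H q" "X \<in> tangent_space A p"
  shows "dfun A H (f p) (dmap A f p X) = dfun A H p X"
proof -
  let ?c = "chart_at A p" let ?d = "chart_at A (f p)"
  let ?E = "frechet_derivative (H \<circ> chart_inv ?d) (at (snd ?d (f p)))"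
  let ?D = "frechet_derivative (snd ?d \<circ> f \<circ> chart_inv ?c) (at (snd ?c p))"
  note dX = dmap_in_tangent_space[OF assms(2,4)]
  have fp: "f (chart_inv ?c (snd ?c p)) = f p" using chart_at by (simp add: chart_inv_chart)
  have "((H \<circ> (f \<circ> chart_inv ?c)) has_derivative ?E \<circ> ?D) (at (snd ?c p))"
    using mdiffD[OF assms(2), of ?c ?d] dfun_in_chart(2)[OF assms(1) dX chart_at] isCont_rep[of ?c p f] fp chart_at assms(2)
    by (intro derivative_through_chart[where c="?d"]) (auto simp: o_assoc mdiff_def)
  moreover have "\<forall>\<^sub>F x in nhds (snd ?c p). (H \<circ> (f \<circ> chart_inv ?c)) x = (H \<circ> chart_inv ?c) x"
    using eventually_chart_inv[OF chart_at assms(3)] by eventually_elim simp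
  ultimately have "((H \<circ> chart_inv ?c) has_derivative ?E \<circ> ?D) (at (snd ?c p))"
    using frechet_derivative_eventually_cong(1) by blast
  then show ?thesis
    using frechet_derivative_at dfun_in_chart(1)[OF assms(1) dX chart_at] dfun_in_chart(1)[OF assms(1,4) chart_at]
      dmap_in_chart[OF assms(2,4) chart_at(1) chart_at(1) chart_at(2) chart_at(2)] by (metis comp_apply)
qed

end

section \<open>The Hamiltonian vector field\<close>

text \<open>A symplectic manifold with a Hamiltonian function.  The dimension is that of the coordinate
  space and is arbitrary here.\<close>
locale ham_mfd = smooth_mfd A
  for A :: "('m::{t2_space, second_countable_topology}, real ^ 'n) chart set" +
  fixes \<omega> :: "('m, real ^ 'n) form2" and H :: "'m \<Rightarrow> real"
  assumes symplectic: "symplectic_manifold A \<omega>" and smooth_H: "smooth_fun A H"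
begin

lemma form_skew: "X \<in> tangent_space A p \<Longrightarrow> Y \<in> tangent_space A p \<Longrightarrow> \<omega> p X Y = - \<omega> p Y X"
  using symplectic unfolding symplectic_manifold_def differential_2form_def by blast

lemma form_left: "X \<in> tangent_space A p \<Longrightarrow> Y \<in> tangent_space A p \<Longrightarrow> Z \<in> tangent_space A p \<Longrightarrow>
    \<omega> p (tlin a X b Y) Z = a * \<omega> p X Z + b * \<omega> p Y Z"
  using symplectic unfolding symplectic_manifold_def differential_2form_def by blast

lemma form_right: "X \<in> tangent_space A p \<Longrightarrow> Y \<in> tangent_space A p \<Longrightarrow> Z \<in> tangent_space A p \<Longrightarrow>
    \<omega> p Z (tlin a X b Y) = a * \<omega> p Z X + b * \<omega> p Z Y"
  using form_left[of X p Y Z a b] form_skew[of Z p X] form_skew[of Z p Y]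
    form_skew[of Z p "tlin a X b Y"] tlin_in_tangent_space[of X p Y a b] by simp

lemma form_nondegenerate:
  "X \<in> tangent_space A p \<Longrightarrow> (\<And>Y. Y \<in> tangent_space A p \<Longrightarrow> \<omega> p X Y = 0) \<Longrightarrow> X = (\<lambda>_. 0)"
  using symplectic unfolding symplectic_manifold_def by blast

text \<open>The matrix of the symplectic form in the coordinates of a chart, as a function of the
  coordinates.\<close>
definition form_matrix :: "('m, real^'n) chart \<Rightarrow> real^'n \<Rightarrow> real^'n^'n" where
  "form_matrix c x = (\<chi> i j. form_in_chart A \<omega> c (axis i 1) (axis j 1) x)"

text \<open>The partial derivatives of \<open>H\<close> in the coordinates of a chart.\<close>
definition gradient :: "('m, real^'n) chart \<Rightarrow> real^'n \<Rightarrow> real^'n" where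
  "gradient c x = (\<chi> i. frechet_derivative (H \<circ> chart_inv c) (at x) (axis i 1))"

lemma coord_tvec_linear:
  assumes "c \<in> A" "p \<in> fst c"
  shows "coord_tvec A c p (a *\<^sub>R u + b *\<^sub>R w) = tlin a (coord_tvec A c p u) b (coord_tvec A c p w)"
proof (rule tangent_space_eqI[OF _ _ assms])
  show "tlin a (coord_tvec A c p u) b (coord_tvec A c p w) \<in> tangent_space A p"
    by (intro tlin_in_tangent_space coord_tvec assms)
qed (simp_all add: coord_tvec[OF assms] tlin_def)

lemma form_coord_linear:
  assumes "c \<in> A" "p \<in> fst c"
  shows "linear (\<lambda>u. \<omega> p (coord_tvec A c p u) (coord_tvec A c p w))"
    "linear (\<lambda>w. \<omega> p (coord_tvec A c p u) (coord_tvec A c p w))"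
proof -
  have add: "coord_tvec A c p (x + y) = tlin 1 (coord_tvec A c p x) 1 (coord_tvec A c p y)"
    and scale: "coord_tvec A c p (r *\<^sub>R x) = tlin r (coord_tvec A c p x) 0 (coord_tvec A c p x)" for r x y
    using coord_tvec_linear[OF assms, of 1 x 1 y] coord_tvec_linear[OF assms, of r x 0 x] by simp_all
  note ct = coord_tvec(1)[OF assms]
  show "linear (\<lambda>u. \<omega> p (coord_tvec A c p u) (coord_tvec A c p w))"
    by (rule linearI) (simp_all only: add scale form_left[OF ct ct ct], simp_all)
  show "linear (\<lambda>w. \<omega> p (coord_tvec A c p u) (coord_tvec A c p w))"
    by (rule linearI) (simp_all only: add scale form_right[OF ct ct ct], simp_all)
qed

lemma form_matrix_mult:
  assumes "c \<in> A" "p \<in> fst c"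
  shows "(form_matrix c (snd c p) *v w) $ i = \<omega> p (coord_tvec A c p (axis i 1)) (coord_tvec A c p w)"
  using linear_axis_expansion[OF form_coord_linear(2)[OF assms], of "axis i 1" w]
  by (simp add: form_matrix_def form_in_chart_def Let_def chart_inv_chart assms matrix_vector_mult_def mult.commute)

lemma form_coord:
  assumes "c \<in> A" "p \<in> fst c"
  shows "\<omega> p (coord_tvec A c p u) (coord_tvec A c p w) = u \<bullet> (form_matrix c (snd c p) *v w)"
  using linear_axis_expansion[OF form_coord_linear(1)[OF assms, of w], of u]
  by (simp add: form_matrix_mult[OF assms] inner_vec_def)

lemma det_form_matrix:
  assumes "c \<in> A" "p \<in> fst c"
  shows "det (form_matrix c (snd c p)) \<noteq> 0"
proof -
  note ct = coord_tvec[OF assms]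
  have "w = 0" if "form_matrix c (snd c p) *v w = 0" for w
  proof -
    have "\<omega> p (coord_tvec A c p w) Y = 0" if Y: "Y \<in> tangent_space A p" for Y
      using form_coord[OF assms, of "Y c" w] form_skew[OF ct(1)[of w] Y] ct(3)[OF Y]
        \<open>form_matrix c (snd c p) *v w = 0\<close> by simp
    then have "coord_tvec A c p w = (\<lambda>_. 0)" using form_nondegenerate[OF ct(1)] by blast
    from fun_cong[OF this, of c] show ?thesis unfolding ct(2) .
  qed
  then show ?thesis
    unfolding invertible_det_nz[symmetric] invertible_left_inverse matrix_left_invertible_ker by blast
qed

lemma dfun_coord:
  assumes "c \<in> A" "p \<in> fst c" "Y \<in> tangent_space A p"
  shows "dfun A H p Y = Y c \<bullet> gradient c (snd c p)"
proof -
  note D = dfun_in_chart[OF smooth_H assms(3,1,2)]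
  show ?thesis
    unfolding D(1) using linear_axis_expansion[OF bounded_linear.linear[OF has_derivative_bounded_linear[OF D(2)]], of "Y c"]
    by (simp add: gradient_def inner_vec_def)
qed

text \<open>In coordinates the equation defining the Hamiltonian vector field is a linear system.\<close>
lemma hamiltonian_iff:
  assumes "c \<in> A" "p \<in> fst c" "X \<in> tangent_space A p"
  shows "(\<forall>Y\<in>tangent_space A p. dfun A H p Y = \<omega> p Y X) \<longleftrightarrow> form_matrix c (snd c p) *v (X c) = gradient c (snd c p)"
proof -
  note ct = coord_tvec[OF assms(1,2)]
  have om: "\<omega> p Y X = Y c \<bullet> (form_matrix c (snd c p) *v (X c))" if "Y \<in> tangent_space A p" for Y
    using form_coord[OF assms(1,2), of "Y c" "X c"] ct(3)[OF that] ct(3)[OF assms(3)] by simp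
  show ?thesis
  proof
    assume "\<forall>Y\<in>tangent_space A p. dfun A H p Y = \<omega> p Y X"
    then have "u \<bullet> gradient c (snd c p) = u \<bullet> (form_matrix c (snd c p) *v (X c))" for u
      using om[OF ct(1)[of u]] dfun_coord[OF assms(1,2) ct(1)[of u]] ct(1,2)[of u] by simp
    then show "form_matrix c (snd c p) *v (X c) = gradient c (snd c p)"
      using vector_eq_rdot by (metis inner_commute)
  qed (simp add: om dfun_coord[OF assms(1,2)])
qed

lemma ham_vf_ex1:
  "\<exists>!X. X \<in> tangent_space A p \<and> (\<forall>Y\<in>tangent_space A p. dfun A H p Y = \<omega> p Y X)"
proof -
  obtain c where c: "c \<in> A" "p \<in> fst c" using ex_chart by blast
  note ct = coord_tvec[OF c]
  note cr = cramer[OF det_form_matrix[OF c]]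
  let ?w = "\<chi> k. det (\<chi> i j. if j = k then gradient c (snd c p) $ i else form_matrix c (snd c p) $ i $ j) / det (form_matrix c (snd c p))"
  show ?thesis
  proof (rule ex1I[of _ "coord_tvec A c p ?w"])
    show "coord_tvec A c p ?w \<in> tangent_space A p \<and> (\<forall>Y\<in>tangent_space A p. dfun A H p Y = \<omega> p Y (coord_tvec A c p ?w))"
      using hamiltonian_iff[OF c ct(1)[of ?w]] ct(1)[of ?w] unfolding ct(2) cr by blast
    fix X assume "X \<in> tangent_space A p \<and> (\<forall>Y\<in>tangent_space A p. dfun A H p Y = \<omega> p Y X)"
    then show "X = coord_tvec A c p ?w"
      using hamiltonian_iff[OF c, of X] ct(3)[of X] unfolding cr by force
  qed
qed

lemma
  shows ham_vf_in_tangent_space: "ham_vf A \<omega> H p \<in> tangent_space A p"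
    and dfun_eq_form: "Y \<in> tangent_space A p \<Longrightarrow> dfun A H p Y = \<omega> p Y (ham_vf A \<omega> H p)"
  using theI'[OF ham_vf_ex1, of p] unfolding ham_vf_def by blast+

lemma ham_vf_eqI:
  "X \<in> tangent_space A p \<Longrightarrow> (\<And>Y. Y \<in> tangent_space A p \<Longrightarrow> dfun A H p Y = \<omega> p Y X) \<Longrightarrow> ham_vf A \<omega> H p = X"
  unfolding ham_vf_def by (rule the1_equality[OF ham_vf_ex1]) blast

text \<open>The representation of the Hamiltonian vector field in a chart.\<close>
definition ham_coord :: "('m, real^'n) chart \<Rightarrow> real^'n \<Rightarrow> real^'n" where
  "ham_coord c x = ham_vf A \<omega> H (chart_inv c x) c"

text \<open>Cramer's rule expresses the components as quotients of determinants in smooth functions.\<close>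
lemma ham_coord_C1:
  assumes "c \<in> A"
  shows "C1 (snd c ` fst c) (ham_coord c)"
proof (rule C1_cong[OF open_range[OF assms]])
  let ?w = "\<lambda>x. \<chi> k. det (\<chi> i j. if j = k then gradient c x $ i else form_matrix c x $ i $ j) / det (form_matrix c x)"
  show "?w x = ham_coord c x" if x: "x \<in> snd c ` fst c" for x
  proof -
    obtain p where p: "p \<in> fst c" "x = snd c p" using x by blast
    have "form_matrix c x *v ham_coord c x = gradient c x"
      using hamiltonian_iff[OF assms p(1) ham_vf_in_tangent_space] dfun_eq_form[of _ p] p assms
      by (simp add: ham_coord_def chart_inv_chart)
    then show ?thesis using cramer[OF det_form_matrix[OF assms p(1)], of "ham_coord c x" "gradient c x"] p(2) by metis
  qed
  have fm: "C1 (snd c ` fst c) (\<lambda>x. form_matrix c x $ i $ j)" for i j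
  proof -
    have "smooth_on (snd c ` fst c) (form_in_chart A \<omega> c (axis i 1) (axis j 1))"
      using symplectic assms unfolding symplectic_manifold_def differential_2form_def by blast
    from smooth_on_C1(1)[OF this] show ?thesis by (simp add: form_matrix_def)
  qed
  have gr: "C1 (snd c ` fst c) (\<lambda>x. gradient c x $ i)" for i
  proof -
    have "smooth_on (snd c ` fst c) (H \<circ> chart_inv c)"
      using smooth_H assms unfolding smooth_fun_def by blast
    from smooth_on_C1(2)[OF this] show ?thesis by (simp add: gradient_def)
  qed
  show "C1 (snd c ` fst c) ?w"
  proof (rule C1_vec)
    fix k
    have e: "C1 (snd c ` fst c) (\<lambda>x. (\<chi> i j. if j = k then gradient c x $ i else form_matrix c x $ i $ j) $ i $ j)" for i j
      using fm gr by (cases "j = k") auto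
    have "C1 (snd c ` fst c) (\<lambda>x. det (\<chi> i j. if j = k then gradient c x $ i else form_matrix c x $ i $ j) * inverse (det (form_matrix c x)))"
      using det_form_matrix[OF assms] by (intro C1_mult C1_inverse C1_det e fm) auto
    then show "C1 (snd c ` fst c) (\<lambda>x. ?w x $ k)" by (simp add: divide_inverse)
  qed
qed

text \<open>An antisymplectic involution preserving \<open>H\<close> reverses the Hamiltonian vector field.  The
  negative of a tangent vector is written with \<open>tlin\<close>.\<close>
lemma antisymplectic_ham_vf:
  assumes "antisymplectic_involution A \<omega> \<rho>" "H \<circ> \<rho> = H"
  shows "ham_vf A \<omega> H (\<rho> p) = tlin (-1) (dmap A \<rho> p (ham_vf A \<omega> H p)) 0 (dmap A \<rho> p (ham_vf A \<omega> H p))"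
proof (rule ham_vf_eqI)
  let ?X = "ham_vf A \<omega> H p"
  have sm: "mdiff \<rho> q" for q
    using assms smooth_map_mdiff unfolding antisymplectic_involution_def diffeomorphism_def by blast
  have inv: "\<rho> (\<rho> q) = q" for q
    using assms unfolding antisymplectic_involution_def by (metis comp_apply id_apply)
  note dX = dmap_in_tangent_space[OF sm ham_vf_in_tangent_space, of p]
  show "tlin (-1) (dmap A \<rho> p ?X) 0 (dmap A \<rho> p ?X) \<in> tangent_space A (\<rho> p)"
    using tlin_in_tangent_space[OF dX dX] .
  fix Y assume Y: "Y \<in> tangent_space A (\<rho> p)"
  define Y' where "Y' = dmap A \<rho> (\<rho> p) Y"
  have Y': "Y' \<in> tangent_space A p" using dmap_in_tangent_space[OF sm Y] inv by (simp add: Y'_def)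
  have "\<rho> \<circ> \<rho> = id" using inv by auto
  then have YY: "Y = dmap A \<rho> p Y'"
    using mdiff_comp(2)[OF sm sm Y] mdiff_id(2)[OF Y] inv by (simp add: Y'_def)
  have "dfun A H (\<rho> p) Y = dfun A H p Y'"
    unfolding YY by (rule dfun_dmap[OF smooth_H sm _ Y']) (simp add: fun_cong[OF assms(2), unfolded comp_apply])
  also have "\<dots> = \<omega> p Y' ?X" by (rule dfun_eq_form[OF Y'])
  also have "\<dots> = - \<omega> (\<rho> p) Y (dmap A \<rho> p ?X)"
    using assms(1) Y' ham_vf_in_tangent_space[of p] unfolding antisymplectic_involution_def YY by simp
  also have "\<dots> = \<omega> (\<rho> p) Y (tlin (-1) (dmap A \<rho> p ?X) 0 (dmap A \<rho> p ?X))"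
    using form_right[OF dX dX Y] by simp
  finally show "dfun A H (\<rho> p) Y = \<omega> (\<rho> p) Y (tlin (-1) (dmap A \<rho> p ?X) 0 (dmap A \<rho> p ?X))" .
qed

end

section \<open>The Hamiltonian flow\<close>

context ham_mfd
begin

text \<open>Integral curves of the Hamiltonian vector field on an open interval, without initial
  condition.\<close>
definition integral_curve :: "(real \<Rightarrow> 'm) \<Rightarrow> real set \<Rightarrow> bool" where
  "integral_curve \<gamma> I \<longleftrightarrow> open I \<and> is_interval I \<and> (\<forall>s\<in>I. has_velocity A \<gamma> s (ham_vf A \<omega> H (\<gamma> s)))"

text \<open>The flow for time \<open>t\<close> as a relation: an integral curve leads from \<open>p\<close> to \<open>q\<close> in time \<open>t\<close>.
  In contrast to \<open>ham_flow\<close>, it also records that the curve exists.\<close>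
definition flows_to :: "real \<Rightarrow> 'm \<Rightarrow> 'm \<Rightarrow> bool" where
  "flows_to t p q \<longleftrightarrow> (\<exists>\<gamma> I. integral_curve \<gamma> I \<and> 0 \<in> I \<and> t \<in> I \<and> \<gamma> 0 = p \<and> \<gamma> t = q)"

lemma integral_curve_isCont: "integral_curve \<gamma> I \<Longrightarrow> s \<in> I \<Longrightarrow> isCont \<gamma> s"
  unfolding integral_curve_def has_velocity_def by blast

lemma integral_curve_in_chart:
  assumes "integral_curve \<gamma> I" "s \<in> I" "c \<in> A" "\<gamma> s \<in> fst c"
  shows "((snd c \<circ> \<gamma>) has_vector_derivative ham_coord c ((snd c \<circ> \<gamma>) s)) (at s)"
  using assms unfolding integral_curve_def has_velocity_def ham_coord_def by (simp add: chart_inv_chart)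

text \<open>The set where two integral curves agree is open by uniqueness in a chart, and its complement
  is open because the manifold is Hausdorff.\<close>
lemma integral_curve_unique:
  assumes \<gamma>: "integral_curve \<gamma> I" and \<delta>: "integral_curve \<delta> J" and s: "s \<in> I" "s \<in> J" "\<gamma> s = \<delta> s"
    and t: "t \<in> I" "t \<in> J"
  shows "\<gamma> t = \<delta> t"
proof -
  let ?K = "I \<inter> J"
  have K: "open ?K" "connected ?K"
    using \<gamma> \<delta> unfolding integral_curve_def by (auto simp: is_interval_Int is_interval_connected)
  define S where "S = {u \<in> ?K. \<gamma> u = \<delta> u}"
  define T where "T = {u \<in> ?K. \<gamma> u \<noteq> \<delta> u}"
  have cont: "isCont \<gamma> u" "isCont \<delta> u" if "u \<in> ?K" for u
    using that integral_curve_isCont \<gamma> \<delta> by auto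
  have "\<forall>\<^sub>F w in nhds u. w \<in> S" if u: "u \<in> S" for u
  proof -
    obtain c where c: "c \<in> A" "\<gamma> u \<in> fst c" using ex_chart by blast
    have uK: "u \<in> ?K" "\<gamma> u = \<delta> u" using u unfolding S_def by auto
    have "\<forall>\<^sub>F w in nhds u. w \<in> ?K" using K(1) uK(1) eventually_nhds_in_open by blast
    moreover have "\<forall>\<^sub>F w in nhds u. \<gamma> w \<in> fst c"
      by (rule eventually_pullback[OF cont(1)[OF uK(1)] eventually_in_domain[OF c]])
    moreover have "\<forall>\<^sub>F w in nhds u. \<delta> w \<in> fst c"
      by (rule eventually_pullback[OF cont(2)[OF uK(1)]]) (use eventually_in_domain[OF c] uK(2) in simp)
    ultimately have ev: "\<forall>\<^sub>F w in nhds u. w \<in> ?K \<and> \<gamma> w \<in> fst c \<and> \<delta> w \<in> fst c"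
      by eventually_elim simp
    obtain f' where f': "C1_on (snd c ` fst c) (ham_coord c) f'"
      using ham_coord_C1[OF c(1)] unfolding C1_def by blast
    have "\<forall>\<^sub>F w in nhds u. (snd c \<circ> \<gamma>) w = (snd c \<circ> \<delta>) w"
    proof (rule local_ode_uniqueness[OF open_range[OF c(1)] f'])
      show "\<forall>\<^sub>F w in nhds u. ((snd c \<circ> \<gamma>) has_vector_derivative ham_coord c ((snd c \<circ> \<gamma>) w)) (at w)"
        using ev by (rule eventually_mono) (use integral_curve_in_chart[OF \<gamma> _ c(1)] in blast)
      show "\<forall>\<^sub>F w in nhds u. ((snd c \<circ> \<delta>) has_vector_derivative ham_coord c ((snd c \<circ> \<delta>) w)) (at w)"
        using ev by (rule eventually_mono) (use integral_curve_in_chart[OF \<delta> _ c(1)] in blast)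
    qed (use c uK in auto)
    with ev show ?thesis
    proof eventually_elim
      case (elim w)
      then have "\<gamma> w = \<delta> w" by (metis chart_inv_chart[OF c(1)] comp_apply)
      then show ?case using elim unfolding S_def by blast
    qed
  qed
  then have "open S" by (subst open_subopen) (metis eventually_nhds subsetI)
  moreover have "\<forall>\<^sub>F w in nhds u. w \<in> T" if u: "u \<in> T" for u
  proof -
    have uK: "u \<in> ?K" "\<gamma> u \<noteq> \<delta> u" using u unfolding T_def by auto
    obtain V W where VW: "open V" "open W" "\<gamma> u \<in> V" "\<delta> u \<in> W" "V \<inter> W = {}"
      using hausdorff[OF uK(2)] by blast
    have "\<forall>\<^sub>F w in nhds u. w \<in> ?K" using K(1) uK(1) eventually_nhds_in_open by blast
    moreover have "\<forall>\<^sub>F w in nhds u. \<gamma> w \<in> V"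
      by (rule eventually_pullback[OF cont(1)[OF uK(1)] eventually_nhds_in_open[OF VW(1,3)]])
    moreover have "\<forall>\<^sub>F w in nhds u. \<delta> w \<in> W"
      by (rule eventually_pullback[OF cont(2)[OF uK(1)] eventually_nhds_in_open[OF VW(2,4)]])
    ultimately show ?thesis
      by eventually_elim (use VW(5) in \<open>auto simp: T_def\<close>)
  qed
  then have "open T" by (subst open_subopen) (metis eventually_nhds subsetI)
  moreover have "S \<inter> T \<inter> ?K = {}" "?K \<subseteq> S \<union> T" unfolding S_def T_def by auto
  ultimately have "S \<inter> ?K = {} \<or> T \<inter> ?K = {}" using connectedD[OF K(2)] by blast
  moreover have "s \<in> S \<inter> ?K" using s unfolding S_def by auto
  ultimately show ?thesis using t unfolding T_def by blast
qed

lemma ham_flow_eq: assumes "flows_to t p q" shows "ham_flow A \<omega> H t p = q"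
proof -
  have *: "(\<exists>\<gamma> I. open I \<and> is_interval I \<and> 0 \<in> I \<and> t \<in> I \<and>
     (\<forall>s\<in>I. has_velocity A \<gamma> s (ham_vf A \<omega> H (\<gamma> s))) \<and> \<gamma> 0 = p \<and> \<gamma> t = r) \<longleftrightarrow> flows_to t p r" for r
    unfolding flows_to_def integral_curve_def by blast
  show ?thesis
    unfolding ham_flow_def *
  proof (rule the_equality)
    show "flows_to t p q" by (rule assms)
    fix r assume "flows_to t p r"
    then obtain \<gamma> I where \<gamma>: "integral_curve \<gamma> I" "0 \<in> I" "t \<in> I" "\<gamma> 0 = p" "\<gamma> t = r"
      unfolding flows_to_def by blast
    obtain \<delta> J where \<delta>: "integral_curve \<delta> J" "0 \<in> J" "t \<in> J" "\<delta> 0 = p" "\<delta> t = q"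
      using assms unfolding flows_to_def by blast
    show "r = q" using integral_curve_unique[OF \<gamma>(1) \<delta>(1) \<gamma>(2) \<delta>(2) _ \<gamma>(3) \<delta>(3)] \<gamma>(4,5) \<delta>(4,5) by simp
  qed
qed

lemma integral_curve_shift:
  assumes "integral_curve \<gamma> I"
  shows "integral_curve (\<lambda>u. \<gamma> (u - s)) ((+) s ` I)"
  unfolding integral_curve_def
proof (intro conjI ballI)
  show "open ((+) s ` I)" using assms unfolding integral_curve_def by (simp add: open_translation)
  show "is_interval ((+) s ` I)" using assms unfolding integral_curve_def by simp
  fix u assume "u \<in> (+) s ` I"
  then have "u - s \<in> I" by auto
  then have "has_velocity A \<gamma> (1 * u + (- s)) (ham_vf A \<omega> H (\<gamma> (u - s)))"
    using assms unfolding integral_curve_def by simp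
  from velocity_affine[OF this] show "has_velocity A (\<lambda>u. \<gamma> (u - s)) u (ham_vf A \<omega> H (\<gamma> (u - s)))" by simp
qed

lemma flows_to_trans:
  assumes "flows_to s p q" "flows_to t q r"
  shows "flows_to (s + t) p r"
proof -
  obtain \<gamma> I where \<gamma>: "integral_curve \<gamma> I" "0 \<in> I" "s \<in> I" "\<gamma> 0 = p" "\<gamma> s = q"
    using assms(1) unfolding flows_to_def by blast
  obtain \<delta>0 J0 where \<delta>0: "integral_curve \<delta>0 J0" "0 \<in> J0" "t \<in> J0" "\<delta>0 0 = q" "\<delta>0 t = r"
    using assms(2) unfolding flows_to_def by blast
  define \<delta> where "\<delta> = (\<lambda>u. \<delta>0 (u - s))"
  define J where "J = (+) s ` J0"
  have \<delta>: "integral_curve \<delta> J" unfolding \<delta>_def J_def by (rule integral_curve_shift[OF \<delta>0(1)])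
  have J: "s \<in> J" "s + t \<in> J" "\<delta> s = q" "\<delta> (s + t) = r" using \<delta>0 unfolding J_def \<delta>_def by (auto simp: image_iff)
  \<comment> \<open>the two curves agree where both are defined, so they can be glued\<close>
  define \<eta> where "\<eta> u = (if u \<in> I then \<gamma> u else \<delta> u)" for u
  have \<eta>I: "\<eta> u = \<gamma> u" if "u \<in> I" for u using that unfolding \<eta>_def by simp
  have \<eta>J: "\<eta> u = \<delta> u" if "u \<in> J" for u
    using integral_curve_unique[OF \<gamma>(1) \<delta> \<gamma>(3) J(1)] that \<gamma>(5) J(3) unfolding \<eta>_def by auto
  have op: "open I" "open J" "is_interval I" "is_interval J" using \<gamma>(1) \<delta> unfolding integral_curve_def by auto
  have "integral_curve \<eta> (I \<union> J)"
    unfolding integral_curve_def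
  proof (intro conjI ballI)
    show "open (I \<union> J)" using op by blast
    show "is_interval (I \<union> J)"
      using op \<gamma>(3) J(1) connected_Un[of I J] by (auto simp: is_interval_connected_1)
    fix u assume "u \<in> I \<union> J"
    then show "has_velocity A \<eta> u (ham_vf A \<omega> H (\<eta> u))"
    proof
      assume u: "u \<in> I"
      have "\<forall>\<^sub>F w in nhds u. \<eta> w = \<gamma> w"
        using eventually_nhds_in_open[OF op(1) u] by (rule eventually_mono) (rule \<eta>I)
      then show ?thesis using velocity_cong \<gamma>(1) u \<eta>I[OF u] unfolding integral_curve_def by metis
    next
      assume u: "u \<in> J"
      have "\<forall>\<^sub>F w in nhds u. \<eta> w = \<delta> w"
        using eventually_nhds_in_open[OF op(2) u] by (rule eventually_mono) (rule \<eta>J)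
      then show ?thesis using velocity_cong \<delta> u \<eta>J[OF u] unfolding integral_curve_def by metis
    qed
  qed
  moreover have "\<eta> 0 = p" "\<eta> (s + t) = r" using \<eta>I[OF \<gamma>(2)] \<eta>J[OF J(2)] \<gamma>(4) J(4) by auto
  ultimately show ?thesis unfolding flows_to_def using \<gamma>(2) J(2) by blast
qed

lemma flows_to_sym:
  assumes "flows_to t p q" shows "flows_to (- t) q p"
proof -
  obtain \<gamma> I where \<gamma>: "integral_curve \<gamma> I" "0 \<in> I" "t \<in> I" "\<gamma> 0 = p" "\<gamma> t = q"
    using assms unfolding flows_to_def by blast
  show ?thesis unfolding flows_to_def
    using integral_curve_shift[OF \<gamma>(1), of "- t"] \<gamma>(2-)
    by (intro exI[of _ "\<lambda>u. \<gamma> (u - - t)"] exI[of _ "(+) (- t) ` I"]) (auto simp: image_iff)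
qed

lemma
  assumes "antisymplectic_involution A \<omega> \<rho>"
  shows antisymplectic_mdiff: "mdiff \<rho> p" and antisymplectic_involutive: "\<rho> (\<rho> p) = p"
proof -
  show "mdiff \<rho> p"
    using assms smooth_map_mdiff unfolding antisymplectic_involution_def diffeomorphism_def by blast
  show "\<rho> (\<rho> p) = p"
    using assms unfolding antisymplectic_involution_def by (metis comp_apply id_apply)
qed

lemma flows_to_reversed:
  assumes \<rho>: "antisymplectic_involution A \<omega> \<rho>" "H \<circ> \<rho> = H" and "flows_to t p q"
  shows "flows_to (- t) (\<rho> p) (\<rho> q)"
proof -
  obtain \<gamma> I where \<gamma>: "integral_curve \<gamma> I" "0 \<in> I" "t \<in> I" "\<gamma> 0 = p" "\<gamma> t = q"
    using assms unfolding flows_to_def by blast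
  have op: "open I" "is_interval I" using \<gamma>(1) unfolding integral_curve_def by auto
  have "integral_curve (\<lambda>u. \<rho> (\<gamma> (- u))) (uminus ` I)"
    unfolding integral_curve_def
  proof (intro conjI ballI)
    show "open (uminus ` I)" "is_interval (uminus ` I)" using op by (simp_all add: open_negations)
    fix u assume "u \<in> uminus ` I"
    then have u: "- u \<in> I" by auto
    let ?X = "ham_vf A \<omega> H (\<gamma> (- u))"
    have "has_velocity A \<gamma> ((-1) * u + 0) ?X" using \<gamma>(1) u unfolding integral_curve_def by simp
    from velocity_affine[OF this] have "has_velocity A (\<lambda>u. \<gamma> (- u)) u (tlin (-1) ?X 0 ?X)"
      by (simp add: tlin_def)
    from velocity_map[OF this antisymplectic_mdiff[OF \<rho>(1)]]
    have "has_velocity A (\<rho> \<circ> (\<lambda>u. \<gamma> (- u))) u (dmap A \<rho> (\<gamma> (- u)) (tlin (-1) ?X 0 ?X))" .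
    then show "has_velocity A (\<lambda>u. \<rho> (\<gamma> (- u))) u (ham_vf A \<omega> H (\<rho> (\<gamma> (- u))))"
      unfolding antisymplectic_ham_vf[OF \<rho>]
        dmap_tlin[OF antisymplectic_mdiff[OF \<rho>(1)] ham_vf_in_tangent_space ham_vf_in_tangent_space] o_def .
  qed
  then show ?thesis unfolding flows_to_def
    using \<gamma>(2-) by (intro exI[of _ "\<lambda>u. \<rho> (\<gamma> (- u))"] exI[of _ "uminus ` I"]) auto
qed

lemma energy_conservation:
  assumes "flows_to t p q" shows "H q = H p"
proof -
  obtain \<gamma> I where \<gamma>: "integral_curve \<gamma> I" "0 \<in> I" "t \<in> I" "\<gamma> 0 = p" "\<gamma> t = q"
    using assms unfolding flows_to_def by blast
  have "norm ((H \<circ> \<gamma>) t - (H \<circ> \<gamma>) 0) \<le> 0 * \<bar>t - 0\<bar>"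
  proof (rule vector_mean_value[where S=I and u'="\<lambda>_. 0"])
    show "convex I" using \<gamma>(1) unfolding integral_curve_def by (simp add: is_interval_convex)
    fix s assume s: "s \<in> I"
    let ?X = "ham_vf A \<omega> H (\<gamma> s)"
    have "dfun A H (\<gamma> s) ?X = 0"
      using dfun_eq_form[OF ham_vf_in_tangent_space] form_skew[OF ham_vf_in_tangent_space ham_vf_in_tangent_space, of "\<gamma> s"] by simp
    then show "((H \<circ> \<gamma>) has_vector_derivative 0) (at s within I)"
      using dfun_velocity[OF smooth_H, of \<gamma> s ?X] \<gamma>(1) s has_vector_derivative_at_within
      unfolding integral_curve_def by metis
  qed (use \<gamma> in auto)
  then show ?thesis using \<gamma> by simp
qed

text \<open>The flow for time \<open>t\<close> is defined near \<open>p\<close> and differentiable at \<open>p\<close>.\<close>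
definition flow_differentiable :: "real \<Rightarrow> 'm \<Rightarrow> bool" where
  "flow_differentiable t p \<longleftrightarrow> (\<forall>\<^sub>F q in nhds p. flows_to t q (ham_flow A \<omega> H t q)) \<and> mdiff (ham_flow A \<omega> H t) p"

lemma local_flow_differentiable:
  "\<exists>W \<epsilon>. open W \<and> p \<in> W \<and> \<epsilon> > 0 \<and> (\<forall>q\<in>W. \<forall>t. \<bar>t\<bar> < \<epsilon> \<longrightarrow> flow_differentiable t q)"
proof -
  obtain c where c: "c \<in> A" "p \<in> fst c" using ex_chart by blast
  obtain f' where f': "C1_on (snd c ` fst c) (ham_coord c) f'"
    using ham_coord_C1[OF c(1)] unfolding C1_def by blast
  obtain r \<epsilon> \<Phi> where r: "r > 0" "\<epsilon> > 0" "ball (snd c p) r \<subseteq> snd c ` fst c"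
    and \<Phi>0: "\<And>x. x \<in> ball (snd c p) r \<Longrightarrow> \<Phi> x 0 = x"
    and \<Phi>in: "\<And>x t. x \<in> ball (snd c p) r \<Longrightarrow> t \<in> {-\<epsilon><..<\<epsilon>} \<Longrightarrow> \<Phi> x t \<in> snd c ` fst c"
    and \<Phi>: "\<And>x t. x \<in> ball (snd c p) r \<Longrightarrow> t \<in> {-\<epsilon><..<\<epsilon>} \<Longrightarrow> (\<Phi> x has_vector_derivative ham_coord c (\<Phi> x t)) (at t)"
    and \<Phi>d: "\<And>x t. x \<in> ball (snd c p) r \<Longrightarrow> t \<in> {-\<epsilon><..<\<epsilon>} \<Longrightarrow> (\<lambda>x. \<Phi> x t) differentiable (at x)"
    by (rule local_flow[OF open_range[OF c(1)] f' imageI[OF c(2)]]) blast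
  let ?I = "{-\<epsilon><..<\<epsilon>}"
  define W where "W = fst c \<inter> snd c -` ball (snd c p) r"
  have "continuous_on (fst c) (snd c)" using chart_homeo[OF c(1)] homeomorphism_cont1 by blast
  from continuous_open_preimage[OF this open_domain[OF c(1)] open_ball]
  have W: "open W" "p \<in> W"
    using c(2) r(1) by (simp_all add: W_def)
  have ic: "isCont (chart_inv c) y" if "y \<in> snd c ` fst c" for y
    using that isCont_chart_inv[OF c(1)] by blast
  have fl: "flows_to t q (chart_inv c (\<Phi> (snd c q) t))" if q: "q \<in> W" and t: "t \<in> ?I" for q t
  proof -
    have q': "q \<in> fst c" "snd c q \<in> ball (snd c p) r" using q unfolding W_def by auto
    have "integral_curve (chart_inv c \<circ> \<Phi> (snd c q)) ?I"
      unfolding integral_curve_def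
    proof (intro conjI ballI)
      fix s assume s: "s \<in> ?I"
      let ?x = "\<Phi> (snd c q)"
      note xin = \<Phi>in[OF q'(2) s]
      have d: "(?x has_vector_derivative ham_coord c (?x s)) (at s)" by (rule \<Phi>[OF q'(2) s])
      have "isCont ?x s" using has_vector_derivative_continuous[OF d] .
      then have "isCont (chart_inv c \<circ> ?x) s" using ic[OF xin] by (rule continuous_at_compose)
      moreover have "((snd c \<circ> (chart_inv c \<circ> ?x)) has_vector_derivative ham_coord c (?x s)) (at s)"
      proof -
        have "\<forall>\<^sub>F u in nhds s. ?x u = (snd c \<circ> (chart_inv c \<circ> ?x)) u"
          using eventually_nhds_in_open[OF open_greaterThanLessThan s]
          by (rule eventually_mono) (use chart_chart_inv[OF c(1)] \<Phi>in[OF q'(2)] in auto)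
        then show ?thesis using d frechet_derivative_eventually_cong(1) unfolding has_vector_derivative_def by blast
      qed
      ultimately show "has_velocity A (chart_inv c \<circ> ?x) s (ham_vf A \<omega> H ((chart_inv c \<circ> ?x) s))"
        using ham_vf_in_tangent_space c(1) chart_inv_in[OF c(1) xin]
        by (intro velocityI[where c=c]) (auto simp: ham_coord_def)
    qed (auto simp: is_interval_oo)
    then show ?thesis
      unfolding flows_to_def using r(2) t chart_inv_chart[OF c(1) q'(1)] \<Phi>0[OF q'(2)]
      by (intro exI[of _ "chart_inv c \<circ> \<Phi> (snd c q)"] exI[of _ ?I]) auto
  qed
  have "flow_differentiable t q" if q: "q \<in> W" and t: "\<bar>t\<bar> < \<epsilon>" for q t
  proof -
    have t': "t \<in> ?I" using t by auto
    have q': "q \<in> fst c" "snd c q \<in> ball (snd c p) r" using q unfolding W_def by auto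
    have evW: "\<forall>\<^sub>F q' in nhds q. q' \<in> W" using W(1) q eventually_nhds_in_open by blast
    let ?F = "\<lambda>q'. chart_inv c (\<Phi> (snd c q') t)"
    have eq: "ham_flow A \<omega> H t q' = ?F q'" if "q' \<in> W" for q'
      using ham_flow_eq[OF fl[OF that t']] .
    have 1: "\<forall>\<^sub>F q' in nhds q. flows_to t q' (ham_flow A \<omega> H t q')"
      using evW by (rule eventually_mono) (use fl eq t' in auto)
    have ev: "\<forall>\<^sub>F q' in nhds q. ?F q' = ham_flow A \<omega> H t q'"
      using evW by (rule eventually_mono) (use eq in auto)
    have "mdiff ?F q"
    proof (rule mdiffI[where c=c and c'=c])
      have "isCont (\<lambda>x. \<Phi> x t) (snd c q)" by (rule differentiable_imp_continuous_within[OF \<Phi>d[OF q'(2) t']])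
      then have "isCont (\<lambda>q'. \<Phi> (snd c q') t) q"
        using continuous_at_compose[OF isCont_chart[OF c(1) q'(1)]] by (simp add: o_def)
      then show "isCont ?F q"
        using continuous_at_compose[of q "\<lambda>q'. \<Phi> (snd c q') t" "chart_inv c"] ic[OF \<Phi>in[OF q'(2) t']] by (simp add: o_def)
      have "\<forall>\<^sub>F x in nhds (snd c q). x \<in> ball (snd c p) r" using q'(2) eventually_nhds_in_open open_ball by blast
      then have "\<forall>\<^sub>F x in nhds (snd c q). \<Phi> x t = (snd c \<circ> ?F \<circ> chart_inv c) x"
        by (rule eventually_mono) (use chart_chart_inv[OF c(1)] \<Phi>in[OF _ t'] r(3) in auto)
      from frechet_derivative_eventually_cong(3)[OF this] \<Phi>d[OF q'(2) t']
      show "(snd c \<circ> ?F \<circ> chart_inv c) differentiable at (snd c q)" by (rule iffD1)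
      show "?F q \<in> fst c" using chart_inv_in[OF c(1) \<Phi>in[OF q'(2) t']] .
    qed (use c q' in auto)
    then have "mdiff (ham_flow A \<omega> H t) q" using mdiff_cong(1)[OF ev] by blast
    with 1 show ?thesis unfolding flow_differentiable_def by blast
  qed
  then show ?thesis using W r(2) by blast
qed

lemma flow_differentiable_add:
  assumes "flow_differentiable s p" "flow_differentiable t (ham_flow A \<omega> H s p)"
  shows "flow_differentiable (s + t) p"
proof -
  let ?\<phi> = "ham_flow A \<omega> H"
  have s: "\<forall>\<^sub>F q in nhds p. flows_to s q (?\<phi> s q)" "mdiff (?\<phi> s) p"
    and t: "\<forall>\<^sub>F q in nhds (?\<phi> s p). flows_to t q (?\<phi> t q)" "mdiff (?\<phi> t) (?\<phi> s p)"
    using assms unfolding flow_differentiable_def by auto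
  have "isCont (?\<phi> s) p" using s(2) unfolding mdiff_def by blast
  from eventually_pullback[OF this t(1)] s(1)
  have ev: "\<forall>\<^sub>F q in nhds p. flows_to (s + t) q ((?\<phi> t \<circ> ?\<phi> s) q)"
    by eventually_elim (auto intro: flows_to_trans)
  then have ev2: "\<forall>\<^sub>F q in nhds p. (?\<phi> t \<circ> ?\<phi> s) q = ?\<phi> (s + t) q"
    by (rule eventually_mono) (simp add: ham_flow_eq)
  have "mdiff (?\<phi> (s + t)) p"
    using mdiff_comp(1)[OF s(2) t(2)] mdiff_cong(1)[OF ev2] by blast
  moreover have "\<forall>\<^sub>F q in nhds p. flows_to (s + t) q (?\<phi> (s + t) q)"
    using ev ev2 by eventually_elim simp
  ultimately show ?thesis unfolding flow_differentiable_def by blast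
qed

lemma flows_along_orbit:
  assumes "periodic_orbit A \<omega> H w \<kappa>"
  shows "flows_to t (w s) (w (s + t / \<kappa>))"
proof -
  have \<kappa>: "\<kappa> > 0" using assms unfolding periodic_orbit_def by blast
  have "integral_curve (\<lambda>u. w (s + u / \<kappa>)) UNIV"
    unfolding integral_curve_def
  proof (intro conjI ballI)
    fix u :: real
    have "has_velocity A w ((1/\<kappa>) * u + s) (\<lambda>c. \<kappa> *\<^sub>R ham_vf A \<omega> H (w ((1/\<kappa>) * u + s)) c)"
      using assms unfolding periodic_orbit_def by blast
    from velocity_affine[OF this] show "has_velocity A (\<lambda>u. w (s + u / \<kappa>)) u (ham_vf A \<omega> H (w (s + u / \<kappa>)))"
      using \<kappa> by (simp add: add.commute)
  qed auto
  then show ?thesis unfolding flows_to_def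
    by (intro exI[of _ "\<lambda>u. w (s + u / \<kappa>)"] exI[of _ UNIV]) auto
qed

lemma periodic_orbit_int:
  assumes "periodic_orbit A \<omega> H w \<kappa>"
  shows "w (x + of_int n) = w x"
proof -
  have 1: "w (y + 1) = w y" for y using assms unfolding periodic_orbit_def by blast
  show ?thesis
  proof (induction n rule: int_induct[where k=0])
    case (step1 i)
    then show ?case using 1[of "x + of_int i"] by (simp add: add.assoc)
  next
    case (step2 i)
    then show ?case using 1[of "x + of_int (i - 1)"] by (simp add: algebra_simps)
  qed simp
qed

text \<open>By compactness of the orbit the local flow exists for a uniform time at all its points; longer
  times are reached by composing short steps along the orbit.\<close>
lemma flow_differentiable_along_orbit:
  assumes per: "periodic_orbit A \<omega> H w \<kappa>"
  shows "flow_differentiable t (w s)"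
proof -
  have "\<forall>p. \<exists>W \<epsilon>. open W \<and> p \<in> W \<and> \<epsilon> > 0 \<and> (\<forall>q\<in>W. \<forall>t. \<bar>t\<bar> < \<epsilon> \<longrightarrow> flow_differentiable t q)"
    using local_flow_differentiable by blast
  then obtain W \<epsilon> where W: "\<And>p. open (W p)" "\<And>p. p \<in> W p" "\<And>p. \<epsilon> p > (0::real)"
    and D: "\<And>p q t. q \<in> W p \<Longrightarrow> \<bar>t\<bar> < \<epsilon> p \<Longrightarrow> flow_differentiable t q"
    by metis
  have "isCont w u" for u using per unfolding periodic_orbit_def has_velocity_def by blast
  then have "continuous_on {0..1} w" by (simp add: continuous_at_imp_continuous_on)
  then have comp: "compact (w ` {0..1})" by (rule compact_continuous_image) simp
  have rng: "w u \<in> w ` {0..1}" for u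
  proof -
    from periodic_orbit_int[OF per, of "frac u" "\<lfloor>u\<rfloor>"] have "w u = w (frac u)" by (simp add: frac_def)
    then show ?thesis using frac_ge_0[of u] frac_lt_1[of u] by (intro image_eqI[of _ _ "frac u"]) auto
  qed
  have "w ` {0..1} \<subseteq> (\<Union>p\<in>w ` {0..1}. W p)" using W(2) by blast
  then obtain C where C: "C \<subseteq> w ` {0..1}" "finite C" "w ` {0..1} \<subseteq> (\<Union>p\<in>C. W p)"
    by (rule compactE_image[OF comp W(1)])
  have "C \<noteq> {}" using C rng by auto
  define e where "e = Min (\<epsilon> ` C)"
  have e: "e > 0" unfolding e_def using C(2) \<open>C \<noteq> {}\<close> W(3) by simp
  have small: "flow_differentiable t (w u)" if "\<bar>t\<bar> < e" for t u
  proof -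
    obtain p where "p \<in> C" "w u \<in> W p" using C(3) rng[of u] by blast
    moreover have "e \<le> \<epsilon> p" unfolding e_def using C(2) \<open>p \<in> C\<close> by simp
    ultimately show ?thesis using D[of "w u" p t] that by simp
  qed
  obtain n :: nat where n: "\<bar>t\<bar> < of_nat n * e" using ex_less_of_nat_mult[OF e] by blast
  then have n0: "n > 0" by (cases n) auto
  let ?h = "t / n"
  have "\<bar>?h\<bar> < e" using n n0 by (simp add: field_simps)
  have "flow_differentiable (real k * ?h) (w s)" for k
  proof (induction k)
    case 0 then show ?case using small[of 0 s] e by simp
  next
    case (Suc k)
    have "ham_flow A \<omega> H (real k * ?h) (w s) = w (s + real k * ?h / \<kappa>)"
      by (rule ham_flow_eq[OF flows_along_orbit[OF per]])
    then have "flow_differentiable (real k * ?h + ?h) (w s)"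
      using flow_differentiable_add[OF Suc] small[OF \<open>\<bar>?h\<bar> < e\<close>] by simp
    then show ?case by (simp add: algebra_simps add_divide_distrib)
  qed
  from this[of n] show ?thesis using n0 by simp
qed

end

section \<open>Tangent spaces of energy levels\<close>

lemma near_infimum:
  fixes Z :: "real set"
  assumes "Z \<noteq> {}" "\<eta> > 0"
  shows "\<exists>s\<in>Z. \<forall>s'\<in>Z. \<bar>s\<bar> \<le> \<bar>s'\<bar> + \<eta>"
proof -
  have bdd: "bdd_below (abs ` Z)" by (rule bdd_belowI[of _ 0]) auto
  have "Inf (abs ` Z) < Inf (abs ` Z) + \<eta>" using assms by simp
  then obtain s where s: "s \<in> Z" "\<bar>s\<bar> < Inf (abs ` Z) + \<eta>"
    using cInf_lessD[of "abs ` Z"] assms(1) by blast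
  have "\<bar>s\<bar> \<le> \<bar>s'\<bar> + \<eta>" if "s' \<in> Z" for s'
    using s(2) cInf_lower[OF imageI[OF that, of abs] bdd] by simp
  then show ?thesis using s(1) by blast
qed

text \<open>Where \<open>D u = 0\<close> and \<open>D n = 1\<close>, the straight line in direction \<open>u\<close> can be moved into the level
  set of \<open>h\<close> by a correction \<open>s t\<close> along \<open>n\<close> of order \<open>o(t)\<close>.  The intermediate value theorem gives,
  for every \<open>e > 0\<close>, a correction of size at most \<open>e * \<bar>t\<bar>\<close> for small \<open>t\<close>; a single function \<open>s\<close> is
  obtained by choosing a correction that is smallest up to \<open>t\<^sup>2\<close>.  Continuity of \<open>s\<close> away from \<open>0\<close>
  is not needed.\<close>
lemma level_set_correction:
  fixes h :: "'a::real_normed_vector \<Rightarrow> real"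
  assumes U: "open U" "continuous_on U h" "x \<in> U"
    and D: "(h has_derivative D) (at x)" "D u = 0" "D n = 1"
  obtains s :: "real \<Rightarrow> real" where "s 0 = 0" "(s has_real_derivative 0) (at 0)"
    "\<forall>\<^sub>F t in nhds 0. x + t *\<^sub>R u + s t *\<^sub>R n \<in> U \<and> h (x + t *\<^sub>R u + s t *\<^sub>R n) = h x"
proof -
  interpret D: bounded_linear D using D(1) by (rule has_derivative_bounded_linear)
  obtain r where r: "r > 0" "ball x r \<subseteq> U" using U open_contains_ball by blast
  define Z where "Z t = {s. x + t *\<^sub>R u + s *\<^sub>R n \<in> U \<and> h (x + t *\<^sub>R u + s *\<^sub>R n) = h x}" for t
  have key: "\<exists>d>0. \<forall>t. \<bar>t\<bar> < d \<longrightarrow> (\<exists>s\<in>Z t. \<bar>s\<bar> \<le> e * \<bar>t\<bar>)" if e: "e > 0" for e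
  proof -
    define K where "K = norm u + e * norm n + 1"
    have K: "K > 0" using e by (simp add: K_def add_nonneg_pos)
    have "e / (2 * K) > 0" using e K by simp
    then obtain d where d: "d > 0" "\<And>y. norm (y - x) < d \<Longrightarrow> norm (h y - h x - D (y - x)) \<le> e / (2 * K) * norm (y - x)"
      using D(1) unfolding has_derivative_at_alt by blast
    define d' where "d' = min d r / K"
    have d': "d' > 0" using d r K by (simp add: d'_def)
    have "\<exists>s\<in>Z t. \<bar>s\<bar> \<le> e * \<bar>t\<bar>" if t: "\<bar>t\<bar> < d'" for t
    proof -
      let ?y = "\<lambda>s. x + t *\<^sub>R u + s *\<^sub>R n"
      have tK: "\<bar>t\<bar> * K < min d r" using t K by (simp add: d'_def pos_less_divide_eq)
      have ny: "norm (?y s - x) \<le> \<bar>t\<bar> * K" if s: "\<bar>s\<bar> \<le> e * \<bar>t\<bar>" for s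
      proof -
        have "norm (?y s - x) \<le> norm (t *\<^sub>R u) + norm (s *\<^sub>R n)"
          using norm_triangle_ineq[of "t *\<^sub>R u" "s *\<^sub>R n"] by (simp add: algebra_simps)
        also have "\<dots> \<le> \<bar>t\<bar> * norm u + (e * \<bar>t\<bar>) * norm n"
          using s by (auto intro!: mult_right_mono)
        also have "\<dots> \<le> \<bar>t\<bar> * K" by (simp add: K_def algebra_simps)
        finally show ?thesis .
      qed
      have inU: "?y s \<in> U" if "\<bar>s\<bar> \<le> e * \<bar>t\<bar>" for s
      proof -
        have "norm (?y s - x) < r" using ny[OF that] tK by simp
        then have "?y s \<in> ball x r" by (metis dist_commute dist_norm mem_ball)
        then show ?thesis using r by blast
      qed
      have est: "\<bar>h (?y s) - h x - s\<bar> \<le> e * \<bar>t\<bar> / 2" if s: "\<bar>s\<bar> \<le> e * \<bar>t\<bar>" for s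
      proof -
        have "D (?y s - x) = s" using D by (simp add: D.add D.scaleR add.assoc)
        then have "\<bar>h (?y s) - h x - s\<bar> \<le> e / (2 * K) * norm (?y s - x)"
          using d(2)[of "?y s"] ny[OF s] tK by simp
        also have "\<dots> \<le> e / (2 * K) * (\<bar>t\<bar> * K)" using ny[OF s] e K by (intro mult_left_mono) auto
        also have "\<dots> = e * \<bar>t\<bar> / 2" using K by simp
        finally show ?thesis .
      qed
      have e0: "0 \<le> e * \<bar>t\<bar>" using e by simp
      have "\<exists>s\<ge>- (e * \<bar>t\<bar>). s \<le> e * \<bar>t\<bar> \<and> h (?y s) = h x"
      proof (rule IVT')
        have "\<bar>h (?y (- (e * \<bar>t\<bar>))) - h x - - (e * \<bar>t\<bar>)\<bar> \<le> e * \<bar>t\<bar> / 2" by (rule est) (use e0 in simp)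
        then show "h (?y (- (e * \<bar>t\<bar>))) \<le> h x" using e0 by linarith
        have "\<bar>h (?y (e * \<bar>t\<bar>)) - h x - e * \<bar>t\<bar>\<bar> \<le> e * \<bar>t\<bar> / 2" by (rule est) (use e0 in simp)
        then show "h x \<le> h (?y (e * \<bar>t\<bar>))" using e0 by linarith
        show "continuous_on {- (e * \<bar>t\<bar>)..e * \<bar>t\<bar>} (\<lambda>s. h (?y s))"
          using inU by (intro continuous_on_compose2[OF U(2)] continuous_intros) (auto simp: abs_le_iff)
      qed (use e0 in simp)
      then obtain s where s: "- (e * \<bar>t\<bar>) \<le> s" "s \<le> e * \<bar>t\<bar>" "h (?y s) = h x" by blast
      then have "\<bar>s\<bar> \<le> e * \<bar>t\<bar>" by linarith
      then show ?thesis using s(3) inU unfolding Z_def by blast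
    qed
    then show ?thesis using d' by blast
  qed
  \<comment> \<open>at \<open>t = 0\<close> the tolerance \<open>t\<^sup>2\<close> vanishes and the value is prescribed\<close>
  define s where "s t = (if t = 0 then 0 else SOME s. s \<in> Z t \<and> (\<forall>s'\<in>Z t. \<bar>s\<bar> \<le> \<bar>s'\<bar> + t\<^sup>2))" for t
  have s: "s t \<in> Z t" "s' \<in> Z t \<Longrightarrow> \<bar>s t\<bar> \<le> \<bar>s'\<bar> + t\<^sup>2" if ne: "Z t \<noteq> {}" for t s'
  proof -
    have "s t \<in> Z t \<and> (\<forall>s'\<in>Z t. \<bar>s t\<bar> \<le> \<bar>s'\<bar> + t\<^sup>2)"
    proof (cases "t = 0")
      case True
      then show ?thesis using U(3) by (simp add: s_def Z_def)
    next
      case False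
      then have "\<exists>s. s \<in> Z t \<and> (\<forall>s'\<in>Z t. \<bar>s\<bar> \<le> \<bar>s'\<bar> + t\<^sup>2)" using near_infimum[OF ne, of "t\<^sup>2"] by auto
      from someI_ex[OF this] show ?thesis using False by (simp add: s_def)
    qed
    then show "s t \<in> Z t" "s' \<in> Z t \<Longrightarrow> \<bar>s t\<bar> \<le> \<bar>s'\<bar> + t\<^sup>2" by auto
  qed
  show ?thesis
  proof (rule that)
    show s0: "s 0 = 0" by (simp add: s_def)
    obtain d where d: "d > 0" "\<And>t. \<bar>t\<bar> < d \<Longrightarrow> \<exists>s\<in>Z t. \<bar>s\<bar> \<le> 1 * \<bar>t\<bar>" using key[of 1] by auto
    show "\<forall>\<^sub>F t in nhds 0. x + t *\<^sub>R u + s t *\<^sub>R n \<in> U \<and> h (x + t *\<^sub>R u + s t *\<^sub>R n) = h x"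
      unfolding eventually_nhds_metric
    proof (intro exI[of _ d] conjI allI impI d(1))
      fix t :: real assume "dist t 0 < d"
      then have "Z t \<noteq> {}" using d(2)[of t] by (auto simp: dist_real_def)
      from s(1)[OF this] show "x + t *\<^sub>R u + s t *\<^sub>R n \<in> U" "h (x + t *\<^sub>R u + s t *\<^sub>R n) = h x"
        unfolding Z_def by auto
    qed
    show "(s has_real_derivative 0) (at 0)"
      unfolding has_field_derivative_def has_derivative_at_alt
    proof (intro conjI allI impI)
      fix e :: real assume e: "e > 0"
      obtain d where d: "d > 0" "\<And>t. \<bar>t\<bar> < d \<Longrightarrow> \<exists>s\<in>Z t. \<bar>s\<bar> \<le> (e/2) * \<bar>t\<bar>" using key[of "e/2"] e by auto
      have "norm (s t - s 0 - 0 * (t - 0)) \<le> e * norm (t - 0)" if t: "norm (t - 0) < min d (e/2)" for t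
      proof -
        obtain s' where s': "s' \<in> Z t" "\<bar>s'\<bar> \<le> (e/2) * \<bar>t\<bar>" using d(2)[of t] t by auto
        then have "\<bar>s t\<bar> \<le> \<bar>s'\<bar> + t\<^sup>2" by (intro s(2)) auto
        moreover have "t\<^sup>2 \<le> (e/2) * \<bar>t\<bar>"
        proof -
          have "\<bar>t\<bar> * \<bar>t\<bar> \<le> (e/2) * \<bar>t\<bar>" using t by (intro mult_right_mono) auto
          then show ?thesis by (simp add: power2_eq_square)
        qed
        ultimately show ?thesis using s'(2) s0 by simp
      qed
      then show "\<exists>d>0. \<forall>y. norm (y - 0) < d \<longrightarrow> norm (s y - s 0 - 0 * (y - 0)) \<le> e * norm (y - 0)"
        using d(1) e by (intro exI[of _ "min d (e/2)"]) auto
    qed (rule bounded_linear_mult_right)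
  qed
qed

context ham_mfd
begin

text \<open>At a regular point the velocities of curves in the energy level are the kernel of \<open>dH\<close>.\<close>
lemma level_set_tangent:
  assumes Z: "Z \<in> tangent_space A p" "dfun A H p Z \<noteq> 0"
  shows "tangent_to A {q. H q = H p} p = {Y \<in> tangent_space A p. dfun A H p Y = 0}"
proof (intro equalityI subsetI CollectI)
  fix Y assume "Y \<in> tangent_to A {q. H q = H p} p"
  then obtain \<gamma> where \<gamma>: "range \<gamma> \<subseteq> {q. H q = H p}" "\<gamma> 0 = p" "has_velocity A \<gamma> 0 Y"
    unfolding tangent_to_def by blast
  have "H \<circ> \<gamma> = (\<lambda>_. H p)" using \<gamma>(1) by (auto simp: fun_eq_iff)
  then have "((\<lambda>_. H p) has_vector_derivative dfun A H p Y) (at 0)"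
    using dfun_velocity[OF smooth_H \<gamma>(3)] \<gamma>(2) by simp
  then have "dfun A H p Y = 0"
    using has_vector_derivative_const vector_derivative_unique_at by blast
  then show "Y \<in> tangent_space A p \<and> dfun A H p Y = 0"
    using \<gamma> unfolding has_velocity_def by simp
next
  fix Y assume "Y \<in> {Y \<in> tangent_space A p. dfun A H p Y = 0}"
  then have Y: "Y \<in> tangent_space A p" "dfun A H p Y = 0" by auto
  obtain c where c: "c \<in> A" "p \<in> fst c" using ex_chart by blast
  let ?U = "snd c ` fst c" and ?h = "H \<circ> chart_inv c" and ?x = "snd c p"
  let ?D = "frechet_derivative ?h (at ?x)"
  note D = dfun_in_chart[OF smooth_H Y(1) c] and DZ = dfun_in_chart(1)[OF smooth_H Z(1) c]
  let ?n = "(1 / dfun A H p Z) *\<^sub>R Z c"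
  have "?D ?n = 1"
    using bounded_linear.linear[OF has_derivative_bounded_linear[OF D(2)]] DZ Z(2) by (simp add: linear_cmul)
  moreover have "continuous_on ?U ?h"
    using smooth_on_C1(1) C1_continuous_on smooth_H c(1) unfolding smooth_fun_def by blast
  ultimately obtain s where s: "s 0 = 0" "(s has_real_derivative 0) (at 0)"
    "\<forall>\<^sub>F t in nhds 0. ?x + t *\<^sub>R Y c + s t *\<^sub>R ?n \<in> ?U \<and> ?h (?x + t *\<^sub>R Y c + s t *\<^sub>R ?n) = ?h ?x"
    using level_set_correction[OF open_range[OF c(1)] _ imageI[OF c(2)] D(2), of "Y c" ?n] D(1) Y(2) by auto
  define y where "y t = ?x + t *\<^sub>R Y c + s t *\<^sub>R ?n" for t
  have "(y has_vector_derivative (0 + 1 *\<^sub>R Y c + 0 *\<^sub>R ?n)) (at 0)"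
    unfolding y_def[abs_def]
    by (intro has_vector_derivative_add has_vector_derivative_const
        bounded_linear.has_vector_derivative[OF bounded_linear_scaleR_left] has_vector_derivative_id
        s(2)[unfolded has_real_derivative_iff_has_vector_derivative])
  then have y': "(y has_vector_derivative Y c) (at 0)" by simp
  have y0: "y 0 = ?x" by (simp add: y_def s)
  \<comment> \<open>the curve has to stay in the level for all times, so it takes the value \<open>p\<close> where the correction fails\<close>
  define \<gamma> where "\<gamma> t = (if y t \<in> ?U \<and> ?h (y t) = H p then chart_inv c (y t) else p)" for t
  have hx: "?h ?x = H p" using chart_inv_chart[OF c] by simp
  have ev: "\<forall>\<^sub>F t in nhds 0. y t \<in> ?U \<and> ?h (y t) = H p"
    using s(3) unfolding hx y_def .
  have \<gamma>0: "\<gamma> 0 = p" using y0 chart_inv_chart[OF c] by (simp add: \<gamma>_def)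
  have "has_velocity A \<gamma> 0 Y"
  proof (rule velocityI[OF _ _ c(1)])
    have "\<forall>\<^sub>F t in nhds 0. \<gamma> t = (chart_inv c \<circ> y) t" using ev by (rule eventually_mono) (simp add: \<gamma>_def)
    moreover have "isCont (chart_inv c \<circ> y) 0"
      by (rule continuous_at_compose[OF has_vector_derivative_continuous[OF y']]) (simp add: y0 isCont_chart_inv c)
    ultimately show "isCont \<gamma> 0" using isCont_cong by blast
    have "\<forall>\<^sub>F t in nhds 0. y t = (snd c \<circ> \<gamma>) t"
      using ev by (rule eventually_mono) (simp add: \<gamma>_def chart_chart_inv[OF c(1)])
    from frechet_derivative_eventually_cong(1)[OF this] y'
    show "((snd c \<circ> \<gamma>) has_vector_derivative Y c) (at 0)" unfolding has_vector_derivative_def by blast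
  qed (use \<gamma>0 Y c in auto)
  moreover have "range \<gamma> \<subseteq> {q. H q = H p}" by (auto simp: \<gamma>_def)
  ultimately show "Y \<in> tangent_to A {q. H q = H p} p"
    unfolding tangent_to_def using \<gamma>0 by blast
qed

end

section \<open>Traces on a quotient plane\<close>

lemma line_coset_eq_iff:
  "line_coset X Y = line_coset X Z \<longleftrightarrow> (\<exists>s. Z = tlin 1 Y s X)"
proof
  have "Z = tlin 1 Z 0 X" by (simp add: tlin_def)
  then have "Z \<in> line_coset X Z" unfolding line_coset_def by blast
  then show "line_coset X Y = line_coset X Z \<Longrightarrow> \<exists>s. Z = tlin 1 Y s X"
    unfolding line_coset_def by auto
  assume "\<exists>s. Z = tlin 1 Y s X"
  then obtain s where s: "Z = tlin 1 Y s X" by blast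
  have 1: "tlin 1 Z r X = tlin 1 Y (s + r) X" for r
    unfolding s by (simp add: tlin_def scaleR_add_left add.assoc)
  have 2: "tlin 1 Y r X = tlin 1 Z (r - s) X" for r
    unfolding s by (simp add: tlin_def scaleR_diff_left)
  show "line_coset X Y = line_coset X Z"
    unfolding line_coset_def using 1 2 by blast
qed

lemma det_square_of_involution:
  fixes a b c d :: real
  assumes "a * a + b * c = 1" "a * b + b * d = 0" "c * a + d * c = 0" "c * b + d * d = 1"
  shows "(a * d - b * c)\<^sup>2 = 1"
proof -
  have "(a * d - b * c)\<^sup>2 = (a * a + b * c) * (c * b + d * d) - (a * b + b * d) * (c * a + d * c)"
    by (simp add: power2_eq_square algebra_simps)
  then show ?thesis using assms by simp
qed

text \<open>The algebraic core: if \<open>N\<close> and \<open>R\<close> act on the plane \<open>V\<close> modulo \<open>X\<close> with \<open>R\<^sup>2 = 1\<close> and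
  \<open>(N R)\<^sup>2 = 1\<close>, then \<open>(det N)\<^sup>2 = 1\<close> and the trace of \<open>N\<^sup>2\<close> is at least \<open>-2\<close>.  The basis \<open>e\<close>, \<open>f\<close>
  provides coordinates \<open>\<alpha>\<close>, \<open>\<beta>\<close> on \<open>V\<close> modulo \<open>X\<close>.  Since \<open>quotient_trace\<close> is a definite description,
  the proof also shows that the trace does not depend on the basis.\<close>
lemma quotient_trace_square_ge:
  fixes V :: "('m, 'e::euclidean_space) tvec set"
  assumes V: "\<And>a Y b Z. Y \<in> V \<Longrightarrow> Z \<in> V \<Longrightarrow> tlin a Y b Z \<in> V" and X: "X \<in> V"
    and basis: "quotient_basis V X e f"
    and NV: "\<And>Y. Y \<in> V \<Longrightarrow> N Y \<in> V"
    and Nlin: "\<And>a Y b Z. Y \<in> V \<Longrightarrow> Z \<in> V \<Longrightarrow> N (tlin a Y b Z) = tlin a (N Y) b (N Z)"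
    and NX: "N X = tlin 1 X 0 X"
    and RV: "\<And>Y. Y \<in> V \<Longrightarrow> R Y \<in> V"
    and Rlin: "\<And>a Y b Z. Y \<in> V \<Longrightarrow> Z \<in> V \<Longrightarrow> R (tlin a Y b Z) = tlin a (R Y) b (R Z)"
    and RX: "R X = tlin (-1) X 0 X"
    and RR: "\<And>Y. Y \<in> V \<Longrightarrow> R (R Y) = Y"
    and NRNR: "\<And>Y. Y \<in> V \<Longrightarrow> N (R (N (R Y))) = Y"
    and T: "\<And>Y. Y \<in> V \<Longrightarrow> T (line_coset X Y) = line_coset X (N (N Y))"
  shows "quotient_trace V X T \<ge> -2"
proof -
  have ef: "e \<in> V" "f \<in> V" using basis unfolding quotient_basis_def by auto
  have "\<exists>!ab. line_coset X Y = line_coset X (tlin (fst ab) e (snd ab) f)" if "Y \<in> V" for Y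
    using basis that unfolding quotient_basis_def by blast
  then obtain ab where ab: "\<And>Y. Y \<in> V \<Longrightarrow> line_coset X Y = line_coset X (tlin (fst (ab Y)) e (snd (ab Y)) f)"
    and ab_unique: "\<And>Y z. Y \<in> V \<Longrightarrow> line_coset X Y = line_coset X (tlin (fst z) e (snd z) f) \<Longrightarrow> z = ab Y"
    by metis
  define \<alpha> where "\<alpha> Y = fst (ab Y)" for Y
  define \<beta> where "\<beta> Y = snd (ab Y)" for Y
  have rep: "line_coset X Y = line_coset X (tlin (\<alpha> Y) e (\<beta> Y) f)" if "Y \<in> V" for Y
    using ab[OF that] by (simp add: \<alpha>_def \<beta>_def)
  have uniq: "\<alpha> Y = a \<and> \<beta> Y = b" if "Y \<in> V" "line_coset X Y = line_coset X (tlin a e b f)" for Y a b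
  proof -
    have "(a, b) = ab Y" using ab_unique[OF that(1), of "(a, b)"] that(2) by simp
    then show ?thesis by (metis \<alpha>_def \<beta>_def fst_conv snd_conv)
  qed
  have coset: "\<alpha> Y = \<alpha> Z \<and> \<beta> Y = \<beta> Z" if "Y \<in> V" "Z \<in> V" "line_coset X Y = line_coset X Z" for Y Z
    using uniq[OF that(1)] rep[OF that(2)] that(3) by metis
  have ex: "\<exists>s. tlin (\<alpha> Y) e (\<beta> Y) f = tlin 1 Y s X" if "Y \<in> V" for Y
    using rep[OF that] line_coset_eq_iff by blast
  have lin: "\<alpha> (tlin a Y b Z) = a * \<alpha> Y + b * \<alpha> Z \<and> \<beta> (tlin a Y b Z) = a * \<beta> Y + b * \<beta> Z"
    if YZ: "Y \<in> V" "Z \<in> V" for a b Y Z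
  proof (rule uniq[OF V[OF YZ]])
    obtain s where s: "tlin (\<alpha> Y) e (\<beta> Y) f = tlin 1 Y s X" using ex[OF YZ(1)] by blast
    obtain r where r: "tlin (\<alpha> Z) e (\<beta> Z) f = tlin 1 Z r X" using ex[OF YZ(2)] by blast
    have "tlin (a * \<alpha> Y + b * \<alpha> Z) e (a * \<beta> Y + b * \<beta> Z) f = tlin a (tlin (\<alpha> Y) e (\<beta> Y) f) b (tlin (\<alpha> Z) e (\<beta> Z) f)"
      by (simp add: tlin_def fun_eq_iff algebra_simps)
    also have "\<dots> = tlin 1 (tlin a Y b Z) (a * s + b * r) X"
      unfolding s r by (simp add: tlin_def fun_eq_iff algebra_simps)
    finally show "line_coset X (tlin a Y b Z) = line_coset X (tlin (a * \<alpha> Y + b * \<alpha> Z) e (a * \<beta> Y + b * \<beta> Z) f)"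
      unfolding line_coset_eq_iff by blast
  qed
  have zero: "\<alpha> X = 0 \<and> \<beta> X = 0"
  proof (rule uniq[OF X])
    have "tlin 0 e 0 f = tlin 1 X (-1) X" by (simp add: tlin_def)
    then show "line_coset X X = line_coset X (tlin 0 e 0 f)" unfolding line_coset_eq_iff by blast
  qed
  have id: "tlin 1 e 0 f = e" "tlin 0 e 1 f = f" by (simp_all add: tlin_def)
  have e1: "\<alpha> e = 1 \<and> \<beta> e = 0" by (rule uniq[OF ef(1)]) (simp add: id)
  have f1: "\<alpha> f = 0 \<and> \<beta> f = 1" by (rule uniq[OF ef(2)]) (simp add: id)
  have mat: "\<alpha> (L Y) = \<alpha> Y * \<alpha> (L e) + \<beta> Y * \<alpha> (L f) \<and> \<beta> (L Y) = \<alpha> Y * \<beta> (L e) + \<beta> Y * \<beta> (L f)"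
    if LV: "\<And>Y. Y \<in> V \<Longrightarrow> L Y \<in> V"
      and Llin: "\<And>a Y b Z. Y \<in> V \<Longrightarrow> Z \<in> V \<Longrightarrow> L (tlin a Y b Z) = tlin a (L Y) b (L Z)"
      and LX: "L X = tlin k X 0 X" and Y: "Y \<in> V" for L Y k
  proof -
    obtain s where s: "tlin (\<alpha> Y) e (\<beta> Y) f = tlin 1 Y s X" using ex[OF Y] by blast
    have "tlin (\<alpha> Y) (L e) (\<beta> Y) (L f) = tlin 1 (L Y) s (tlin k X 0 X)"
      using arg_cong[OF s, of L] Llin[OF ef] Llin[OF Y X] LX by simp
    then show ?thesis
      using lin[OF LV[OF ef(1)] LV[OF ef(2)], of "\<alpha> Y" "\<beta> Y"] lin[OF LV[OF Y] V[OF X X], of 1 s k 0] lin[OF X X, of k 0] zero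
      by simp
  qed
  have matN: "\<alpha> (N Y) = \<alpha> Y * \<alpha> (N e) + \<beta> Y * \<alpha> (N f) \<and> \<beta> (N Y) = \<alpha> Y * \<beta> (N e) + \<beta> Y * \<beta> (N f)"
    if "Y \<in> V" for Y by (rule mat[where L=N and k=1]) (simp_all add: NV Nlin NX that)
  have matR: "\<alpha> (R Y) = \<alpha> Y * \<alpha> (R e) + \<beta> Y * \<alpha> (R f) \<and> \<beta> (R Y) = \<alpha> Y * \<beta> (R e) + \<beta> Y * \<beta> (R f)"
    if "Y \<in> V" for Y by (rule mat[where L=R and k="-1"]) (simp_all add: RV Rlin RX that)
  define n11 n12 n21 n22 where n: "n11 = \<alpha> (N e)" "n12 = \<alpha> (N f)" "n21 = \<beta> (N e)" "n22 = \<beta> (N f)"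
  define r11 r12 r21 r22 where r: "r11 = \<alpha> (R e)" "r12 = \<alpha> (R f)" "r21 = \<beta> (R e)" "r22 = \<beta> (R f)"
  have detR: "(r11 * r22 - r12 * r21)\<^sup>2 = 1"
    using matR[OF RV[OF ef(1)]] matR[OF RV[OF ef(2)]] RR ef e1 f1
    by (intro det_square_of_involution) (auto simp: r mult.commute)
  \<comment> \<open>the matrix of \<open>N R\<close>\<close>
  define p11 p12 p21 p22 where p: "p11 = r11 * n11 + r21 * n12" "p12 = r12 * n11 + r22 * n12"
     "p21 = r11 * n21 + r21 * n22" "p22 = r12 * n21 + r22 * n22"
  have NRe: "\<alpha> (N (R e)) = p11 \<and> \<beta> (N (R e)) = p21" and NRf: "\<alpha> (N (R f)) = p12 \<and> \<beta> (N (R f)) = p22"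
    using matN[OF RV[OF ef(1)]] matN[OF RV[OF ef(2)]] by (auto simp: p n r)
  have NR: "\<alpha> (N (R Y)) = \<alpha> Y * p11 + \<beta> Y * p12 \<and> \<beta> (N (R Y)) = \<alpha> Y * p21 + \<beta> Y * p22" if "Y \<in> V" for Y
    using matN[OF RV[OF that]] matR[OF that] by (simp add: p n r algebra_simps)
  have detP: "(p11 * p22 - p12 * p21)\<^sup>2 = 1"
    using NR[OF NV[OF RV[OF ef(1)]]] NR[OF NV[OF RV[OF ef(2)]]] NRNR[OF ef(1)] NRNR[OF ef(2)] e1 f1 NRe NRf
    by (intro det_square_of_involution) (auto simp: mult.commute)
  have "p11 * p22 - p12 * p21 = (n11 * n22 - n12 * n21) * (r11 * r22 - r12 * r21)"
    unfolding p by (simp add: algebra_simps)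
  then have detN: "(n11 * n22 - n12 * n21)\<^sup>2 = 1" using detP detR by (simp add: power_mult_distrib)
  have M: "\<alpha> (N (N Y)) = \<alpha> Y * \<alpha> (N (N e)) + \<beta> Y * \<alpha> (N (N f)) \<and> \<beta> (N (N Y)) = \<alpha> Y * \<beta> (N (N e)) + \<beta> Y * \<beta> (N (N f))"
    if "Y \<in> V" for Y
  proof -
    have "N (N X) = tlin 1 X 0 X" using NX by (simp add: tlin_def)
    then show ?thesis by (intro mat[where L="\<lambda>Y. N (N Y)" and k=1]) (simp_all add: NV Nlin that)
  qed
  have "quotient_trace V X T = \<alpha> (N (N e)) + \<beta> (N (N f))"
    unfolding quotient_trace_def
  proof (rule the_equality)
    show "\<exists>e' f' a b c d. quotient_basis V X e' f' \<and> T (line_coset X e') = line_coset X (tlin a e' b f') \<and>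
       T (line_coset X f') = line_coset X (tlin c e' d f') \<and> \<alpha> (N (N e)) + \<beta> (N (N f)) = a + d"
      using basis T ef rep[OF NV[OF NV]] by blast
    fix x assume "\<exists>e' f' a b c d. quotient_basis V X e' f' \<and> T (line_coset X e') = line_coset X (tlin a e' b f') \<and>
       T (line_coset X f') = line_coset X (tlin c e' d f') \<and> x = a + d"
    then obtain e' f' a b c d where b': "quotient_basis V X e' f'" and T': "T (line_coset X e') = line_coset X (tlin a e' b f')"
       "T (line_coset X f') = line_coset X (tlin c e' d f')" and x: "x = a + d" by blast
    have ef': "e' \<in> V" "f' \<in> V" using b' unfolding quotient_basis_def by auto
    define A B C D where M': "A = \<alpha> (N (N e))" "B = \<beta> (N (N e))" "C = \<alpha> (N (N f))" "D = \<beta> (N (N f))"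
    define p q r s where pq: "p = \<alpha> e'" "q = \<beta> e'" "r = \<alpha> f'" "s = \<beta> f'"
    have "line_coset X (N (N e')) = line_coset X (tlin a e' b f')" "line_coset X (N (N f')) = line_coset X (tlin c e' d f')"
      using T' T ef' by auto
    from coset[OF NV[OF NV[OF ef'(1)]] V[OF ef'] this(1)] coset[OF NV[OF NV[OF ef'(2)]] V[OF ef'] this(2)]
    have eqs: "p * A + q * C = a * p + b * r" "p * B + q * D = a * q + b * s"
      "r * A + s * C = c * p + d * r" "r * B + s * D = c * q + d * s"
      using M[OF ef'(1)] M[OF ef'(2)] lin[OF ef'] by (auto simp: M' pq)
    have "\<exists>!z. line_coset X Y = line_coset X (tlin (fst z) e' (snd z) f')" if "Y \<in> V" for Y
      using b' that unfolding quotient_basis_def by blast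
    from this[OF ef(1)] this[OF ef(2)] obtain z1 z2 where
      z: "line_coset X e = line_coset X (tlin (fst z1) e' (snd z1) f')" "line_coset X f = line_coset X (tlin (fst z2) e' (snd z2) f')"
      by blast
    define u1 w1 u2 w2 where uw: "u1 = fst z1" "w1 = snd z1" "u2 = fst z2" "w2 = snd z2"
    from coset[OF ef(1) V[OF ef'] z(1)] coset[OF ef(2) V[OF ef'] z(2)]
    have inv: "1 = u1 * p + w1 * r" "0 = u1 * q + w1 * s" "0 = u2 * p + w2 * r" "1 = u2 * q + w2 * s"
      using e1 f1 lin[OF ef'] by (auto simp: pq uw)
    \<comment> \<open>the change of basis has an inverse, so its determinant does not vanish\<close>
    have "(u1 * w2 - u2 * w1) * (p * s - q * r) = (u1 * p + w1 * r) * (u2 * q + w2 * s) - (u1 * q + w1 * s) * (u2 * p + w2 * r)"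
      by (simp add: algebra_simps)
    also have "\<dots> = 1" using inv by simp
    finally have ne: "p * s - q * r \<noteq> 0" by auto
    have "a * (p * s - q * r) = s * (p * A + q * C) - r * (p * B + q * D)"
      unfolding eqs by (simp add: algebra_simps)
    moreover have "d * (p * s - q * r) = p * (r * B + s * D) - q * (r * A + s * C)"
      unfolding eqs by (simp add: algebra_simps)
    ultimately have "(a + d) * (p * s - q * r) = (A + D) * (p * s - q * r)"
      by (simp add: algebra_simps)
    then show "x = \<alpha> (N (N e)) + \<beta> (N (N f))" using ne x M' by simp
  qed
  also have "\<dots> = n11 * n11 + n21 * n12 + (n12 * n21 + n22 * n22)"
    using matN[OF NV[OF ef(1)]] matN[OF NV[OF ef(2)]] by (simp add: n)
  also have "\<dots> = (n11 + n22)\<^sup>2 - 2 * (n11 * n22 - n12 * n21)"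
    by (simp add: power2_eq_square algebra_simps)
  also have "\<dots> \<ge> -2"
  proof -
    have "n11 * n22 - n12 * n21 \<le> 1" using detN by (simp add: power2_eq_1_iff) auto
    moreover have "-2 \<le> x - 2 * y" if "0 \<le> x" "y \<le> 1" for x y :: real using that by linarith
    ultimately show ?thesis using zero_le_power2 by blast
  qed
  finally show ?thesis .
qed

text \<open>A basis of the plane orthogonal to \<open>g\<close> modulo \<open>x\<close>: an ordinary basis of the plane orthogonal
  to both.\<close>
lemma quotient_plane_basis:
  fixes g x :: "real^4"
  assumes "g \<noteq> 0" "x \<noteq> 0" "g \<bullet> x = 0"
  obtains e f where "g \<bullet> e = 0" "g \<bullet> f = 0"
    "\<And>y. g \<bullet> y = 0 \<Longrightarrow> \<exists>!ab. \<exists>s. fst ab *\<^sub>R e + snd ab *\<^sub>R f = y + s *\<^sub>R x"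
proof -
  define S where "S = {y. g \<bullet> y = 0 \<and> x \<bullet> y = 0}"
  have gx: "g \<noteq> x" using assms by auto
  have "independent {g, x}"
    using assms gx by (intro pairwise_orthogonal_independent) (auto simp: pairwise_def orthogonal_def inner_commute)
  then have d2: "dim (span {g, x}) = 2" using gx by (simp add: dim_eq_card_independent)
  have S: "S = {y \<in> UNIV. \<forall>z\<in>span {g, x}. orthogonal z y}"
  proof -
    have "(\<forall>z\<in>span {g, x}. orthogonal z y) \<longleftrightarrow> g \<bullet> y = 0 \<and> x \<bullet> y = 0" for y
    proof
      assume "\<forall>z\<in>span {g, x}. orthogonal z y"
      then show "g \<bullet> y = 0 \<and> x \<bullet> y = 0" by (simp add: orthogonal_def span_base)
    next
      assume y: "g \<bullet> y = 0 \<and> x \<bullet> y = 0"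
      show "\<forall>z\<in>span {g, x}. orthogonal z y"
      proof
        fix z assume "z \<in> span {g, x}"
        from orthogonal_to_span[OF this, of y] y show "orthogonal z y" by (auto simp: orthogonal_def inner_commute)
      qed
    qed
    then show ?thesis by (auto simp: S_def)
  qed
  have "dim S + dim (span {g, x}) = dim (UNIV :: (real^4) set)"
    unfolding S by (rule dim_subspace_orthogonal_to_vectors) auto
  then have dS: "dim S = 2" using d2 by (simp add: dim_UNIV)
  have subS: "subspace S" unfolding S_def subspace_def by (auto simp: inner_right_distrib)
  obtain B where B: "B \<subseteq> S" "independent B" "S \<subseteq> span B" "card B = 2"
    using basis_exists[of S] dS by metis
  obtain e f where ef: "B = {e, f}" "e \<noteq> f" using B(4) by (auto simp: card_2_iff)
  have efS: "g \<bullet> e = 0" "g \<bullet> f = 0" "x \<bullet> e = 0" "x \<bullet> f = 0" using B(1) ef by (auto simp: S_def)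
  show ?thesis
  proof (rule that[OF efS(1,2)])
    fix y assume y: "g \<bullet> y = 0"
    define s where "s = - (x \<bullet> y) / (x \<bullet> x)"
    have "x \<bullet> (y + s *\<^sub>R x) = 0" using assms(2) by (simp add: s_def inner_right_distrib inner_diff_right)
    then have "y + s *\<^sub>R x \<in> span {e, f}" using y assms B(3) ef by (auto simp: S_def inner_right_distrib)
    then obtain a b where ab: "y + s *\<^sub>R x = a *\<^sub>R e + b *\<^sub>R f"
      unfolding span_insert span_empty by (auto simp: algebra_simps)
    show "\<exists>!ab. \<exists>s. fst ab *\<^sub>R e + snd ab *\<^sub>R f = y + s *\<^sub>R x"
    proof (rule ex1I[of _ "(a, b)"])
      show "\<exists>s. fst (a, b) *\<^sub>R e + snd (a, b) *\<^sub>R f = y + s *\<^sub>R x" using ab by (metis fst_conv snd_conv)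
      fix z assume "\<exists>s. fst z *\<^sub>R e + snd z *\<^sub>R f = y + s *\<^sub>R x"
      then obtain r where r: "fst z *\<^sub>R e + snd z *\<^sub>R f = y + r *\<^sub>R x" by blast
      have "x \<bullet> (fst z *\<^sub>R e + snd z *\<^sub>R f) = 0" "x \<bullet> (a *\<^sub>R e + b *\<^sub>R f) = 0" using efS by (simp_all add: inner_right_distrib)
      then have "x \<bullet> y + r * (x \<bullet> x) = 0" "x \<bullet> y + s * (x \<bullet> x) = 0"
        unfolding r ab[symmetric] by (simp_all add: inner_right_distrib)
      then have "r * (x \<bullet> x) = s * (x \<bullet> x)" by linarith
      then have "r = s" using assms(2) by simp
      then have 0: "(fst z - a) *\<^sub>R e + (snd z - b) *\<^sub>R f = 0" using r ab by (simp add: algebra_simps)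
      let ?u = "\<lambda>w. if w = e then fst z - a else snd z - b"
      have "(\<Sum>w\<in>{e, f}. ?u w *\<^sub>R w) = 0" using 0 ef(2) by simp
      then have u0: "?u v = 0" if "v \<in> {e, f}" for v
        by (intro independentD[OF B(2), of "{e, f}" ?u]) (use ef(1) that in simp_all)
      have "fst z = a" "snd z = b" using u0[of e] u0[of f] ef(2) by (simp_all split: if_splits)
      then show "z = (a, b)" by (simp add: prod_eq_iff)
    qed
  qed
qed

section \<open>Covers of doubly symmetric orbits\<close>

text \<open>The hypotheses on the doubly symmetric orbit.\<close>
locale doubly_symmetric = ham_mfd A \<omega> H
  for A :: "('m::{t2_space, second_countable_topology}, real ^ 4) chart set"
    and \<omega> :: "('m, real ^ 4) form2" and H :: "'m \<Rightarrow> real" +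
  fixes \<rho>\<^sub>1 \<rho>\<^sub>2 :: "'m \<Rightarrow> 'm" and v :: "real \<Rightarrow> 'm" and \<tau> :: real
  assumes inv1: "antisymplectic_involution A \<omega> \<rho>\<^sub>1" "H \<circ> \<rho>\<^sub>1 = H"
    and inv2: "antisymplectic_involution A \<omega> \<rho>\<^sub>2" "H \<circ> \<rho>\<^sub>2 = H"
    and commuting: "\<rho>\<^sub>1 \<circ> \<rho>\<^sub>2 = \<rho>\<^sub>2 \<circ> \<rho>\<^sub>1"
    and doubly: "doubly_symmetric_orbit A \<omega> H \<rho>\<^sub>1 \<rho>\<^sub>2 v \<tau>"
begin

lemma orbit: "periodic_orbit A \<omega> H v \<tau>"
  and period_pos: "\<tau> > 0"
  and orbit_inj: "v s = v t \<Longrightarrow> s - t \<in> \<int>"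
  and reversed: "\<rho>\<^sub>1 (v (- t)) = v t"
  and half_period: "\<rho>\<^sub>2 (v 0) = v (1 / 2)"
  using doubly unfolding doubly_symmetric_orbit_def symmetric_orbit_def simple_periodic_orbit_def periodic_orbit_def
  by blast+

lemma flow_half_turn: "flows_to t p q \<Longrightarrow> flows_to t (\<rho>\<^sub>1 (\<rho>\<^sub>2 p)) (\<rho>\<^sub>1 (\<rho>\<^sub>2 q))"
  using flows_to_reversed[OF inv1 flows_to_reversed[OF inv2]] by fastforce

lemma half_turn_orbit: "\<rho>\<^sub>1 (\<rho>\<^sub>2 (v t)) = v (t + 1 / 2)"
proof -
  have "\<rho>\<^sub>1 (\<rho>\<^sub>2 (v 0)) = v (- (1 / 2))" using reversed[of "- (1 / 2)"] half_period by simp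
  also have "\<dots> = v (1 / 2)" using periodic_orbit_int[OF orbit, of "- (1 / 2)" 1] by simp
  finally have 0: "\<rho>\<^sub>1 (\<rho>\<^sub>2 (v 0)) = v (1 / 2)" .
  have "flows_to (t * \<tau>) (v s) (v (s + t))" for s
    using flows_along_orbit[OF orbit, of "t * \<tau>" s] period_pos by simp
  from ham_flow_eq[OF flow_half_turn[OF this[of 0]]] ham_flow_eq[OF this[of "1 / 2"]]
  show ?thesis unfolding 0 by (simp add: add.commute)
qed

text \<open>The involution acting on the orbit as the shift by \<open>j / 2\<close> is the identity for even \<open>j\<close> and
  \<open>\<rho>\<^sub>1 \<circ> \<rho>\<^sub>2\<close> for odd \<open>j\<close>.\<close>
lemma commuting_half_turn:
  fixes j :: nat
  obtains S where "\<And>q. mdiff S q" "\<And>q. S (S q) = q" "\<And>q. S (\<rho>\<^sub>1 q) = \<rho>\<^sub>1 (S q)" "\<And>q. H (S q) = H q"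
    "\<And>t p q. flows_to t p q \<Longrightarrow> flows_to t (S p) (S q)" "\<And>t. S (v t) = v (t + real j / 2)"
proof (cases "even j")
  case True
  then obtain i where i: "j = 2 * i" by blast
  have "v t = v (t + real j / 2)" for t using periodic_orbit_int[OF orbit, of t "int i"] i by simp
  then show ?thesis using that[of "\<lambda>q. q"] mdiff_id(1) by (simp add: id_def)
next
  case False
  then obtain i where i: "j = 2 * i + 1" using oddE by blast
  have com: "\<rho>\<^sub>1 (\<rho>\<^sub>2 q) = \<rho>\<^sub>2 (\<rho>\<^sub>1 q)" for q using commuting by (metis comp_apply)
  note ii = antisymplectic_involutive[OF inv1(1)] antisymplectic_involutive[OF inv2(1)]
  have "v (t + 1 / 2) = v (t + real j / 2)" for t
    using periodic_orbit_int[OF orbit, of "t + 1 / 2" "int i"] i by (simp add: add_divide_distrib algebra_simps)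
  then have sv: "(\<rho>\<^sub>1 \<circ> \<rho>\<^sub>2) (v t) = v (t + real j / 2)" for t using half_turn_orbit by simp
  show ?thesis
  proof (rule that[of "\<rho>\<^sub>1 \<circ> \<rho>\<^sub>2"])
    show "mdiff (\<rho>\<^sub>1 \<circ> \<rho>\<^sub>2) q" for q
      by (intro mdiff_comp(1) antisymplectic_mdiff inv1 inv2)
    show "(\<rho>\<^sub>1 \<circ> \<rho>\<^sub>2) ((\<rho>\<^sub>1 \<circ> \<rho>\<^sub>2) q) = q" for q using com ii by (metis comp_apply)
    show "(\<rho>\<^sub>1 \<circ> \<rho>\<^sub>2) (\<rho>\<^sub>1 q) = \<rho>\<^sub>1 ((\<rho>\<^sub>1 \<circ> \<rho>\<^sub>2) q)" for q using com by (metis comp_apply)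
    show "H ((\<rho>\<^sub>1 \<circ> \<rho>\<^sub>2) q) = H q" for q using inv1(2) inv2(2) by (metis comp_apply)
  qed (use flow_half_turn sv in auto)
qed

text \<open>Otherwise the orbit would be constant, by uniqueness of integral curves.\<close>
lemma ham_vf_nonzero: "ham_vf A \<omega> H (v 0) \<noteq> (\<lambda>_. 0)"
proof
  assume 0: "ham_vf A \<omega> H (v 0) = (\<lambda>_. 0)"
  have "has_velocity A (\<lambda>_. v 0) s (ham_vf A \<omega> H (v 0))" for s :: real
    by (rule velocityI[OF _ ham_vf_in_tangent_space chart_at]) (simp_all add: 0 o_def)
  then have "integral_curve (\<lambda>_. v 0) UNIV" unfolding integral_curve_def by simp
  then have "flows_to (\<tau> / 2) (v 0) (v 0)" unfolding flows_to_def by blast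
  moreover have "flows_to (\<tau> / 2) (v 0) (v (1 / 2))"
    using flows_along_orbit[OF orbit, of "\<tau> / 2" 0] period_pos by simp
  ultimately have "v (1 / 2) = v 0" using ham_flow_eq by metis
  then have "(1 / 2 :: real) \<in> \<int>" using orbit_inj[of "1 / 2" 0] by simp
  then obtain i :: int where "1 / 2 = (of_int i :: real)" by (rule Ints_cases)
  then have "of_int (2 * i) = (of_int 1 :: real)" by simp
  then have "2 * i = 1" by (simp only: of_int_eq_iff)
  then show False by presburger
qed

lemma monodromy_trace_cover_ge:
  assumes "j \<ge> 1"
  shows "monodromy_trace A \<omega> H (orbit_cover j v) (real j * \<tau>) \<ge> -2"
proof -
  let ?P = "v 0" and ?X = "ham_vf A \<omega> H (v 0)"
  define V where "V = {Y \<in> tangent_space A ?P. dfun A H ?P Y = 0}"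
  note Xts = ham_vf_in_tangent_space[of ?P]
  obtain Z where Z: "Z \<in> tangent_space A ?P" "dfun A H ?P Z \<noteq> 0"
  proof -
    obtain Y where "Y \<in> tangent_space A ?P" "\<omega> ?P ?X Y \<noteq> 0"
      using form_nondegenerate[OF Xts] ham_vf_nonzero by blast
    then show ?thesis using that[of Y] dfun_eq_form[of Y ?P] form_skew[OF Xts, of Y] by simp
  qed
  have level: "tangent_to A {q. H q = H ?P} ?P = V"
    unfolding V_def by (rule level_set_tangent[OF Z])
  have Vts: "Y \<in> tangent_space A ?P" if "Y \<in> V" for Y using that unfolding V_def by blast
  have Vlin: "tlin a Y b Z \<in> V" if "Y \<in> V" "Z \<in> V" for a Y b Z
    using that tlin_in_tangent_space dfun_tlin[OF smooth_H] unfolding V_def by simp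
  have XV: "?X \<in> V"
    using Xts dfun_eq_form[OF Xts] form_skew[OF Xts Xts] unfolding V_def by simp
  obtain e f where basis: "quotient_basis V ?X e f"
  proof -
    obtain c where c: "c \<in> A" "?P \<in> fst c" using ex_chart by blast
    note ct = coord_tvec[OF c]
    let ?g = "gradient c (snd c ?P)"
    have dH: "dfun A H ?P Y = ?g \<bullet> Y c" if "Y \<in> tangent_space A ?P" for Y
      using dfun_coord[OF c that] by (simp add: inner_commute)
    have g: "?g \<noteq> 0" using dH[OF Z(1)] Z(2) by auto
    have x: "?X c \<noteq> 0"
    proof
      assume "?X c = 0"
      then have "?X = tlin 0 ?X 0 ?X"
        by (intro tangent_space_eqI[OF Xts tlin_in_tangent_space[OF Xts Xts] c]) (simp add: tlin_def)
      then show False using ham_vf_nonzero by (simp add: tlin_def)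
    qed
    have gx: "?g \<bullet> ?X c = 0" using dH[OF Xts] XV unfolding V_def by simp
    obtain e f where ef: "?g \<bullet> e = 0" "?g \<bullet> f = 0"
      and ex1: "\<And>y. ?g \<bullet> y = 0 \<Longrightarrow> \<exists>!ab. \<exists>s. fst ab *\<^sub>R e + snd ab *\<^sub>R f = y + s *\<^sub>R ?X c"
      by (rule quotient_plane_basis[OF g x gx]) blast
    let ?e = "coord_tvec A c ?P e" and ?f = "coord_tvec A c ?P f"
    have inV: "?e \<in> V" "?f \<in> V" using ef dH ct(1,2) unfolding V_def by simp_all
    have iff: "line_coset ?X Y = line_coset ?X (tlin a ?e b ?f) \<longleftrightarrow> (\<exists>s. a *\<^sub>R e + b *\<^sub>R f = Y c + s *\<^sub>R ?X c)"
      if Y: "Y \<in> V" for Y a b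
    proof -
      have "tlin a ?e b ?f = tlin 1 Y s ?X \<longleftrightarrow> a *\<^sub>R e + b *\<^sub>R f = Y c + s *\<^sub>R ?X c" for s
      proof
        assume "tlin a ?e b ?f = tlin 1 Y s ?X"
        from fun_cong[OF this, of c] show "a *\<^sub>R e + b *\<^sub>R f = Y c + s *\<^sub>R ?X c" by (simp add: tlin_def ct(2))
      next
        assume "a *\<^sub>R e + b *\<^sub>R f = Y c + s *\<^sub>R ?X c"
        then show "tlin a ?e b ?f = tlin 1 Y s ?X"
          by (intro tangent_space_eqI[OF _ _ c] tlin_in_tangent_space ct(1) Vts[OF Y] Xts) (simp add: tlin_def ct(2))
      qed
      then show ?thesis unfolding line_coset_eq_iff by simp
    qed
    have "quotient_basis V ?X ?e ?f"
      unfolding quotient_basis_def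
    proof (intro conjI ballI inV)
      fix Q assume "Q \<in> line_coset ?X ` V"
      then obtain Y where Y: "Y \<in> V" "Q = line_coset ?X Y" by blast
      have "?g \<bullet> Y c = 0" using dH[OF Vts[OF Y(1)]] Y(1) unfolding V_def by simp
      from ex1[OF this] show "\<exists>!ab. Q = line_coset ?X (tlin (fst ab) ?e (snd ab) ?f)"
        unfolding Y(2) iff[OF Y(1)] .
    qed
    then show ?thesis by (rule that)
  qed
  obtain S where S: "\<And>q. mdiff S q" "\<And>q. S (S q) = q" "\<And>q. S (\<rho>\<^sub>1 q) = \<rho>\<^sub>1 (S q)" "\<And>q. H (S q) = H q"
    "\<And>t p q. flows_to t p q \<Longrightarrow> flows_to t (S p) (S q)" "\<And>t. S (v t) = v (t + real j / 2)"
    using commuting_half_turn[of j] by blast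
  define T where "T = real j * \<tau> / 2"
  define \<phi> where "\<phi> = ham_flow A \<omega> H T"
  define \<Psi> where "\<Psi> = S \<circ> \<phi>"
  have fl: "\<forall>\<^sub>F q in nhds ?P. flows_to T q (\<phi> q)" and \<phi>d: "mdiff \<phi> ?P"
    using flow_differentiable_along_orbit[OF orbit, of T 0] unfolding flow_differentiable_def \<phi>_def by auto
  have \<phi>v: "\<phi> (v s) = v (s + real j / 2)" for s
    using ham_flow_eq[OF flows_along_orbit[OF orbit, of T s]] period_pos by (simp add: \<phi>_def T_def)
  have \<Psi>v: "\<Psi> (v s) = v s" for s
    using periodic_orbit_int[OF orbit, of s "int j"] by (simp add: \<Psi>_def \<phi>v S(6) add.commute[of "real j"])
  have \<Psi>d: "mdiff \<Psi> ?P" unfolding \<Psi>_def by (rule mdiff_comp(1)[OF \<phi>d S(1)])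
  have \<rho>P: "\<rho>\<^sub>1 ?P = ?P" using reversed[of 0] by simp
  note \<rho>d = antisymplectic_mdiff[OF inv1(1)] and \<rho>\<rho> = antisymplectic_involutive[OF inv1(1)]
  have H\<Psi>: "\<forall>\<^sub>F q in nhds ?P. H (\<Psi> q) = H q"
    using fl by (rule eventually_mono) (simp add: \<Psi>_def S(4) energy_conservation)
  have fl\<Psi>: "\<forall>\<^sub>F q in nhds ?P. flows_to T (\<Psi> q) (\<phi> (\<Psi> q))"
    by (rule eventually_pullback[where P="\<lambda>q. flows_to T q (\<phi> q)"]) (use \<Psi>d \<Psi>v[of 0] fl in \<open>simp_all add: mdiff_def\<close>)
  have fl\<rho>: "\<forall>\<^sub>F q in nhds ?P. flows_to T (\<rho>\<^sub>1 q) (\<phi> (\<rho>\<^sub>1 q))"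
    by (rule eventually_pullback[where P="\<lambda>q. flows_to T q (\<phi> q)"]) (use \<rho>d[of ?P] \<rho>P fl in \<open>simp_all add: mdiff_def\<close>)
  have square: "\<forall>\<^sub>F q in nhds ?P. ham_flow A \<omega> H (real j * \<tau>) q = (\<Psi> \<circ> \<Psi>) q"
    using fl fl\<Psi>
  proof eventually_elim
    case (elim q)
    have "flows_to T (\<phi> q) (\<Psi> (\<Psi> q))" using S(5)[OF elim(2)] by (simp add: \<Psi>_def S(2))
    moreover have "T + T = real j * \<tau>" by (simp add: T_def)
    ultimately have "flows_to (real j * \<tau>) q ((\<Psi> \<circ> \<Psi>) q)" using flows_to_trans[OF elim(1)] by (metis comp_apply)
    then show ?case by (rule ham_flow_eq)
  qed
  \<comment> \<open>\<open>\<rho>\<^sub>1\<close> conjugates \<open>\<Psi>\<close> to its inverse\<close>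
  have inverse: "\<forall>\<^sub>F q in nhds ?P. (\<Psi> \<circ> (\<rho>\<^sub>1 \<circ> (\<Psi> \<circ> \<rho>\<^sub>1))) q = id q"
    using fl\<rho>
  proof eventually_elim
    case (elim q)
    have "flows_to (- T) (S q) (\<rho>\<^sub>1 (\<Psi> (\<rho>\<^sub>1 q)))"
      using S(5)[OF flows_to_reversed[OF inv1 elim]] by (simp add: \<rho>\<rho> \<Psi>_def S(3))
    from flows_to_sym[OF this] have "\<phi> (\<rho>\<^sub>1 (\<Psi> (\<rho>\<^sub>1 q))) = S q" by (simp add: \<phi>_def ham_flow_eq)
    then show ?case by (simp add: \<Psi>_def S(2))
  qed
  define N where "N = dmap A \<Psi> ?P"
  define R where "R = dmap A \<rho>\<^sub>1 ?P"
  have Nts: "N Y \<in> tangent_space A ?P" if "Y \<in> tangent_space A ?P" for Y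
    using dmap_in_tangent_space[OF \<Psi>d that] \<Psi>v[of 0] by (simp add: N_def)
  have Rts: "R Y \<in> tangent_space A ?P" if "Y \<in> tangent_space A ?P" for Y
    using dmap_in_tangent_space[OF \<rho>d that] \<rho>P by (simp add: R_def)
  have vel: "has_velocity A v 0 (tlin \<tau> ?X 0 ?X)"
    using orbit unfolding periodic_orbit_def tlin_def by simp
  \<comment> \<open>\<open>\<Psi>\<close> fixes the orbit pointwise, so \<open>N\<close> fixes its velocity \<open>\<tau> * X\<close>\<close>
  have NX: "N ?X = ?X"
  proof -
    have "\<Psi> \<circ> v = v" using \<Psi>v by auto
    then have "has_velocity A v 0 (dmap A \<Psi> ?P (tlin \<tau> ?X 0 ?X))" using velocity_map[OF vel \<Psi>d] by simp
    from velocity_unique[OF this vel] have "tlin \<tau> (N ?X) 0 (N ?X) = tlin \<tau> ?X 0 ?X"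
      unfolding dmap_tlin[OF \<Psi>d Xts Xts] N_def .
    then show ?thesis using period_pos by (auto simp: tlin_def fun_eq_iff)
  qed
  \<comment> \<open>\<open>\<rho>\<^sub>1\<close> reverses the orbit\<close>
  have RX: "R ?X = tlin (-1) ?X 0 ?X"
  proof -
    have "\<rho>\<^sub>1 \<circ> v = (\<lambda>t. v (- t))" using reversed[of "- t" for t] by (auto simp: fun_eq_iff)
    then have 1: "has_velocity A (\<lambda>t. v (- t)) 0 (dmap A \<rho>\<^sub>1 ?P (tlin \<tau> ?X 0 ?X))" using velocity_map[OF vel \<rho>d] by simp
    have 2: "has_velocity A (\<lambda>t. v (- t)) 0 (tlin (- \<tau>) ?X 0 ?X)"
      using velocity_affine[of v "-1" 0 0 "tlin \<tau> ?X 0 ?X"] vel by (simp add: tlin_def)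
    from velocity_unique[OF 1 2] have eq: "tlin \<tau> (R ?X) 0 (R ?X) = tlin (- \<tau>) ?X 0 ?X"
      unfolding dmap_tlin[OF \<rho>d Xts Xts] R_def .
    have "R ?X c = - ?X c" for c
    proof -
      have "\<tau> *\<^sub>R (R ?X c + ?X c) = 0"
        using fun_cong[OF eq, of c] by (simp add: tlin_def scaleR_add_right)
      then show ?thesis using period_pos by (simp add: eq_neg_iff_add_eq_0)
    qed
    then show ?thesis by (simp add: tlin_def fun_eq_iff)
  qed
  have NN: "dmap A (ham_flow A \<omega> H (real j * \<tau>)) ?P Y = N (N Y)" if "Y \<in> tangent_space A ?P" for Y
  proof -
    have "dmap A (ham_flow A \<omega> H (real j * \<tau>)) ?P = dmap A (\<Psi> \<circ> \<Psi>) ?P" by (rule mdiff_cong(2)[OF square])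
    then show ?thesis using mdiff_comp(2)[of \<Psi> ?P \<Psi>, OF \<Psi>d _ that] \<Psi>v[of 0] \<Psi>d by (simp add: N_def)
  qed
  have NRNR: "N (R (N (R Y))) = Y" if Y: "Y \<in> tangent_space A ?P" for Y
  proof -
    have 1: "mdiff (\<Psi> \<circ> \<rho>\<^sub>1) ?P" "dmap A (\<Psi> \<circ> \<rho>\<^sub>1) ?P Y = N (R Y)"
      using mdiff_comp[of \<rho>\<^sub>1 ?P \<Psi>] \<rho>d \<Psi>d \<rho>P Y by (simp_all add: N_def R_def)
    have 2: "mdiff (\<rho>\<^sub>1 \<circ> (\<Psi> \<circ> \<rho>\<^sub>1)) ?P" "dmap A (\<rho>\<^sub>1 \<circ> (\<Psi> \<circ> \<rho>\<^sub>1)) ?P Y = R (N (R Y))"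
      using mdiff_comp[of "\<Psi> \<circ> \<rho>\<^sub>1" ?P \<rho>\<^sub>1] 1 \<rho>d \<rho>P \<Psi>v[of 0] Y by (simp_all add: R_def)
    have "dmap A (\<Psi> \<circ> (\<rho>\<^sub>1 \<circ> (\<Psi> \<circ> \<rho>\<^sub>1))) ?P Y = N (R (N (R Y)))"
      using mdiff_comp(2)[of "\<rho>\<^sub>1 \<circ> (\<Psi> \<circ> \<rho>\<^sub>1)" ?P \<Psi>] 2 \<Psi>d \<rho>P \<Psi>v[of 0] Y by (simp add: N_def)
    moreover have "dmap A (\<Psi> \<circ> (\<rho>\<^sub>1 \<circ> (\<Psi> \<circ> \<rho>\<^sub>1))) ?P = dmap A id ?P" by (rule mdiff_cong(2)[OF inverse])
    ultimately show ?thesis using mdiff_id(2)[OF Y] by simp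
  qed
  have RR: "R (R Y) = Y" if Y: "Y \<in> tangent_space A ?P" for Y
  proof -
    have "\<rho>\<^sub>1 \<circ> \<rho>\<^sub>1 = id" using \<rho>\<rho> by auto
    then show ?thesis using mdiff_comp(2)[of \<rho>\<^sub>1 ?P \<rho>\<^sub>1, OF \<rho>d \<rho>d Y] mdiff_id(2)[OF Y] \<rho>P by (simp add: R_def)
  qed
  have "monodromy_trace A \<omega> H (orbit_cover j v) (real j * \<tau>)
      = quotient_trace V ?X (reduced_monodromy A \<omega> H (orbit_cover j v) (real j * \<tau>))"
    unfolding monodromy_trace_def level[symmetric] by (simp add: orbit_cover_def)
  also have "\<dots> \<ge> -2"
  proof (rule quotient_trace_square_ge[OF Vlin XV basis, where N=N and R=R])
    show "N Y \<in> V" if "Y \<in> V" for Y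
      using that Nts[of Y] dfun_dmap[OF smooth_H \<Psi>d H\<Psi>, of Y] \<Psi>v[of 0] unfolding V_def N_def by simp
    show "R Y \<in> V" if "Y \<in> V" for Y
      using that Rts[of Y] dfun_dmap[OF smooth_H \<rho>d _, of ?P Y] fun_cong[OF inv1(2)] \<rho>P unfolding V_def R_def by simp
    show "N (tlin a Y b Z) = tlin a (N Y) b (N Z)" if "Y \<in> V" "Z \<in> V" for a Y b Z
      unfolding N_def by (rule dmap_tlin[OF \<Psi>d Vts[OF that(1)] Vts[OF that(2)]])
    show "R (tlin a Y b Z) = tlin a (R Y) b (R Z)" if "Y \<in> V" "Z \<in> V" for a Y b Z
      unfolding R_def by (rule dmap_tlin[OF \<rho>d Vts[OF that(1)] Vts[OF that(2)]])
    show "N ?X = tlin 1 ?X 0 ?X" using NX by (simp add: tlin_def)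
    show "R ?X = tlin (-1) ?X 0 ?X" by (rule RX)
    show "R (R Y) = Y" "N (R (N (R Y))) = Y" if "Y \<in> V" for Y using RR NRNR Vts[OF that] by auto
    show "reduced_monodromy A \<omega> H (orbit_cover j v) (real j * \<tau>) (line_coset ?X Y) = line_coset ?X (N (N Y))"
      if Y: "Y \<in> V" for Y
    proof -
      have "dmap A (ham_flow A \<omega> H (real j * \<tau>)) ?P (tlin 1 Y s ?X) = tlin 1 (N (N Y)) s ?X" for s
        using NN[OF tlin_in_tangent_space[OF Vts[OF Y] Xts]] dmap_tlin[OF \<Psi>d Vts[OF Y] Xts]
          dmap_tlin[OF \<Psi>d Nts[OF Vts[OF Y]] Xts] NX by (simp add: N_def)
      then show ?thesis unfolding reduced_monodromy_def line_coset_def by (auto simp: orbit_cover_def image_def)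
    qed
  qed
  finally show ?thesis .
qed

lemma cover_good:
  assumes "k \<ge> 1"
  shows "good_orbit A \<omega> H (orbit_cover k v) (real k * \<tau>)"
  unfolding good_orbit_def
proof
  show "periodic_orbit A \<omega> H (orbit_cover k v) (real k * \<tau>)"
    unfolding periodic_orbit_def orbit_cover_def
  proof (intro conjI allI)
    show "real k * \<tau> > 0" using assms period_pos by simp
    show "v (real k * (t + 1)) = v (real k * t)" for t
      using periodic_orbit_int[OF orbit, of "real k * t" "int k"] by (simp add: distrib_left)
    have "has_velocity A v (real k * t + 0) (\<lambda>c. \<tau> *\<^sub>R ham_vf A \<omega> H (v (real k * t + 0)) c)" for t
      using orbit unfolding periodic_orbit_def by blast
    from velocity_affine[OF this]
    show "has_velocity A (\<lambda>t. v (real k * t)) t (\<lambda>c. (real k * \<tau>) *\<^sub>R ham_vf A \<omega> H (v (real k * t)) c)" for t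
      by simp
  qed
  show "\<not> bad_orbit A \<omega> H (orbit_cover k v) (real k * \<tau>)"
  proof
    assume "bad_orbit A \<omega> H (orbit_cover k v) (real k * \<tau>)"
    then obtain w \<kappa> m where w: "negative_hyperbolic A \<omega> H w \<kappa>" "m > 0" "orbit_cover k v = orbit_cover m w" "real k * \<tau> = real m * \<kappa>"
      unfolding bad_orbit_def by blast
    have w_eq: "w t = v (real k / real m * t)" for t
      using fun_cong[OF w(3), of "t / real m"] w(2) by (simp add: orbit_cover_def)
    \<comment> \<open>the period of \<open>w\<close> makes \<open>k / m\<close> an integer, as \<open>v\<close> is injective on the circle\<close>
    have "w (0 + 1) = w 0" using w(1) unfolding negative_hyperbolic_def periodic_orbit_def by blast
    then have "v (real k / real m) = v 0" by (simp add: w_eq)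
    then have "real k / real m \<in> \<int>" using orbit_inj by fastforce
    then obtain i where i: "real k / real m = of_int i" by (rule Ints_cases)
    have "real k / real m > 0" using assms w(2) by simp
    then have "i > 0" using i by simp
    define j where "j = nat i"
    have j: "real k / real m = real j" "j \<ge> 1" using i \<open>i > 0\<close> by (simp_all add: j_def)
    have "w = orbit_cover j v" using w_eq j by (simp add: orbit_cover_def fun_eq_iff)
    moreover have "\<kappa> = real j * \<tau>" using w(2,4) j(1) by (simp add: field_simps)
    ultimately have "monodromy_trace A \<omega> H w \<kappa> \<ge> -2" using monodromy_trace_cover_ge[OF j(2)] by simp
    then show False using w(1) unfolding negative_hyperbolic_def by simp
  qed
qed

end

theorem mainTheorem6:
  fixes A :: "('m::{t2_space, second_countable_topology}, real ^ 4) chart set"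
    and \<omega> :: "('m, real ^ 4) form2"
    and \<rho>\<^sub>1 \<rho>\<^sub>2 :: "'m \<Rightarrow> 'm"
    and H :: "'m \<Rightarrow> real"
    and v :: "real \<Rightarrow> 'm"
    and \<tau> :: real
    and k :: nat
  assumes "symplectic_manifold A \<omega>"
    and "antisymplectic_involution A \<omega> \<rho>\<^sub>1"
    and "antisymplectic_involution A \<omega> \<rho>\<^sub>2"
    and "\<rho>\<^sub>1 \<noteq> \<rho>\<^sub>2"
    and "\<rho>\<^sub>1 \<circ> \<rho>\<^sub>2 = \<rho>\<^sub>2 \<circ> \<rho>\<^sub>1"
    and "smooth_fun A H"
    and "H \<circ> \<rho>\<^sub>1 = H"
    and "H \<circ> \<rho>\<^sub>2 = H"
    and "doubly_symmetric_orbit A \<omega> H \<rho>\<^sub>1 \<rho>\<^sub>2 v \<tau>"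
    and "k \<ge> 1"
  shows "good_orbit A \<omega> H (orbit_cover k v) (real k * \<tau>)"
proof -
  interpret doubly_symmetric A \<omega> H \<rho>\<^sub>1 \<rho>\<^sub>2 v \<tau>
    by unfold_locales (use assms in \<open>simp_all add: symplectic_manifold_def\<close>)
  show ?thesis using \<open>k \<ge> 1\<close> by (rule cover_good)
qed

end
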